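(* Let $p\ge 1$, let $\boldsymbol\mu\in\mathbb R^p$, let $\boldsymbol\Sigma$ be a $p\times p$ positive definite matrix, $\boldsymbol\lambda\in\mathbb R^p$, $\tau\in\mathbb R$, let $\mathbf a=(a_1,\dots,a_p)^\top$, $\mathbf b=(b_1,\dots,b_p)^\top$ be (possibly infinite) lower and upper truncation limits, and let $\boldsymbol\kappa=(k_1,\dots,k_p)^\top$ be a vector of nonnegative integers. Then for every $i=1,\dots,p$, $$\mathcal F^p_{\boldsymbol\kappa+\mathbf e_i}(\mathbf a,\mathbf b;\boldsymbol\mu,\boldsymbol\Sigma,\boldsymbol\lambda,\tau)=\mu_i\,\mathcal F^p_{\boldsymbol\kappa}(\mathbf a,\mathbf b;\boldsymbol\mu,\boldsymbol\Sigma,\boldsymbol\lambda,\tau)+\delta_i\,F^p_{\boldsymbol\kappa}(\mathbf a,\mathbf b;\boldsymbol\mu-\boldsymbol\mu_b,\boldsymbol\Gamma)+\mathbf e_i^\top\boldsymbol\Sigma\,\mathbf d_{\boldsymbol\kappa},$$ where $\boldsymbol\delta=(\delta_1,\dots,\delta_p)^\top=\eta\,\boldsymbol\Sigma^{1/2}\boldsymbol\lambda$, $\boldsymbol\mu_b=\tilde\tau\boldsymbol\Delta$, $\boldsymbol\Gamma=\boldsymbol\Sigma-\boldsymbol\Delta\boldsymbol\Delta^\top$, and $\mathbf d_{\boldsymbol\kappa}$ is the $p$-vector with $j$th element $$\begin{aligned}d_{\boldsymbol\kappa,j}={}&k_j\,\mathcal F^p_{\boldsymbol\kappa-\mathbf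 e_j}(\mathbf a,\mathbf b;\boldsymbol\mu,\boldsymbol\Sigma,\boldsymbol\lambda,\tau)\\&+a_j^{k_j}\,ESN_1(a_j;\mu_j,\sigma_j^2,c_j\sigma_j\tilde\varphi_j,c_j\tau)\,\mathcal F^{p-1}_{\boldsymbol\kappa_{(j)}}(\mathbf a_{(j)},\mathbf b_{(j)};\tilde{\boldsymbol\mu}_j^{\mathbf a},\tilde{\boldsymbol\Sigma}_j,\tilde{\boldsymbol\Sigma}_j^{1/2}\boldsymbol\varphi_{(j)},\tilde\tau_j^{\mathbf a})\\&-b_j^{k_j}\,ESN_1(b_j;\mu_j,\sigma_j^2,c_j\sigma_j\tilde\varphi_j,c_j\tau)\,\mathcal F^{p-1}_{\boldsymbol\kappa_{(j)}}(\mathbf a_{(j)},\mathbf b_{(j)};\tilde{\boldsymbol\mu}_j^{\mathbf b},\tilde{\boldsymbol\Sigma}_j,\tilde{\boldsymbol\Sigma}_j^{1/2}\boldsymbol\varphi_{(j)},\tilde\tau_j^{\mathbf b}),\end{aligned}$$ with $$\tilde{\boldsymbol\mu}_j^{\mathbf a}=\boldsymbol\mu_{(j)}+\boldsymbol\Sigma_{(j),j}\frac{a_j-\mu_j}{\sigma_j^2},\quad \tilde{\boldsymbol\mu}_j^{\mathbf b}=\boldsymbol\mu_{(j)}+\boldsymbol\Sigma_{(j),j}\frac{b_j-\mu_j}{\sigma_j^2},\quad \tilde\varphi_j=\varphi_j+\frac1{\sigma_j^2}\boldsymbol\Sigma_{j,(j)}\boldsymbol\varphi_{(j)},$$ $$\tilde{\boldsymbol\Sigma}_j=\boldsymbol\Sigma_{(j),(j)}-\frac1{\sigma_j^2}\boldsymbol\Sigma_{(j),j}\boldsymbol\Sigma_{j,(j)},\quad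 c_j=\frac1{(1+\boldsymbol\varphi_{(j)}^\top\tilde{\boldsymbol\Sigma}_j\boldsymbol\varphi_{(j)})^{1/2}},\quad \tilde\tau_j^{\mathbf a}=\tau+\tilde\varphi_j(a_j-\mu_j),\quad \tilde\tau_j^{\mathbf b}=\tau+\tilde\varphi_j(b_j-\mu_j).$$
   Context: $\phi_p(\cdot;\boldsymbol\mu,\boldsymbol\Sigma)$ is the density of the $p$-variate normal distribution with mean $\boldsymbol\mu$ and covariance $\boldsymbol\Sigma$; $\phi_1(\cdot;m,v)$ is the univariate normal density with mean $m$ and variance $v$; $\Phi_1$ is the standard univariate normal cdf. $\boldsymbol\Sigma^{1/2}$ is the symmetric positive definite square root of $\boldsymbol\Sigma$, and $\boldsymbol\Sigma^{-1/2}$ its inverse. Extended skew-normal (ESN) density: $$ESN_p(\mathbf y;\boldsymbol\mu,\boldsymbol\Sigma,\boldsymbol\lambda,\tau)=\xi^{-1}\phi_p(\mathbf y;\boldsymbol\mu,\boldsymbol\Sigma)\,\Phi_1\big(\tau+\boldsymbol\lambda^\top\boldsymbol\Sigma^{-1/2}(\mathbf y-\boldsymbol\mu)\big),\qquad \xi=\Phi_1\big(\tau/(1+\boldsymbol\lambda^\top\boldsymbol\lambda)^{1/2}\big).$$ Further constants: $\tilde\tau=\tau/(1+\boldsymbol\lambda^\top\boldsymbol\lambda)^{1/2}$, $\boldsymbol\Delta=\boldsymbol\Sigma^{1/2}\boldsymbol\lambda/(1+\boldsymbol\lambda^\top\boldsymbol\lambda)^{1/2}$, $\eta=\phi_1(\tau;0,1+\boldsymbol\lambda^\top\boldsymbol\lambda)/\xi$,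 $\boldsymbol\varphi=(\varphi_1,\dots,\varphi_p)^\top=\boldsymbol\Sigma^{-1/2}\boldsymbol\lambda$. Integrals: with $\mathbf x^{\boldsymbol\kappa}=x_1^{k_1}\cdots x_p^{k_p}$, $$\mathcal F^p_{\boldsymbol\kappa}(\mathbf a,\mathbf b;\boldsymbol\mu,\boldsymbol\Sigma,\boldsymbol\lambda,\tau)=\int_{\mathbf a}^{\mathbf b}\mathbf x^{\boldsymbol\kappa}ESN_p(\mathbf x;\boldsymbol\mu,\boldsymbol\Sigma,\boldsymbol\lambda,\tau)\,d\mathbf x,\qquad F^p_{\boldsymbol\kappa}(\mathbf a,\mathbf b;\boldsymbol\mu,\boldsymbol\Sigma)=\int_{\mathbf a}^{\mathbf b}\mathbf x^{\boldsymbol\kappa}\phi_p(\mathbf x;\boldsymbol\mu,\boldsymbol\Sigma)\,d\mathbf x,$$ where $\int_{\mathbf a}^{\mathbf b}=\int_{a_1}^{b_1}\cdots\int_{a_p}^{b_p}$. When $p=1$, the factors $\mathcal F^{0}$ are equal to $1$ (and terms involving empty vectors are $0$). Notation: $\mathbf e_i$ is the $i$th standard basis vector; $\mathbf v_{(j)}$ is the vector $\mathbf v$ with its $j$th entry removed; $\sigma_j^2=\Sigma_{jj}$, $\sigma_j=\sqrt{\sigma_j^2}$; $\boldsymbol\Sigma_{(j),j}$ is the $j$th column of $\boldsymbol\Sigma$ with its $j$th entry removed, $\boldsymbol\Sigma_{j,(j)}$ its transpose, and $\boldsymbol\Sigma_{(j),(j)}$ is $\boldsymbol\Sigma$ with $j$th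 row and $j$th column removed. Conventions: when $k_j=0$ the first term of $d_{\boldsymbol\kappa,j}$ is $0$; when $a_j=-\infty$ the second term is $0$; when $b_j=+\infty$ the third term is $0$. *)

theory Defs
  imports "HOL-Probability.Probability" "Jordan_Normal_Form.Gauss_Jordan_Elimination"
    "Jordan_Normal_Form.Determinant"
begin

(* Vectors and matrices are those of Jordan_Normal_Form, whose dimension is a value, so that
   p- and (p-1)-dimensional objects (including p - 1 = 0) can occur in one formula.
   Coordinates are numbered 0, ..., p - 1. *)
unbundle no vec_syntax
unbundle no inner_syntax
hide_const (open) Determinants.det Finite_Cartesian_Product.vec Finite_Cartesian_Product.row
  Finite_Cartesian_Product.column Finite_Cartesian_Product.mat
hide_type (open) Finite_Cartesian_Product.vec

subsection \<open>Matrices\<close>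

definition pos_def_mat :: "nat \<Rightarrow> real mat \<Rightarrow> bool" where
  "pos_def_mat n A \<longleftrightarrow> A \<in> carrier_mat n n \<and> transpose_mat A = A \<and>
     (\<forall>v \<in> carrier_vec n. v \<noteq> 0\<^sub>v n \<longrightarrow> v \<bullet> (A *\<^sub>v v) > 0)"

(* meaningful for positive definite A, where the square root exists and is unique *)
definition sqrt_mat :: "real mat \<Rightarrow> real mat" where
  "sqrt_mat A = (THE R. pos_def_mat (dim_row A) R \<and> R * R = A)"

definition inv_mat :: "real mat \<Rightarrow> real mat" where
  "inv_mat A = the (mat_inverse A)"

definition outer_prod :: "real vec \<Rightarrow> real vec \<Rightarrow> real mat" where
  "outer_prod u v = mat (dim_vec u) (dim_vec v) (\<lambda>(i, k). u $ i * v $ k)"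

(* companion of mat_delete for vectors *)
definition vec_delete :: "nat \<Rightarrow> 'a vec \<Rightarrow> 'a vec" where
  "vec_delete j v = vec (dim_vec v - 1) (\<lambda>i. v $ (if i < j then i else Suc i))"

subsection \<open>Densities\<close>

definition mvn_density :: "real vec \<Rightarrow> real mat \<Rightarrow> real vec \<Rightarrow> real" where
  "mvn_density \<mu> \<Sigma> y =
     exp (- ((y - \<mu>) \<bullet> (inv_mat \<Sigma> *\<^sub>v (y - \<mu>))) / 2) / sqrt ((2 * pi) ^ dim_vec \<mu> * det \<Sigma>)"

definition std_normal_cdf :: "real \<Rightarrow> real" where
  "std_normal_cdf x = cdf std_normal_distribution x"

definition esn_xi :: "real vec \<Rightarrow> real \<Rightarrow> real" where
  "esn_xi l \<tau> = std_normal_cdf (\<tau> / sqrt (1 + l \<bullet> l))"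

definition esn_density :: "real vec \<Rightarrow> real mat \<Rightarrow> real vec \<Rightarrow> real \<Rightarrow> real vec \<Rightarrow> real" where
  "esn_density \<mu> \<Sigma> l \<tau> y =
     inverse (esn_xi l \<tau>) * mvn_density \<mu> \<Sigma> y *
     std_normal_cdf (\<tau> + l \<bullet> (inv_mat (sqrt_mat \<Sigma>) *\<^sub>v (y - \<mu>)))"

(* the case of dimension one, with scalar arguments; v is the variance *)
definition esn1_density :: "real \<Rightarrow> real \<Rightarrow> real \<Rightarrow> real \<Rightarrow> real \<Rightarrow> real" where
  "esn1_density m v l \<tau> y =
     esn_density (vec 1 (\<lambda>_. m)) (mat 1 1 (\<lambda>_. v)) (vec 1 (\<lambda>_. l)) \<tau> (vec 1 (\<lambda>_. y))"

subsection \<open>Truncated product integrals\<close>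

definition box_moment ::
    "nat vec \<Rightarrow> ereal vec \<Rightarrow> ereal vec \<Rightarrow> (real vec \<Rightarrow> real) \<Rightarrow> real" where
  "box_moment \<kappa> a b f =
     (let p = dim_vec \<kappa> in
      set_lebesgue_integral (\<Pi>\<^sub>M i\<in>{..<p}. lborel)
        {x. \<forall>i<p. a $ i \<le> ereal (x i) \<and> ereal (x i) \<le> b $ i}
        (\<lambda>x. (\<Prod>i<p. x i ^ (\<kappa> $ i)) * f (vec p x)))"

definition mvn_moment ::
    "nat vec \<Rightarrow> ereal vec \<Rightarrow> ereal vec \<Rightarrow> real vec \<Rightarrow> real mat \<Rightarrow> real" where
  "mvn_moment \<kappa> a b \<mu> \<Sigma> = box_moment \<kappa> a b (mvn_density \<mu> \<Sigma>)"

definition esn_moment ::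
    "nat vec \<Rightarrow> ereal vec \<Rightarrow> ereal vec \<Rightarrow> real vec \<Rightarrow> real mat \<Rightarrow> real vec \<Rightarrow> real \<Rightarrow> real" where
  "esn_moment \<kappa> a b \<mu> \<Sigma> l \<tau> = box_moment \<kappa> a b (esn_density \<mu> \<Sigma> l \<tau>)"

lemma std_normal_cdf_pos: "std_normal_cdf x > 0"
proof -
  interpret N: prob_space "density lborel std_normal_density"
    by (rule prob_space_normal_density) simp
  have nz: "std_normal_density y \<noteq> 0" for y
    using normal_density_pos[of 1 0 y] by simp
  have "emeasure std_normal_distribution {..x} \<noteq> 0"
  proof
    assume "emeasure std_normal_distribution {..x} = 0"
    then have "AE y in lborel. y \<in> {..x} \<longrightarrow> ennreal (std_normal_density y) \<le> 0"
      by (subst (asm) emeasure_density)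
        (auto simp: nn_integral_0_iff_AE indicator_def split: if_splits)
    then have "AE y in lborel. y \<notin> {..x}"
      by (rule eventually_mono) (auto simp: nz)
    then have "emeasure lborel {..x} = 0"
      using AE_iff_null[of lborel "\<lambda>y. y \<notin> {..x}"] by (auto simp: null_sets_def atMost_def not_less)
    moreover have "emeasure lborel {x-1..x} \<le> emeasure lborel {..x}"
      by (intro emeasure_mono) auto
    ultimately show False by simp
  qed
  then show ?thesis
    unfolding std_normal_cdf_def cdf_def by (simp add: N.emeasure_eq_measure zero_less_measure_iff)
qed

(* The integral over R^0 is the one-point evaluation, so the convention that the factors of
   dimension p - 1 are 1 for p = 1 needs no separate clause. *)
lemma esn_moment_dim0:
  assumes "\<kappa> \<in> carrier_vec 0" "\<mu> \<in> carrier_vec 0" "l \<in> carrier_vec 0" "\<Sigma> \<in> carrier_mat 0 0"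
  shows "esn_moment \<kappa> a b \<mu> \<Sigma> l \<tau> = 1"
proof -
  have 0: "u \<bullet> v = 0" if "dim_vec v = 0" for u v :: "real vec"
    using that by (simp add: scalar_prod_def)
  have R: "sqrt_mat \<Sigma> = 1\<^sub>m 0"
  proof -
    have "\<exists>!R. pos_def_mat 0 R \<and> R * R = \<Sigma>"
      using assms(4) by (intro ex1I[of _ "1\<^sub>m 0"]) (auto simp: pos_def_mat_def)
    from theI'[OF this] show ?thesis using assms(4) by (auto simp: sqrt_mat_def pos_def_mat_def)
  qed
  have E: "M = 1\<^sub>m 0" if "M \<in> carrier_mat 0 0" for M :: "real mat"
    using that by auto
  have I: "inv_mat (1\<^sub>m 0) = 1\<^sub>m 0"
  proof (cases "mat_inverse (1\<^sub>m 0 :: real mat)")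
    case None
    from mat_inverse(1)[OF one_carrier_mat None] show ?thesis
      by (auto simp: Units_def ring_mat_def)
  next
    case (Some B)
    from mat_inverse(2)[OF one_carrier_mat Some] Some show ?thesis by (auto simp: inv_mat_def)
  qed
  have det: "det \<Sigma> = 1" using E[OF assms(4)] by simp
  have D: "esn_density \<mu> \<Sigma> l \<tau> y = 1" if "dim_vec y = 0" for y
  proof -
    have s: "\<Sigma> = 1\<^sub>m 0" using E[OF assms(4)] .
    have "mvn_density \<mu> \<Sigma> y = 1" using that assms(2) by (simp add: mvn_density_def det 0 s I)
    then show ?thesis using that assms std_normal_cdf_pos[of \<tau>]
      by (simp add: esn_density_def esn_xi_def 0 R I)
  qed
  show ?thesis using assms(1)
    by (simp add: esn_moment_def box_moment_def D set_lebesgue_integral_def PiM_empty lebesgue_integral_count_space_finite)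
qed

subsection \<open>Constants of the recurrence\<close>

definition esn_tau :: "real vec \<Rightarrow> real \<Rightarrow> real" where
  "esn_tau l \<tau> = \<tau> / sqrt (1 + l \<bullet> l)"

definition esn_Delta :: "real mat \<Rightarrow> real vec \<Rightarrow> real vec" where
  "esn_Delta \<Sigma> l = (1 / sqrt (1 + l \<bullet> l)) \<cdot>\<^sub>v (sqrt_mat \<Sigma> *\<^sub>v l)"

(* normal_density takes the standard deviation, not the variance *)
definition esn_eta :: "real vec \<Rightarrow> real \<Rightarrow> real" where
  "esn_eta l \<tau> = normal_density 0 (sqrt (1 + l \<bullet> l)) \<tau> / esn_xi l \<tau>"

definition esn_delta :: "real mat \<Rightarrow> real vec \<Rightarrow> real \<Rightarrow> real vec" where
  "esn_delta \<Sigma> l \<tau> = esn_eta l \<tau> \<cdot>\<^sub>v (sqrt_mat \<Sigma> *\<^sub>v l)"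

definition esn_mu_b :: "real mat \<Rightarrow> real vec \<Rightarrow> real \<Rightarrow> real vec" where
  "esn_mu_b \<Sigma> l \<tau> = esn_tau l \<tau> \<cdot>\<^sub>v esn_Delta \<Sigma> l"

definition esn_Gamma :: "real mat \<Rightarrow> real vec \<Rightarrow> real mat" where
  "esn_Gamma \<Sigma> l = \<Sigma> - outer_prod (esn_Delta \<Sigma> l) (esn_Delta \<Sigma> l)"

definition esn_phi :: "real mat \<Rightarrow> real vec \<Rightarrow> real vec" where
  "esn_phi \<Sigma> l = inv_mat (sqrt_mat \<Sigma>) *\<^sub>v l"

definition cond_mean :: "real vec \<Rightarrow> real mat \<Rightarrow> nat \<Rightarrow> real \<Rightarrow> real vec" where
  "cond_mean \<mu> \<Sigma> j x =
     vec_delete j \<mu> + ((x - \<mu> $ j) / \<Sigma> $$ (j, j)) \<cdot>\<^sub>v vec_delete j (col \<Sigma> j)"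

definition cond_cov :: "real mat \<Rightarrow> nat \<Rightarrow> real mat" where
  "cond_cov \<Sigma> j =
     mat_delete \<Sigma> j j -
     (1 / \<Sigma> $$ (j, j)) \<cdot>\<^sub>m outer_prod (vec_delete j (col \<Sigma> j)) (vec_delete j (row \<Sigma> j))"

definition cond_phi :: "real mat \<Rightarrow> real vec \<Rightarrow> nat \<Rightarrow> real" where
  "cond_phi \<Sigma> l j =
     esn_phi \<Sigma> l $ j +
     (1 / \<Sigma> $$ (j, j)) * (vec_delete j (row \<Sigma> j) \<bullet> vec_delete j (esn_phi \<Sigma> l))"

definition esn_c :: "real mat \<Rightarrow> real vec \<Rightarrow> nat \<Rightarrow> real" where
  "esn_c \<Sigma> l j =
     1 / sqrt (1 + vec_delete j (esn_phi \<Sigma> l) \<bullet> (cond_cov \<Sigma> j *\<^sub>v vec_delete j (esn_phi \<Sigma> l)))"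

definition cond_tau :: "real vec \<Rightarrow> real mat \<Rightarrow> real vec \<Rightarrow> real \<Rightarrow> nat \<Rightarrow> real \<Rightarrow> real" where
  "cond_tau \<mu> \<Sigma> l \<tau> j x = \<tau> + cond_phi \<Sigma> l j * (x - \<mu> $ j)"

(* the contribution of the face x_j = x, where x is a finite endpoint a_j or b_j *)
definition boundary_term ::
    "nat vec \<Rightarrow> ereal vec \<Rightarrow> ereal vec \<Rightarrow> real vec \<Rightarrow> real mat \<Rightarrow> real vec \<Rightarrow> real \<Rightarrow> nat \<Rightarrow> real \<Rightarrow> real"
  where
  "boundary_term \<kappa> a b \<mu> \<Sigma> l \<tau> j x =
     x ^ (\<kappa> $ j) *
     esn1_density (\<mu> $ j) (\<Sigma> $$ (j, j))
       (esn_c \<Sigma> l j * sqrt (\<Sigma> $$ (j, j)) * cond_phi \<Sigma> l j) (esn_c \<Sigma> l j * \<tau>) x *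
     esn_moment (vec_delete j \<kappa>) (vec_delete j a) (vec_delete j b)
       (cond_mean \<mu> \<Sigma> j x) (cond_cov \<Sigma> j)
       (sqrt_mat (cond_cov \<Sigma> j) *\<^sub>v vec_delete j (esn_phi \<Sigma> l))
       (cond_tau \<mu> \<Sigma> l \<tau> j x)"

(* For k_j = 0 the subtraction of the unit vector is truncated, but the factor k_j is 0. *)
definition esn_d ::
    "nat vec \<Rightarrow> ereal vec \<Rightarrow> ereal vec \<Rightarrow> real vec \<Rightarrow> real mat \<Rightarrow> real vec \<Rightarrow> real \<Rightarrow> real vec" where
  "esn_d \<kappa> a b \<mu> \<Sigma> l \<tau> =
     vec (dim_vec \<kappa>) (\<lambda>j.
       real (\<kappa> $ j) * esn_moment (\<kappa> - unit_vec (dim_vec \<kappa>) j) a b \<mu> \<Sigma> l \<tau>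
       + (if a $ j = -\<infinity> then 0 else boundary_term \<kappa> a b \<mu> \<Sigma> l \<tau> j (real_of_ereal (a $ j)))
       - (if b $ j = \<infinity> then 0 else boundary_term \<kappa> a b \<mu> \<Sigma> l \<tau> j (real_of_ereal (b $ j))))"

end

theory Submission
  imports Defs
begin

text \<open>
  Write \<open>g\<close> for the extended skew-normal density and \<open>h = \<Sigma>\<^sup>-\<^sup>1\<^sup>/\<^sup>2 l\<close> for the vector \<open>esn_phi\<close>, so
  that \<open>g(x)\<close> is a constant times \<open>\<phi>(x; \<mu>, \<Sigma>) \<Phi>(\<tau> + h \<bullet> (x - \<mu>))\<close>.  The product rule gives
  \<open>\<nabla> g = - \<Sigma>\<inverse> (x - \<mu>) g + h r\<close> with \<open>r = \<xi>\<inverse> \<phi>(x; \<mu>, \<Sigma>) \<phi>\<^sub>1(\<tau> + h \<bullet> (x - \<mu>))\<close>, and therefore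
  \<open>(x - \<mu>) g = \<Sigma> h r - \<Sigma> \<nabla> g\<close>.  Multiply the \<open>i\<close>th coordinate of this identity by the monomial
  \<open>x\<^sup>\<kappa>\<close> and integrate over the truncation box.  Three things remain to be identified.

  \<^item> Completing the square in the exponent of \<open>r\<close> turns it into \<open>\<eta>\<close> times the density of the
    normal distribution with mean \<open>\<mu> - \<mu>\<^sub>b\<close> and covariance \<open>\<Gamma>\<close> (\<open>mvn_density_mult_normal\<close>);
    since \<open>\<Sigma> h = \<Sigma>\<^sup>1\<^sup>/\<^sup>2 l\<close>, this is the term with coefficient \<open>\<delta>\<^sub>i\<close>.
  \<^item> Integrating \<open>x\<^sup>\<kappa> \<partial>\<^sub>j g\<close> by parts in the \<open>j\<close>th coordinate produces
    \<open>- k\<^sub>j\<close> times the moment of order \<open>\<kappa> - e\<^sub>j\<close> and the integrals of \<open>x\<^sup>\<kappa> g\<close> over the two faces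
    \<open>x\<^sub>j = a\<^sub>j\<close> and \<open>x\<^sub>j = b\<^sub>j\<close>; an infinite face contributes nothing, because a polynomial times \<open>g\<close>
    decays exponentially (\<open>integral_box_partial_derivative\<close>, \<open>poly_growth_mvn_bound\<close>).
  \<^item> On a face, \<open>g\<close> is the product of a univariate extended skew-normal density at \<open>x\<^sub>j\<close> and a
    density of the same family in the other coordinates (\<open>esn_density_condition\<close>).  This
    is conditioning on \<open>x\<^sub>j\<close>: the Schur complement \<open>cond_cov\<close> splits the quadratic form and the
    determinant, and the same splitting applied to \<open>h \<bullet> \<Sigma> h\<close> makes the normalising constants
    agree.

  All of this presupposes that a positive definite matrix has exactly one positive definite square
  root, since the densities are parametrised through it.  The root enters the densities through the
  identities \<open>\<Sigma>\<^sup>1\<^sup>/\<^sup>2 u \<bullet> \<Sigma>\<^sup>1\<^sup>/\<^sup>2 v = u \<bullet> \<Sigma> v\<close> and \<open>\<Sigma>\<^sup>1\<^sup>/\<^sup>2 u \<bullet> \<Sigma>\<^sup>-\<^sup>1\<^sup>/\<^sup>2 v = u \<bullet> v\<close>.  Its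
  existence comes from a contraction (\<open>contraction_sqrt_limit\<close>), its uniqueness from a trace
  identity (\<open>pos_def_sqrt_unique\<close>).
\<close>

text \<open>The dimension \<open>p - 1\<close> of the faces should stay in this form under simplification.\<close>

declare One_nat_def [simp del]

section \<open>Positive definite matrices\<close>

lemma pos_def_carrier: "pos_def_mat n A \<Longrightarrow> A \<in> carrier_mat n n"
  by (simp add: pos_def_mat_def)

lemma pos_def_pos:
  "pos_def_mat n A \<Longrightarrow> v \<in> carrier_vec n \<Longrightarrow> v \<noteq> 0\<^sub>v n \<Longrightarrow> v \<bullet> (A *\<^sub>v v) > 0"
  by (simp add: pos_def_mat_def)

lemma pos_def_nonneg:
  assumes "pos_def_mat n A" "v \<in> carrier_vec n"
  shows "v \<bullet> (A *\<^sub>v v) \<ge> 0"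
proof (cases "v = 0\<^sub>v n")
  case True
  then show ?thesis using pos_def_carrier[OF assms(1)] by simp
next
  case False
  then show ?thesis using pos_def_pos[OF assms False] by simp
qed

lemma symmetric_form:
  fixes A :: "real mat"
  assumes "A \<in> carrier_mat n n" "transpose_mat A = A" "u \<in> carrier_vec n" "v \<in> carrier_vec n"
  shows "u \<bullet> (A *\<^sub>v v) = (A *\<^sub>v u) \<bullet> v"
  using transpose_vec_mult_scalar[OF assms(1,4,3)] assms(2) by simp

lemma pos_def_symmetric_form:
  assumes "pos_def_mat n A" "u \<in> carrier_vec n" "v \<in> carrier_vec n"
  shows "u \<bullet> (A *\<^sub>v v) = (A *\<^sub>v u) \<bullet> v"
  using assms symmetric_form by (auto simp: pos_def_mat_def)

lemma pos_def_one: "pos_def_mat n (1\<^sub>m n)"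
proof -
  have "v \<bullet> v > 0" if "v \<in> carrier_vec n" "v \<noteq> 0\<^sub>v n" for v :: "real vec"
  proof -
    have "\<exists>i<n. v $ i \<noteq> 0"
    proof (rule ccontr)
      assume "\<not> ?thesis"
      then have "v = 0\<^sub>v n" using that(1) by (intro eq_vecI) auto
      with that(2) show False by simp
    qed
    then obtain i where i: "i < n" "v $ i \<noteq> 0" by blast
    have "v $ i * v $ i \<le> (\<Sum>i\<in>{0..<n}. v $ i * v $ i)"
      using i by (intro member_le_sum) auto
    moreover have "v $ i * v $ i > 0" using i by (metis not_real_square_gt_zero)
    ultimately show ?thesis using that by (simp add: scalar_prod_def)
  qed
  then show ?thesis by (simp add: pos_def_mat_def)
qed

lemma pos_def_det: 
  assumes "pos_def_mat n A" shows "det A \<noteq> 0"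
proof
  assume "det A = 0"
  then obtain v where v: "v \<in> carrier_vec n" "v \<noteq> 0\<^sub>v n" "A *\<^sub>v v = 0\<^sub>v n"
    using det_0_iff_vec_prod_zero_field[OF pos_def_carrier[OF assms]] by auto
  then show False using pos_def_pos[OF assms v(1,2)] by simp
qed

lemma inv_mat_inverse:
  assumes A: "A \<in> carrier_mat n n" and d: "det A \<noteq> 0"
  shows "inv_mat A \<in> carrier_mat n n" "A * inv_mat A = 1\<^sub>m n" "inv_mat A * A = 1\<^sub>m n"
proof -
  have "A \<in> Units (ring_mat TYPE(real) n ())" using det_non_zero_imp_unit[OF A d] .
  then obtain B where B: "mat_inverse A = Some B" using mat_inverse(1)[OF A] by fastforce
  from mat_inverse(2)[OF A B]
  show "inv_mat A \<in> carrier_mat n n" "A * inv_mat A = 1\<^sub>m n" "inv_mat A * A = 1\<^sub>m n"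
    by (auto simp: inv_mat_def B)
qed

lemma inv_mat_mult_vec:
  assumes A: "A \<in> carrier_mat n n" and d: "det A \<noteq> 0" and w: "w \<in> carrier_vec n"
  shows "inv_mat A *\<^sub>v (A *\<^sub>v w) = w" "A *\<^sub>v (inv_mat A *\<^sub>v w) = w"
  using inv_mat_inverse[OF A d] A w
  by (metis assoc_mult_mat_vec one_mult_mat_vec)+

text \<open>
  The form \<open>u \<bullet> A v\<close> is an inner product, so the usual argument applies: evaluate the form at
  \<open>u - t v\<close> with the minimising \<open>t\<close>.
\<close>

lemma pos_def_Cauchy_Schwarz:
  assumes A: "pos_def_mat n A" and u: "u \<in> carrier_vec n" and v: "v \<in> carrier_vec n"
  shows "(u \<bullet> (A *\<^sub>v v))\<^sup>2 \<le> (u \<bullet> (A *\<^sub>v u)) * (v \<bullet> (A *\<^sub>v v))"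
proof (cases "v = 0\<^sub>v n")
  case True
  moreover have "A *\<^sub>v 0\<^sub>v n = 0\<^sub>v n" using pos_def_carrier[OF A] by auto
  ultimately show ?thesis using u by simp
next
  case False
  note Ac[simp] = pos_def_carrier[OF A]
  define x y z where "x = u \<bullet> (A *\<^sub>v u)" and "y = u \<bullet> (A *\<^sub>v v)" and "z = v \<bullet> (A *\<^sub>v v)"
  have z: "z > 0" using pos_def_pos[OF A v False] by (simp add: z_def)
  define t where "t = y / z"
  have vu: "v \<bullet> (A *\<^sub>v u) = y"
    using pos_def_symmetric_form[OF A v u] comm_scalar_prod[OF u mult_mat_vec_carrier[OF Ac v]]
    by (simp add: y_def)
  have "0 \<le> (u - t \<cdot>\<^sub>v v) \<bullet> (A *\<^sub>v (u - t \<cdot>\<^sub>v v))"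
    by (rule pos_def_nonneg[OF A]) (use u v in simp)
  also have "A *\<^sub>v (u - t \<cdot>\<^sub>v v) = A *\<^sub>v u - t \<cdot>\<^sub>v (A *\<^sub>v v)"
    using u v by (simp add: mult_minus_distrib_mat_vec[of _ n n] mult_mat_vec[of _ n n])
  also have "(u - t \<cdot>\<^sub>v v) \<bullet> \<dots> = x - t * y - t * (y - t * z)"
    using u v mult_mat_vec_carrier[OF Ac u] mult_mat_vec_carrier[OF Ac v]
    by (simp add: scalar_prod_minus_distrib[of _ n] minus_scalar_prod_distrib[of _ n] x_def 
        vu algebra_simps flip: y_def z_def)
  also have "\<dots> = x - y\<^sup>2 / z" using z by (simp add: t_def field_simps power2_eq_square)
  finally show ?thesis using z by (simp add: field_simps flip: x_def y_def z_def)
qed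

lemma pos_def_inverse:
  assumes "pos_def_mat n A" shows "pos_def_mat n (inv_mat A)"
proof -
  note Ac = pos_def_carrier[OF assms] and d = pos_def_det[OF assms]
  note I = inv_mat_inverse[OF Ac d]
  have "transpose_mat (inv_mat A) * A = 1\<^sub>m n"
    using I Ac assms transpose_mult[OF Ac I(1)] by (simp add: pos_def_mat_def)
  then have "transpose_mat (inv_mat A) * (A * inv_mat A) = inv_mat A"
    using I Ac by (metis assoc_mult_mat left_mult_one_mat transpose_carrier_mat)
  then have "transpose_mat (inv_mat A) = inv_mat A"
    using I Ac by simp
  moreover have "v \<bullet> (inv_mat A *\<^sub>v v) > 0" if v: "v \<in> carrier_vec n" "v \<noteq> 0\<^sub>v n" for v
  proof -
    define w where "w = inv_mat A *\<^sub>v v"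
    have w: "w \<in> carrier_vec n" "A *\<^sub>v w = v"
      using I v inv_mat_mult_vec[OF Ac d] by (auto simp: w_def)
    have "w \<noteq> 0\<^sub>v n" using w v Ac by auto
    from pos_def_pos[OF assms w(1) this] show ?thesis 
      using w v by (simp add: comm_scalar_prod[of _ n] flip: w_def)
  qed
  ultimately show ?thesis using I by (simp add: pos_def_mat_def)
qed

text \<open>
  Since \<open>z\<^sub>i = e\<^sub>i \<bullet> z = (A\<inverse> e\<^sub>i) \<bullet> A z\<close>, the Cauchy-Schwarz inequality for the form of \<open>A\<close> bounds
  each coordinate by the form.  Hence the form dominates a positive multiple of \<open>|z|\<^sup>2\<close>.
\<close>

lemma pos_def_coercive:
  assumes "pos_def_mat n A"
  shows "\<exists>K>0. \<forall>z \<in> carrier_vec n. \<forall>i<n. (z $ i)\<^sup>2 \<le> K * (z \<bullet> (A *\<^sub>v z))"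
proof -
  note Ac = pos_def_carrier[OF assms] and d = pos_def_det[OF assms]
  note I = inv_mat_inverse[OF Ac d]
  define k where "k i = (let u = inv_mat A *\<^sub>v unit_vec n i in u \<bullet> (A *\<^sub>v u))" for i
  have k0: "k i \<ge> 0" for i
    unfolding k_def Let_def by (rule pos_def_nonneg[OF assms]) (use I in auto)
  have *: "(z $ i)\<^sup>2 \<le> k i * (z \<bullet> (A *\<^sub>v z))" if z: "z \<in> carrier_vec n" and i: "i < n" for z i
  proof -
    define u where "u = inv_mat A *\<^sub>v unit_vec n i"
    have u: "u \<in> carrier_vec n" "A *\<^sub>v u = unit_vec n i"
      using I inv_mat_mult_vec[OF Ac d] by (auto simp: u_def)
    have "u \<bullet> (A *\<^sub>v z) = z $ i"
      using pos_def_symmetric_form[OF assms u(1) z] u z i by simp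
    then show ?thesis using pos_def_Cauchy_Schwarz[OF assms u(1) z]
      by (simp add: k_def Let_def flip: u_def)
  qed
  \<comment> \<open>one constant for all coordinates; the summand 1 makes it positive for \<open>n = 0\<close>\<close>
  define K where "K = 1 + (\<Sum>i<n. k i)"
  have "K > 0" using k0 by (simp add: K_def add_pos_nonneg sum_nonneg)
  moreover have "(z $ i)\<^sup>2 \<le> K * (z \<bullet> (A *\<^sub>v z))" if z: "z \<in> carrier_vec n" and i: "i < n" for z i
  proof -
    have "k i \<le> K" using member_le_sum[of i "{..<n}" k] i k0 by (auto simp: K_def)
    then show ?thesis using *[OF that] pos_def_nonneg[OF assms z]
      by (meson mult_right_mono order_trans)
  qed
  ultimately show ?thesis by blast
qed

section \<open>The square root of a positive definite matrix\<close>

text \<open>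
  With \<open>D = R - S\<close> one has \<open>R D + D S = R\<^sup>2 - S\<^sup>2 = 0\<close>.  Multiplying by \<open>D\<close> and taking traces gives
  \<open>tr (D R D) + tr (D S D) = 0\<close>.  Both traces are sums of values of a positive definite form at the
  columns of \<open>D\<close>, so all columns vanish.
\<close>

lemma pos_def_sqrt_unique:
  assumes R: "pos_def_mat n R" and S: "pos_def_mat n S" and eq: "R * R = S * S"
  shows "R = S"
proof -
  define D where "D = R - S"
  note c[simp] = pos_def_carrier[OF R] pos_def_carrier[OF S]
  have D[simp]: "D \<in> carrier_mat n n" by (simp add: D_def minus_carrier_mat)
  have symD: "transpose_mat D = D" using R S
    by (simp add: D_def transpose_minus[of _ n n] pos_def_mat_def)
  have "R * D + D * S = 0\<^sub>m n n"
  proof -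
    have "R * D = R * R - R * S" "D * S = R * S - S * S"
      by (simp_all add: D_def mult_minus_distrib_mat[of _ n n _ n] minus_mult_distrib_mat[of _ n n _ _ n])
    then show ?thesis using eq by (intro eq_matI) (auto simp: carrier_matD[OF c(1)] carrier_matD[OF c(2)])
  qed
  define f where "f M = (\<Sum>i<n. col D i \<bullet> (M *\<^sub>v col D i))" for M :: "real mat"
  define tr where "tr M = (\<Sum>i<n. M $$ (i,i))" for M :: "real mat"
  have tr_comm: "tr (M * N) = tr (N * M)" if "M \<in> carrier_mat n n" "N \<in> carrier_mat n n" for M N
    using that unfolding tr_def by (simp add: scalar_prod_def) (subst sum.swap, simp add: mult.commute lessThan_atLeast0)
  have f: "f M = tr (D * (M * D))" if M[simp]: "M \<in> carrier_mat n n" for M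
    unfolding f_def tr_def
  proof (intro sum.cong refl)
    fix i assume i: "i \<in> {..<n}"
    have "M * D \<in> carrier_mat n n" by (rule mult_carrier_mat[OF M D])
    from carrier_matD[OF this] carrier_matD[OF D] i
    have "(D * (M * D)) $$ (i,i) = row D i \<bullet> col (M * D) i" by (intro index_mult_mat(1)) auto
    also have "col (M * D) i = M *\<^sub>v col D i" using i by (intro col_mult2[OF M D]) auto
    also have "row D i = col D i" using symD i D by (metis carrier_matD(1) lessThan_iff row_transpose col_transpose)
    finally show "col D i \<bullet> (M *\<^sub>v col D i) = (D * (M * D)) $$ (i,i)" by simp
  qed
  have tr_add: "tr (M + N) = tr M + tr N" if "M \<in> carrier_mat n n" "N \<in> carrier_mat n n" for M N
    using that by (simp add: tr_def sum.distrib)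
  have colD: "col D i \<in> carrier_vec n" for i
    using carrier_matD(1)[OF D] by (metis carrier_vec_dim_vec dim_col)
  have RD: "R * D \<in> carrier_mat n n" and DS: "D * S \<in> carrier_mat n n"
    using mult_carrier_mat[OF c(1) D] mult_carrier_mat[OF D c(2)] .
  have "f R + f S = tr (D * (R * D)) + tr ((D * S) * D)"
    by (simp add: f assoc_mult_mat[of _ n n _ n _ n])
  also have "tr ((D * S) * D) = tr (D * (D * S))" by (rule tr_comm[OF DS D])
  also have "tr (D * (R * D)) + \<dots> = tr (D * (R * D + D * S))"
    unfolding mult_add_distrib_mat[OF D RD DS] tr_add[OF mult_carrier_mat[OF D RD] mult_carrier_mat[OF D DS]] ..
  also have "\<dots> = 0" by (simp add: \<open>R * D + D * S = 0\<^sub>m n n\<close> right_mult_zero_mat[OF D]) (simp add: tr_def)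
  finally have "f R + f S = 0" .
  moreover have "f S \<ge> 0" unfolding f_def by (intro sum_nonneg pos_def_nonneg[OF S] colD)
  moreover have fR: "col D i \<bullet> (R *\<^sub>v col D i) \<ge> 0" for i
    by (rule pos_def_nonneg[OF R colD])
  then have "f R \<ge> 0" unfolding f_def by (intro sum_nonneg) auto
  ultimately have "f R = 0" by simp
  have "col D i = 0\<^sub>v n" if i: "i < n" for i
  proof (rule ccontr)
    assume "col D i \<noteq> 0\<^sub>v n"
    then have "col D i \<bullet> (R *\<^sub>v col D i) > 0" by (rule pos_def_pos[OF R colD])
    moreover have "col D i \<bullet> (R *\<^sub>v col D i) = 0" 
      using \<open>f R = 0\<close> fR i unfolding f_def by (subst (asm) sum_nonneg_eq_0_iff) auto
    ultimately show False by simp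
  qed
  then have "D $$ (k, i) = 0" if "k < n" "i < n" for k i
    using that D by (metis carrier_matD index_col index_zero_vec(1))
  then show ?thesis unfolding D_def by (intro eq_matI) (use c in \<open>auto simp: carrier_matD[OF c(1)] carrier_matD[OF c(2)]\<close>)
qed

lemma sum_squares_scalar_prod: 
  fixes v :: "real vec"
  assumes "v \<in> carrier_vec n" shows "v \<bullet> v = (\<Sum>i<n. (v $ i)\<^sup>2)"
  using assms by (simp add: scalar_prod_def power2_eq_square lessThan_atLeast0)

definition vec_norm :: "real vec \<Rightarrow> real" where
  "vec_norm v = L2_set (($) v) {..<dim_vec v}"

lemma vec_norm_nonneg: "vec_norm v \<ge> 0" by (simp add: vec_norm_def)

lemma vec_norm_sq: "(vec_norm v)\<^sup>2 = v \<bullet> v"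
  using sum_squares_scalar_prod[of v "dim_vec v"] by (simp add: vec_norm_def L2_set_def sum_nonneg)

lemma vec_norm_add:
  assumes "u \<in> carrier_vec n" "v \<in> carrier_vec n"
  shows "vec_norm (u + v) \<le> vec_norm u + vec_norm v"
proof -
  have "vec_norm (u + v) = L2_set (\<lambda>i. u $ i + v $ i) {..<n}"
    using assms by (auto simp: vec_norm_def intro!: L2_set_cong)
  also have "\<dots> \<le> vec_norm u + vec_norm v"
    using assms L2_set_triangle_ineq[of "($) u" "($) v" "{..<n}"] by (simp add: vec_norm_def)
  finally show ?thesis .
qed

lemma vec_norm_smult: "vec_norm (c \<cdot>\<^sub>v v) = \<bar>c\<bar> * vec_norm v"
proof (rule power2_eq_imp_eq)
  show "(vec_norm (c \<cdot>\<^sub>v v))\<^sup>2 = (\<bar>c\<bar> * vec_norm v)\<^sup>2"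
    by (simp add: vec_norm_sq power_mult_distrib) (simp add: power2_eq_square)
qed (simp_all add: vec_norm_nonneg)

lemma component_le_vec_norm:
  assumes "i < dim_vec v" shows "\<bar>v $ i\<bar> \<le> vec_norm v"
  using assms member_le_L2_set[of "{..<dim_vec v}" i "\<lambda>i. \<bar>v $ i\<bar>"] 
  by (simp add: vec_norm_def L2_set_def)

lemma scalar_prod_le_vec_norm:
  assumes "u \<in> carrier_vec n" "v \<in> carrier_vec n"
  shows "\<bar>u \<bullet> v\<bar> \<le> vec_norm u * vec_norm v"
proof (rule power2_le_imp_le)
  show "\<bar>u \<bullet> v\<bar>\<^sup>2 \<le> (vec_norm u * vec_norm v)\<^sup>2"
    using pos_def_Cauchy_Schwarz[OF pos_def_one assms] assms
    by (simp add: power_mult_distrib vec_norm_sq)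
qed (simp add: vec_norm_nonneg)

definition op_bound :: "nat \<Rightarrow> real \<Rightarrow> real mat \<Rightarrow> bool" where
  "op_bound n c M \<longleftrightarrow> M \<in> carrier_mat n n \<and> 
     (\<forall>v \<in> carrier_vec n. vec_norm (M *\<^sub>v v) \<le> c * vec_norm v)"

lemma op_bound_carrier: "op_bound n c M \<Longrightarrow> M \<in> carrier_mat n n" by (simp add: op_bound_def)

lemma op_bound_add:
  assumes "op_bound n c M" "op_bound n d N" shows "op_bound n (c + d) (M + N)"
  unfolding op_bound_def
proof (intro conjI ballI)
  note [simp] = assms[THEN op_bound_carrier]
  show "M + N \<in> carrier_mat n n" by simp
  fix v :: "real vec" assume v: "v \<in> carrier_vec n"
  have "vec_norm ((M + N) *\<^sub>v v) \<le> vec_norm (M *\<^sub>v v) + vec_norm (N *\<^sub>v v)"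
    using v by (subst add_mult_distrib_mat_vec[of _ n n]) (auto intro!: vec_norm_add mult_mat_vec_carrier[of _ n n])
  also have "\<dots> \<le> c * vec_norm v + d * vec_norm v"
    using assms v by (intro add_mono) (auto simp: op_bound_def)
  finally show "vec_norm ((M + N) *\<^sub>v v) \<le> (c + d) * vec_norm v" by (simp add: algebra_simps)
qed

lemma op_bound_mult:
  assumes "op_bound n c M" "op_bound n d N" "c \<ge> 0" shows "op_bound n (c * d) (M * N)"
  unfolding op_bound_def
proof (intro conjI ballI)
  note M = assms(1,2)[THEN op_bound_carrier]
  show "M * N \<in> carrier_mat n n" using M by auto
  fix v :: "real vec" assume v: "v \<in> carrier_vec n"
  have "vec_norm ((M * N) *\<^sub>v v) \<le> c * vec_norm (N *\<^sub>v v)"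
    using v M assms(1) mult_mat_vec_carrier[OF M(2) v] 
    by (subst assoc_mult_mat_vec[OF M v]) (auto simp: op_bound_def)
  also have "\<dots> \<le> c * (d * vec_norm v)"
    using assms v by (intro mult_left_mono) (auto simp: op_bound_def)
  finally show "vec_norm ((M * N) *\<^sub>v v) \<le> (c * d) * vec_norm v" by (simp add: algebra_simps)
qed

lemma op_bound_smult:
  assumes "op_bound n c M" shows "op_bound n (\<bar>k\<bar> * c) (k \<cdot>\<^sub>m M)"
  unfolding op_bound_def
proof (intro conjI ballI)
  note M = assms[THEN op_bound_carrier]
  show "k \<cdot>\<^sub>m M \<in> carrier_mat n n" using M by auto
  fix v :: "real vec" assume v: "v \<in> carrier_vec n"
  have "(k \<cdot>\<^sub>m M) *\<^sub>v v = k \<cdot>\<^sub>v (M *\<^sub>v v)" using M v by (intro eq_vecI) auto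
  then show "vec_norm ((k \<cdot>\<^sub>m M) *\<^sub>v v) \<le> \<bar>k\<bar> * c * vec_norm v"
    using assms v by (auto simp: vec_norm_smult op_bound_def mult.assoc intro: mult_left_mono)
qed

lemma op_bound_mono:
  assumes "op_bound n c M" "c \<le> d" shows "op_bound n d M"
  using assms unfolding op_bound_def by (meson mult_right_mono order_trans vec_norm_nonneg)

lemma op_bound_entry:
  assumes "op_bound n c M" "i < n" "j < n" shows "\<bar>M $$ (i,j)\<bar> \<le> c"
proof -
  note M = assms(1)[THEN op_bound_carrier]
  have "vec_norm (unit_vec n j) = 1"
    using vec_norm_sq[of "unit_vec n j"] assms(3) vec_norm_nonneg[of "unit_vec n j"]
    by (simp add: power2_eq_1_iff) 
  moreover have "\<bar>M $$ (i,j)\<bar> \<le> vec_norm (M *\<^sub>v unit_vec n j)"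
    using component_le_vec_norm[of i "M *\<^sub>v unit_vec n j"] M assms by simp
  ultimately show ?thesis using assms unfolding op_bound_def
    by (metis mult.right_neutral order_trans unit_vec_carrier)
qed

lemma transpose_mat_smult: "transpose_mat (c \<cdot>\<^sub>m M) = c \<cdot>\<^sub>m transpose_mat M"
  by (intro eq_matI) auto

text \<open>
  A root of \<open>1 - B\<close> is sought as \<open>1 - L\<close>, which means \<open>2 L = B + L\<^sup>2\<close>.  The iteration
  \<open>X \<mapsto> (B + X\<^sup>2) / 2\<close> preserves the operator norm ball of radius \<open>q < 1\<close>, and
  \<open>X\<^sup>2 - Y\<^sup>2 = X (X - Y) + (X - Y) Y\<close> makes it a contraction there.  The limit is taken
  entrywise.
\<close>

lemma contraction_sqrt_limit:
  assumes B: "op_bound n q B" and sym: "transpose_mat B = B" and q: "0 \<le> q" "q < 1"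
  shows "\<exists>L \<in> carrier_mat n n. transpose_mat L = L \<and> 2 \<cdot>\<^sub>m L = B + L * L \<and> 
     (\<forall>v \<in> carrier_vec n. v \<bullet> (L *\<^sub>v v) \<le> q * (v \<bullet> v))"
proof -
  note Bc[simp] = op_bound_carrier[OF B]
  define X where "X = rec_nat (0\<^sub>m n n) (\<lambda>_ Y. (1/2) \<cdot>\<^sub>m (B + Y * Y))"
  have X0: "X 0 = 0\<^sub>m n n" and XS: "X (Suc k) = (1/2) \<cdot>\<^sub>m (B + X k * X k)" for k
    by (simp_all add: X_def)
  have bX: "op_bound n q (X k)" for k
  proof (induction k)
    case 0
    have "vec_norm (0\<^sub>v n) = 0" using vec_norm_sq[of "0\<^sub>v n"] by simp
    moreover have "0\<^sub>m n n *\<^sub>v v = 0\<^sub>v n" if "v \<in> carrier_vec n" for v :: "real vec" using that by auto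
    ultimately show ?case using q by (auto simp: op_bound_def X0 vec_norm_nonneg)
  next
    case (Suc k)
    have "op_bound n (\<bar>1/2\<bar> * (q + q * q)) (X (Suc k))"
      unfolding XS by (intro op_bound_smult op_bound_add B op_bound_mult Suc q)
    moreover have "q * q \<le> q" using q by (simp add: mult_left_le)
    ultimately show ?case by (auto elim!: op_bound_mono)
  qed
  note Xc[simp] = bX[THEN op_bound_carrier]
  have symX: "transpose_mat (X k) = X k" for k
  proof (induction k)
    case (Suc k)
    have "transpose_mat (B + X k * X k) = B + X k * X k"
      by (subst transpose_add[of _ n n]) (auto simp: Suc sym transpose_mult[OF Xc Xc] intro!: mult_carrier_mat[OF Xc Xc])
    then show ?case by (simp add: XS transpose_mat_smult)
  qed (simp add: X0)
  have dX: "op_bound n (q ^ Suc k) (X (Suc k) - X k)" for k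
  proof (induction k)
    case 0
    have "X (Suc 0) - X 0 = (1/2) \<cdot>\<^sub>m B" by (intro eq_matI) (auto simp: XS X0 carrier_matD[OF Bc])
    moreover have "op_bound n (\<bar>1/2\<bar> * q) ((1/2) \<cdot>\<^sub>m B)" by (intro op_bound_smult B)
    ultimately show ?case using q by (auto elim!: op_bound_mono)
  next
    case (Suc k)
    define D where "D = X (Suc k) - X k"
    have D[simp]: "D \<in> carrier_mat n n" by (simp add: D_def minus_carrier_mat)
    have "X (Suc k) * D + D * X k = X (Suc k) * X (Suc k) - X k * X k"
      unfolding D_def mult_minus_distrib_mat[OF Xc Xc Xc] minus_mult_distrib_mat[OF Xc Xc Xc]
      by (intro eq_matI) (auto simp: carrier_matD[OF Xc])
    then have "X (Suc (Suc k)) - X (Suc k) = (1/2) \<cdot>\<^sub>m (X (Suc k) * D + D * X k)"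
      unfolding XS[of "Suc k"] by (subst (3) XS) (intro eq_matI, auto simp: carrier_matD[OF Xc] field_simps)
    moreover have "op_bound n (\<bar>1/2\<bar> * (q * q ^ Suc k + q ^ Suc k * q)) ((1/2) \<cdot>\<^sub>m (X (Suc k) * D + D * X k))"
      using Suc q by (intro op_bound_smult op_bound_add op_bound_mult bX) (auto simp: D_def)
    ultimately show ?case by (simp add: algebra_simps)
  qed
  define L where "L = mat n n (\<lambda>(i,j). lim (\<lambda>k. X k $$ (i,j)))"
  have L[simp]: "L \<in> carrier_mat n n" by (simp add: L_def)
  have lim: "(\<lambda>k. X k $$ (i,j)) \<longlonglongrightarrow> L $$ (i,j)" if "i < n" "j < n" for i j
  proof -
    let ?f = "\<lambda>k. X k $$ (i,j)"
    have "summable (\<lambda>k. ?f (Suc k) - ?f k)"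
    proof (rule summable_comparison_test')
      show "summable (\<lambda>k. q ^ Suc k)" using q by (auto intro!: summable_mult summable_geometric)
      show "norm (?f (Suc k) - ?f k) \<le> q ^ Suc k" if "k \<ge> 0" for k
        using op_bound_entry[OF dX[of k] \<open>i < n\<close> \<open>j < n\<close>] \<open>i < n\<close> \<open>j < n\<close>
        by (simp add: carrier_matD[OF Xc])
    qed
    then have "convergent (\<lambda>k. \<Sum>i<k. ?f (Suc i) - ?f i)" by (simp add: summable_iff_convergent)
    then have "convergent (\<lambda>k. ?f k - ?f 0)" unfolding sum_lessThan_telescope[of ?f] .
    then have "convergent ?f" 
      using convergent_add[OF _ convergent_const[of "?f 0"], of "\<lambda>k. ?f k - ?f 0"] by simp
    then show ?thesis using that by (simp add: L_def convergent_LIMSEQ_iff)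
  qed
  have "transpose_mat L = L"
  proof (intro eq_matI)
    fix i j assume "i < dim_row L" "j < dim_col L"
    then have ij: "i < n" "j < n" by (auto simp: L_def)
    have "X k $$ (i,j) = X k $$ (j,i)" for k
      using symX[of k] ij by (metis Xc carrier_matD index_transpose_mat(1))
    then show "transpose_mat L $$ (i,j) = L $$ (i,j)" using ij by (simp add: L_def)
  qed (auto simp: L_def)
  moreover have "2 \<cdot>\<^sub>m L = B + L * L"
  proof (intro eq_matI)
    fix i j assume "i < dim_row (B + L * L)" "j < dim_col (B + L * L)"
    then have ij: "i < n" "j < n" by (auto simp: L_def)
    have e: "(B + M * M) $$ (i,j) = B $$ (i,j) + (\<Sum>l<n. M $$ (i,l) * M $$ (l,j))"
      if "M \<in> carrier_mat n n" for M
      using that ij by (simp add: scalar_prod_def lessThan_atLeast0 carrier_matD[OF that])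
    have "2 * X (Suc k) $$ (i,j) = B $$ (i,j) + (\<Sum>l<n. X k $$ (i,l) * X k $$ (l,j))" for k
      unfolding e[OF Xc, symmetric] XS using ij by (simp add: carrier_matD[OF Xc] carrier_matD[OF Bc])
    moreover have "(\<lambda>k. B $$ (i,j) + (\<Sum>l<n. X k $$ (i,l) * X k $$ (l,j))) \<longlonglongrightarrow> (B + L * L) $$ (i,j)"
      unfolding e[OF L] using ij by (intro tendsto_intros lim) auto
    moreover have "(\<lambda>k. 2 * X (Suc k) $$ (i,j)) \<longlonglongrightarrow> 2 * L $$ (i,j)"
      using lim[OF ij] by (intro tendsto_intros LIMSEQ_Suc)
    ultimately show "(2 \<cdot>\<^sub>m L) $$ (i,j) = (B + L * L) $$ (i,j)"
      using LIMSEQ_unique ij by (auto simp: carrier_matD[OF L])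
  qed (auto simp: L_def)
  moreover have "v \<bullet> (L *\<^sub>v v) \<le> q * (v \<bullet> v)" if v: "v \<in> carrier_vec n" for v
  proof -
    have e: "v \<bullet> (M *\<^sub>v v) = (\<Sum>i<n. v $ i * (\<Sum>j<n. M $$ (i,j) * v $ j))" 
      if "M \<in> carrier_mat n n" for M :: "real mat"
      using v that by (auto simp: scalar_prod_def lessThan_atLeast0 carrier_matD[OF that] carrier_vecD[OF v] intro!: sum.cong)
    have "v \<bullet> (X k *\<^sub>v v) \<le> q * (v \<bullet> v)" for k
    proof -
      have "v \<bullet> (X k *\<^sub>v v) \<le> vec_norm v * vec_norm (X k *\<^sub>v v)"
        using scalar_prod_le_vec_norm[OF v mult_mat_vec_carrier[OF Xc v]] by (meson abs_le_D1)
      also have "\<dots> \<le> vec_norm v * (q * vec_norm v)"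
        using bX v by (intro mult_left_mono) (auto simp: op_bound_def vec_norm_nonneg)
      also have "\<dots> = q * (v \<bullet> v)" by (simp add: power2_eq_square flip: vec_norm_sq)
      finally show ?thesis .
    qed
    moreover have "(\<lambda>k. v \<bullet> (X k *\<^sub>v v)) \<longlonglongrightarrow> v \<bullet> (L *\<^sub>v v)"
      unfolding e[OF L] e[OF Xc] by (intro tendsto_intros lim) auto
    ultimately show ?thesis using LIMSEQ_le_const2 by blast
  qed
  ultimately show ?thesis by (intro bexI[of _ L]) auto
qed

text \<open>
  With \<open>\<alpha> |v|\<^sup>2 \<le> v \<bullet> A v\<close> and \<open>|A v|\<^sup>2 \<le> \<beta> |v|\<^sup>2\<close>, expanding \<open>|v - t A v|\<^sup>2\<close> gives the factor
  \<open>1 - 2 t \<alpha> + t\<^sup>2 \<beta>\<close>, which is minimal and below \<open>1\<close> at \<open>t = \<alpha> / \<beta>\<close>.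
\<close>

lemma pos_def_near_identity:
  assumes A: "pos_def_mat n A"
  shows "\<exists>t>0. \<exists>q. 0 \<le> q \<and> q < 1 \<and> op_bound n q (1\<^sub>m n - t \<cdot>\<^sub>m A)"
proof -
  note Ac[simp] = pos_def_carrier[OF A]
  obtain K where K: "K > 0" "\<And>z i. z \<in> carrier_vec n \<Longrightarrow> i < n \<Longrightarrow> (z $ i)\<^sup>2 \<le> K * (z \<bullet> (A *\<^sub>v z))"
    using pos_def_coercive[OF A] by blast
  \<comment> \<open>summing the \<open>n\<close> coordinate bounds; the summand 1 keeps the denominator positive for \<open>n = 0\<close>\<close>
  define \<alpha> where "\<alpha> = 1 / (n * K + 1)"
  have \<alpha>: "\<alpha> > 0" using K by (simp add: \<alpha>_def add_nonneg_pos)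
  have low: "\<alpha> * (v \<bullet> v) \<le> v \<bullet> (A *\<^sub>v v)" if v: "v \<in> carrier_vec n" for v
  proof -
    have "v \<bullet> v \<le> n * (K * (v \<bullet> (A *\<^sub>v v)))"
      using sum_bounded_above[of "{..<n}" "\<lambda>i. (v $ i)\<^sup>2"] K(2)[OF v] v by (simp add: sum_squares_scalar_prod[of _ n])
    also have "\<dots> \<le> (n * K + 1) * (v \<bullet> (A *\<^sub>v v))" using pos_def_nonneg[OF A v] by (simp add: algebra_simps)
    finally show ?thesis using K by (simp add: \<alpha>_def divide_le_eq mult.commute add_nonneg_pos)
  qed
  define \<beta> where "\<beta> = 1 + (\<Sum>i<n. row A i \<bullet> row A i)"
  have "row A i \<bullet> row A i \<ge> 0" for i by (metis vec_norm_sq zero_le_power2)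
  then have \<beta>: "\<beta> > 0" by (simp add: \<beta>_def add_pos_nonneg sum_nonneg)
  have up: "(A *\<^sub>v v) \<bullet> (A *\<^sub>v v) \<le> \<beta> * (v \<bullet> v)" if v: "v \<in> carrier_vec n" for v
  proof -
    have "(A *\<^sub>v v) \<bullet> (A *\<^sub>v v) = (\<Sum>i<n. (row A i \<bullet> v)\<^sup>2)"
      using v by (subst sum_squares_scalar_prod[of _ n]) (auto simp: carrier_matD[OF Ac] intro!: mult_mat_vec_carrier[OF Ac])
    also have "\<dots> \<le> (\<Sum>i<n. (row A i \<bullet> row A i) * (v \<bullet> v))"
      using v pos_def_Cauchy_Schwarz[OF pos_def_one _ v] by (intro sum_mono) (auto simp: row_carrier_vec[OF _ Ac])
    also have "\<dots> \<le> \<beta> * (v \<bullet> v)" 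
      using zero_le_power2[of "vec_norm v"] by (simp add: \<beta>_def sum_distrib_right distrib_right vec_norm_sq)
    finally show ?thesis .
  qed
  define t where "t = \<alpha> / \<beta>"
  \<comment> \<open>the maximum avoids a comparison of \<open>\<alpha>\<^sup>2\<close> with \<open>\<beta>\<close>\<close>
  define q where "q = sqrt (max 0 (1 - \<alpha>\<^sup>2 / \<beta>))"
  have t: "t > 0" using \<alpha> \<beta> by (simp add: t_def)
  have q: "0 \<le> q" "q < 1" using \<alpha> \<beta> by (auto simp: q_def)
  have "vec_norm ((1\<^sub>m n - t \<cdot>\<^sub>m A) *\<^sub>v v) \<le> q * vec_norm v" if v: "v \<in> carrier_vec n" for v
  proof (rule power2_le_imp_le)
    have "(1\<^sub>m n - t \<cdot>\<^sub>m A) *\<^sub>v v = v - t \<cdot>\<^sub>v (A *\<^sub>v v)"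
      using v by (subst minus_mult_distrib_mat_vec[of _ n n]) (auto intro!: eq_vecI simp: carrier_matD[OF Ac])
    then have "(vec_norm ((1\<^sub>m n - t \<cdot>\<^sub>m A) *\<^sub>v v))\<^sup>2 = (v - t \<cdot>\<^sub>v (A *\<^sub>v v)) \<bullet> (v - t \<cdot>\<^sub>v (A *\<^sub>v v))"
      by (simp add: vec_norm_sq)
    also have "\<dots> = v \<bullet> v - 2 * t * (v \<bullet> (A *\<^sub>v v)) + t\<^sup>2 * ((A *\<^sub>v v) \<bullet> (A *\<^sub>v v))"
      using v mult_mat_vec_carrier[OF Ac v] comm_scalar_prod[OF v mult_mat_vec_carrier[OF Ac v]]
      by (simp add: scalar_prod_minus_distrib[of _ n] minus_scalar_prod_distrib[of _ n] power2_eq_square algebra_simps)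
    also have "\<dots> \<le> v \<bullet> v - 2 * t * (\<alpha> * (v \<bullet> v)) + t\<^sup>2 * (\<beta> * (v \<bullet> v))"
      using low[OF v] up[OF v] t by (intro add_mono diff_mono mult_left_mono) auto
    also have "\<dots> = (1 - \<alpha>\<^sup>2 / \<beta>) * (v \<bullet> v)"
      using \<beta> by (simp add: t_def power2_eq_square field_simps)
    also have "\<dots> \<le> q\<^sup>2 * (v \<bullet> v)"
      using zero_le_power2[of "vec_norm v"] by (intro mult_right_mono) (auto simp: q_def vec_norm_sq)
    finally show "(vec_norm ((1\<^sub>m n - t \<cdot>\<^sub>m A) *\<^sub>v v))\<^sup>2 \<le> (q * vec_norm v)\<^sup>2"
      by (simp add: power_mult_distrib vec_norm_sq)
  qed (use q vec_norm_nonneg in simp)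
  then have "op_bound n q (1\<^sub>m n - t \<cdot>\<^sub>m A)" by (simp add: op_bound_def minus_carrier_mat)
  then show ?thesis using t q by blast
qed

text \<open>
  Scale \<open>A\<close> to \<open>t A = 1 - B\<close> with \<open>B\<close> a contraction, take the root \<open>1 - L\<close> of \<open>t A\<close> and scale back.
  Positivity survives because the form of \<open>L\<close> is at most \<open>q < 1\<close> times that of the identity.
\<close>

lemma pos_def_sqrt_exists:
  assumes A: "pos_def_mat n A"
  shows "\<exists>R. pos_def_mat n R \<and> R * R = A"
proof -
  note Ac[simp] = pos_def_carrier[OF A]
  obtain t q where t: "t > 0" and q: "0 \<le> q" "q < 1" and B: "op_bound n q (1\<^sub>m n - t \<cdot>\<^sub>m A)"
    using pos_def_near_identity[OF A] by blast
  define B' where "B' = 1\<^sub>m n - t \<cdot>\<^sub>m A"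
  have symA: "A $$ (i,j) = A $$ (j,i)" if "i < n" "j < n" for i j
    using A that unfolding pos_def_mat_def by (metis carrier_matD index_transpose_mat(1))
  have "transpose_mat B' = B'" using symA by (intro eq_matI) (auto simp: B'_def carrier_matD[OF Ac])
  then obtain L where L[simp]: "L \<in> carrier_mat n n" and sym: "transpose_mat L = L"
    and eq: "2 \<cdot>\<^sub>m L = B' + L * L" and le: "\<And>v. v \<in> carrier_vec n \<Longrightarrow> v \<bullet> (L *\<^sub>v v) \<le> q * (v \<bullet> v)"
    using contraction_sqrt_limit[OF B[folded B'_def] _ q] by blast
  define s where "s = 1 / sqrt t"
  define M where "M = 1\<^sub>m n - L"
  define R where "R = s \<cdot>\<^sub>m M"
  have M[simp]: "M \<in> carrier_mat n n" by (simp add: M_def minus_carrier_mat)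
  have symM: "transpose_mat M = M" by (simp add: M_def transpose_minus[of _ n n] sym)
  have "M * M = t \<cdot>\<^sub>m A"
  proof (intro eq_matI)
    fix i j assume "i < dim_row (t \<cdot>\<^sub>m A)" "j < dim_col (t \<cdot>\<^sub>m A)"
    then have ij: "i < n" "j < n" by (auto simp: carrier_matD[OF Ac])
    have "M * M = (1\<^sub>m n - L) - (L - L * L)"
      unfolding M_def by (simp add: minus_mult_distrib_mat[of _ n n _ _ n] mult_minus_distrib_mat[of _ n n _ n] minus_carrier_mat left_mult_one_mat[OF L] right_mult_one_mat[OF L])
    moreover have "(2 \<cdot>\<^sub>m L) $$ (i,j) = (B' + L * L) $$ (i,j)" by (simp add: eq)
    ultimately show "(M * M) $$ (i,j) = (t \<cdot>\<^sub>m A) $$ (i,j)"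
      using ij by (simp add: B'_def carrier_matD[OF Ac] carrier_matD[OF L] del: index_mult_mat(1))
  qed (auto simp: carrier_matD[OF Ac] carrier_matD[OF M])
  then have "R * R = (s * s) \<cdot>\<^sub>m (t \<cdot>\<^sub>m A)"
    unfolding R_def mult_smult_assoc_mat[OF M smult_carrier_mat[OF M]] mult_smult_distrib[OF M M]
    by (intro eq_matI) (auto simp del: index_mult_mat(1))
  also have "s * s * t = 1" using t by (simp add: s_def)
  then have "(s * s) \<cdot>\<^sub>m (t \<cdot>\<^sub>m A) = A" by (intro eq_matI) (auto simp flip: mult.assoc)
  finally have "R * R = A" .
  moreover have "pos_def_mat n R"
    unfolding pos_def_mat_def
  proof (intro conjI ballI impI)
    show "R \<in> carrier_mat n n" by (simp add: R_def)
    show "transpose_mat R = R" by (metis R_def symM transpose_mat_smult)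
    fix v :: "real vec" assume v: "v \<in> carrier_vec n" "v \<noteq> 0\<^sub>v n"
    have "R *\<^sub>v v = s \<cdot>\<^sub>v (M *\<^sub>v v)"
      using v by (intro eq_vecI) (auto simp: R_def carrier_matD[OF M])
    also have "M *\<^sub>v v = v - L *\<^sub>v v"
      using v by (simp add: M_def minus_mult_distrib_mat_vec[of _ n n])
    finally have "R *\<^sub>v v = s \<cdot>\<^sub>v (v - L *\<^sub>v v)" .
    then have "v \<bullet> (R *\<^sub>v v) = s * (v \<bullet> v - v \<bullet> (L *\<^sub>v v))"
      using v mult_mat_vec_carrier[OF L v(1)] by (simp add: scalar_prod_minus_distrib[of _ n])
    moreover have "v \<bullet> v > 0" using pos_def_pos[OF pos_def_one v] v by simp
    then have "q * (v \<bullet> v) < v \<bullet> v" using q by simp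
    then have "v \<bullet> v - v \<bullet> (L *\<^sub>v v) > 0" using le[OF v(1)] by linarith
    ultimately show "v \<bullet> (R *\<^sub>v v) > 0" using t by (simp add: s_def)
  qed
  ultimately show ?thesis by blast
qed

lemma sqrt_mat_pos_def:
  assumes "pos_def_mat n A"
  shows "pos_def_mat n (sqrt_mat A)" "sqrt_mat A * sqrt_mat A = A"
proof -
  have "\<exists>!R. pos_def_mat (dim_row A) R \<and> R * R = A"
    using pos_def_sqrt_exists[OF assms] pos_def_sqrt_unique[of "dim_row A"] pos_def_carrier[OF assms]
    by (intro ex_ex1I) auto
  from theI'[OF this] pos_def_carrier[OF assms]
  show "pos_def_mat n (sqrt_mat A)" "sqrt_mat A * sqrt_mat A = A" by (auto simp: sqrt_mat_def)
qed

section \<open>Conditioning on one coordinate\<close>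

lemma sum_delete_index:
  fixes f :: "nat \<Rightarrow> 'a :: comm_monoid_add"
  assumes "j < p"
  shows "(\<Sum>i<p. f i) = f j + (\<Sum>i<p - 1. f (insert_index j i))"
proof -
  have "bij_betw (insert_index j) {..<p - 1} ({..<p} - {j})"
    by (rule bij_betw_byWitness[where f' = "delete_index j"])
       (use assms in \<open>auto simp: insert_index_def delete_index_def\<close>)
  then have "(\<Sum>i<p - 1. f (insert_index j i)) = (\<Sum>i\<in>{..<p} - {j}. f i)"
    by (rule sum.reindex_bij_betw)
  then show ?thesis using assms by (simp add: sum.remove[of _ j])
qed

lemma dim_vec_delete[simp]: "dim_vec (vec_delete j v) = dim_vec v - 1"
  by (simp add: vec_delete_def)

lemma vec_delete_carrier[simp]: "v \<in> carrier_vec p \<Longrightarrow> vec_delete j v \<in> carrier_vec (p - 1)"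
  by (simp add: vec_delete_def)

lemma vec_delete_index:
  "i < dim_vec v - 1 \<Longrightarrow> vec_delete j v $ i = v $ insert_index j i"
  by (simp add: vec_delete_def insert_index_def)

lemma insert_index_less: "j < p \<Longrightarrow> i < p - 1 \<Longrightarrow> insert_index j i < p"
  by (auto simp: insert_index_def)

lemma scalar_prod_sum:
  fixes u v :: "real vec" 
  assumes "v \<in> carrier_vec p" shows "u \<bullet> v = (\<Sum>i<p. u $ i * v $ i)"
  using assms by (simp add: scalar_prod_def lessThan_atLeast0)

lemma scalar_prod_delete:
  fixes u v :: "real vec"
  assumes "u \<in> carrier_vec p" "v \<in> carrier_vec p" "j < p"
  shows "u \<bullet> v = u $ j * v $ j + vec_delete j u \<bullet> vec_delete j v"
  using assms sum_delete_index[OF assms(3), of "\<lambda>i. u $ i * v $ i"]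
  by (simp add: scalar_prod_sum[of _ p] scalar_prod_sum[of _ "p - 1"] vec_delete_index)

lemma pos_def_diag:
  assumes "pos_def_mat p S" "j < p" shows "S $$ (j,j) > 0"
proof -
  have "unit_vec p j \<noteq> 0\<^sub>v p" using assms(2)
    by (metis index_unit_vec(1) index_zero_vec(1) zero_neq_one)
  then have "unit_vec p j \<bullet> (S *\<^sub>v unit_vec p j) > 0" by (intro pos_def_pos[OF assms(1)]) auto
  then show ?thesis using assms(2) pos_def_carrier[OF assms(1)] by simp
qed

lemma pos_def_sym_entry:
  assumes "pos_def_mat p S" "i < p" "j < p" shows "S $$ (i,j) = S $$ (j,i)"
  using assms unfolding pos_def_mat_def by (metis carrier_matD index_transpose_mat(1))

lemma pos_def_row_col:
  assumes "pos_def_mat p S" "j < p" shows "row S j = col S j"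
  using pos_def_sym_entry[OF assms(1)] assms(2) pos_def_carrier[OF assms(1)] by (intro eq_vecI) auto

lemma cond_cov_carrier:
  assumes "S \<in> carrier_mat p p" shows "cond_cov S j \<in> carrier_mat (p - 1) (p - 1)"
  using assms by (auto simp: cond_cov_def outer_prod_def)

lemma cond_cov_index:
  assumes "S \<in> carrier_mat p p" "j < p" "i < p - 1" "k < p - 1"
  shows "cond_cov S j $$ (i,k) = S $$ (insert_index j i, insert_index j k) - 
    S $$ (insert_index j i, j) * S $$ (j, insert_index j k) / S $$ (j,j)"
proof -
  have "mat_delete S j j $$ (i,k) = S $$ (insert_index j i, insert_index j k)"
    using assms by (simp add: mat_delete_def insert_index_def)
  then show ?thesis
    using assms insert_index_less[of j p i] insert_index_less[of j p k]
    by (simp add: cond_cov_def outer_prod_def vec_delete_index)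
qed

text \<open>
  This is one step of Gaussian elimination applied to the system with matrix \<open>S\<close> and unknown \<open>w\<close>:
  subtracting the multiple of the \<open>j\<close>th equation that cancels \<open>w\<^sub>j\<close> leaves a system for the other
  coordinates with matrix \<open>cond_cov S j\<close>.
\<close>

lemma cond_cov_mult_vec:
  assumes S: "S \<in> carrier_mat p p" and j: "j < p" and nz: "S $$ (j,j) \<noteq> 0" and w: "w \<in> carrier_vec p"
  shows "cond_cov S j *\<^sub>v vec_delete j w =
    vec_delete j (S *\<^sub>v w) - ((S *\<^sub>v w) $ j / S $$ (j,j)) \<cdot>\<^sub>v vec_delete j (col S j)"
proof (intro eq_vecI)
  note cc = cond_cov_carrier[OF S, of j]
  fix i assume "i < dim_vec (vec_delete j (S *\<^sub>v w) - ((S *\<^sub>v w) $ j / S $$ (j,j)) \<cdot>\<^sub>v vec_delete j (col S j))"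
  then have i: "i < p - 1" using S by simp
  define m where "m = insert_index j i"
  have m: "m < p" using insert_index_less[OF j i] by (simp add: m_def)
  have ent: "(S *\<^sub>v w) $ l = S $$ (l,j) * w $ j + (\<Sum>k<p-1. S $$ (l, insert_index j k) * w $ insert_index j k)"
    if "l < p" for l
    using that S w sum_delete_index[OF j, of "\<lambda>k. S $$ (l,k) * w $ k"] by (simp add: scalar_prod_sum[of _ p])
  have "(cond_cov S j *\<^sub>v vec_delete j w) $ i = (\<Sum>k<p-1. cond_cov S j $$ (i,k) * w $ insert_index j k)"
    using i cc w by (simp add: scalar_prod_sum[of _ "p-1"] vec_delete_index)
  also have "\<dots> = (\<Sum>k<p-1. S $$ (m, insert_index j k) * w $ insert_index j k
      - S $$ (m,j) / S $$ (j,j) * (S $$ (j, insert_index j k) * w $ insert_index j k))"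
    by (intro sum.cong) (simp_all add: cond_cov_index[OF S j i] m_def left_diff_distrib)
  also have "\<dots> = ((S *\<^sub>v w) $ m - S $$ (m,j) * w $ j) 
      - S $$ (m,j) / S $$ (j,j) * ((S *\<^sub>v w) $ j - S $$ (j,j) * w $ j)"
    by (simp add: sum_subtractf sum_distrib_left ent[OF m] ent[OF j])
  also have "\<dots> = (S *\<^sub>v w) $ m - (S *\<^sub>v w) $ j / S $$ (j,j) * S $$ (m,j)"
    using nz by (simp add: field_simps)
  also have "\<dots> = (vec_delete j (S *\<^sub>v w) - ((S *\<^sub>v w) $ j / S $$ (j,j)) \<cdot>\<^sub>v vec_delete j (col S j)) $ i"
    using i j S m by (simp add: vec_delete_index m_def del: index_mult_mat_vec)
  finally show "(cond_cov S j *\<^sub>v vec_delete j w) $ i = \<dots>" .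
qed (use S cond_cov_carrier[OF S, of j] in auto)

text \<open>
  The one identity behind all uses of the Schur complement: at \<open>w = S\<inverse> z\<close> it splits the exponent of
  the normal density, at \<open>w = h\<close> it relates the normalising constants of the joint, marginal and
  conditional skew-normal densities, and at a \<open>w\<close> with \<open>(S w)\<^sub>j = 0\<close> it shows that the Schur
  complement is positive definite.
\<close>

lemma quadratic_form_split:
  assumes S: "pos_def_mat p S" and j: "j < p" and w: "w \<in> carrier_vec p"
  shows "(S *\<^sub>v w) \<bullet> w = ((S *\<^sub>v w) $ j)\<^sup>2 / S $$ (j,j) 
    + (cond_cov S j *\<^sub>v vec_delete j w) \<bullet> vec_delete j w"
proof -
  note Sc = pos_def_carrier[OF S] and d = pos_def_diag[OF S j]
  define z s where "z = S *\<^sub>v w" and "s = vec_delete j (col S j)"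
  have z: "z \<in> carrier_vec p" using Sc w by (simp add: z_def)
  have s: "s \<in> carrier_vec (p - 1)" using Sc j by (simp add: s_def)
  have vw: "vec_delete j w \<in> carrier_vec (p - 1)" "vec_delete j z \<in> carrier_vec (p - 1)" using w z by auto
  have "z $ j = col S j \<bullet> w" using Sc j w pos_def_row_col[OF S j] by (simp add: z_def)
  also have "\<dots> = S $$ (j,j) * w $ j + s \<bullet> vec_delete j w"
    using Sc j w by (subst scalar_prod_delete[of _ p _ j]) (auto simp: s_def)
  finally have zj: "z $ j = S $$ (j,j) * w $ j + s \<bullet> vec_delete j w" .
  have "z \<bullet> w = z $ j * w $ j + vec_delete j z \<bullet> vec_delete j w"
    by (rule scalar_prod_delete[OF z w j])
  moreover have "(cond_cov S j *\<^sub>v vec_delete j w) \<bullet> vec_delete j w 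
      = vec_delete j z \<bullet> vec_delete j w - z $ j / S $$ (j,j) * (s \<bullet> vec_delete j w)"
    using d unfolding cond_cov_mult_vec[OF Sc j less_imp_neq[OF d, symmetric] w] z_def[symmetric] s_def[symmetric]
    using vw s by (subst minus_scalar_prod_distrib[of _ "p-1"]) auto
  moreover have "s \<bullet> vec_delete j w = z $ j - S $$ (j,j) * w $ j" using zj by simp
  ultimately show ?thesis using d by (simp add: field_simps power2_eq_square flip: z_def)
qed

text \<open>
  Extend \<open>v\<close> by the \<open>j\<close>th coordinate that makes \<open>(S w)\<^sub>j\<close> vanish; then both forms take the same
  value.
\<close>

lemma pos_def_cond_cov:
  assumes S: "pos_def_mat p S" and j: "j < p"
  shows "pos_def_mat (p - 1) (cond_cov S j)"
  unfolding pos_def_mat_def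
proof (intro conjI ballI impI)
  note Sc = pos_def_carrier[OF S] and d = pos_def_diag[OF S j]
  show cc: "cond_cov S j \<in> carrier_mat (p - 1) (p - 1)" by (rule cond_cov_carrier[OF Sc])
  show "transpose_mat (cond_cov S j) = cond_cov S j"
  proof (rule eq_matI)
    fix i k assume "i < dim_row (cond_cov S j)" "k < dim_col (cond_cov S j)"
    then have ik: "i < p - 1" "k < p - 1" using cc by auto
    note l = insert_index_less[OF j ik(1)] insert_index_less[OF j ik(2)]
    show "transpose_mat (cond_cov S j) $$ (i,k) = cond_cov S j $$ (i,k)"
      using cc ik pos_def_sym_entry[OF S l] pos_def_sym_entry[OF S l(1) j] pos_def_sym_entry[OF S l(2) j]
      by (simp add: cond_cov_index[OF Sc j])
  qed (use cc in auto)
  fix v :: "real vec" assume v: "v \<in> carrier_vec (p - 1)" "v \<noteq> 0\<^sub>v (p - 1)"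
  define s where "s = vec_delete j (col S j)"
  define w where "w = vec p (\<lambda>i. if i = j then - (s \<bullet> v) / S $$ (j,j) else v $ delete_index j i)"
  have w: "w \<in> carrier_vec p" by (simp add: w_def)
  have vw: "vec_delete j w = v" 
    using v j by (intro eq_vecI) (auto simp: w_def vec_delete_def delete_index_def)
  have "(S *\<^sub>v w) $ j = col S j \<bullet> w" using Sc j w pos_def_row_col[OF S j] by simp
  also have "\<dots> = S $$ (j,j) * w $ j + s \<bullet> vec_delete j w"
    using Sc j w by (subst scalar_prod_delete[of _ p _ j]) (auto simp: s_def)
  also have "\<dots> = 0" unfolding vw using d j by (simp add: w_def)
  finally have "(S *\<^sub>v w) \<bullet> w = (cond_cov S j *\<^sub>v v) \<bullet> v"
    using quadratic_form_split[OF S j w] by (simp add: vw)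
  moreover have "w \<noteq> 0\<^sub>v p"
  proof
    assume "w = 0\<^sub>v p"
    then have "vec_delete j w = 0\<^sub>v (p - 1)" 
      using insert_index_less[OF j] by (intro eq_vecI) (auto simp: vec_delete_index)
    with vw v show False by simp
  qed
  then have "w \<bullet> (S *\<^sub>v w) > 0" using pos_def_pos[OF S w] by simp
  ultimately show "v \<bullet> (cond_cov S j *\<^sub>v v) > 0"
    using comm_scalar_prod[OF w mult_mat_vec_carrier[OF Sc w]] 
      comm_scalar_prod[OF v(1) mult_mat_vec_carrier[OF cc v(1)]] by simp
qed

text \<open>
  Clear the \<open>j\<close>th column with the pivot \<open>S\<^sub>j\<^sub>j\<close>.  The elimination matrix \<open>L\<close> has determinant \<open>1\<close>, and
  deleting row and column \<open>j\<close> from \<open>L S\<close> leaves exactly the Schur complement.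
\<close>

lemma det_Schur_complement:
  assumes S: "S \<in> carrier_mat p p" and j: "j < p" and nz: "S $$ (j,j) \<noteq> 0"
  shows "det S = S $$ (j,j) * det (cond_cov S j)"
proof -
  define L where "L = mat p p (\<lambda>(i,k). (if i = k then 1 else 0) - (if k = j \<and> i \<noteq> j then S $$ (i,j) / S $$ (j,j) else 0))"
  have L: "L \<in> carrier_mat p p" by (simp add: L_def)
  have LS: "L * S \<in> carrier_mat p p" using L S by auto
  have ent: "(L * S) $$ (i,k) = S $$ (i,k) - (if i \<noteq> j then S $$ (i,j) * S $$ (j,k) / S $$ (j,j) else 0)"
    if "i < p" "k < p" for i k
  proof -
    have "(L * S) $$ (i,k) = (\<Sum>m<p. L $$ (i,m) * S $$ (m,k))"
      using that L S by (simp add: scalar_prod_sum[of _ p])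
    also have "\<dots> = (\<Sum>m<p. (if m = i then S $$ (m,k) else 0) - 
        (if m = j then (if i \<noteq> j then S $$ (i,j) / S $$ (j,j) else 0) * S $$ (m,k) else 0))"
      using that by (intro sum.cong) (auto simp: L_def algebra_simps)
    also have "\<dots> = S $$ (i,k) - (if i \<noteq> j then S $$ (i,j) / S $$ (j,j) else 0) * S $$ (j,k)"
      using that j by (simp add: sum_subtractf)
    finally show ?thesis by simp
  qed
  have "det L = (\<Sum>k<p. L $$ (j,k) * cofactor L j k)" by (rule laplace_expansion_row[OF L j])
  also have "\<dots> = (\<Sum>k<p. if k = j then cofactor L j j else 0)"
    using j by (intro sum.cong) (auto simp: L_def)
  also have "\<dots> = det (mat_delete L j j)" using j by (simp add: cofactor_def)
  also have "mat_delete L j j = 1\<^sub>m (p - 1)" using j by (intro eq_matI) (auto simp: mat_delete_def L_def)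
  finally have "det S = det (L * S)" using det_mult[OF L S] by simp
  also have "\<dots> = (\<Sum>i<p. (L * S) $$ (i,j) * cofactor (L * S) i j)" by (rule laplace_expansion_column[OF LS j])
  also have "\<dots> = (\<Sum>i<p. if i = j then S $$ (j,j) * cofactor (L * S) j j else 0)"
    using j nz by (intro sum.cong) (auto simp: ent)
  also have "\<dots> = S $$ (j,j) * det (mat_delete (L * S) j j)" using j by (simp add: cofactor_def)
  also have "mat_delete (L * S) j j = cond_cov S j"
  proof (rule eq_matI)
    fix i k assume "i < dim_row (cond_cov S j)" "k < dim_col (cond_cov S j)"
    then have ik: "i < p - 1" "k < p - 1" using cond_cov_carrier[OF S, of j] by auto
    note l = insert_index_less[OF j ik(1)] insert_index_less[OF j ik(2)]
    have "mat_delete (L * S) j j $$ (i,k) = (L * S) $$ (insert_index j i, insert_index j k)"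
      using mat_delete_index[of "L * S" "p - 1" j j i k] ik j LS by simp
    moreover have "insert_index j i \<noteq> j" by (auto simp: insert_index_def)
    ultimately show "mat_delete (L * S) j j $$ (i,k) = cond_cov S j $$ (i,k)"
      using ent[OF l] cond_cov_index[OF S j ik] by simp
  qed (use LS cond_cov_carrier[OF S, of j] in \<open>auto simp: mat_delete_def\<close>)
  finally show ?thesis .
qed

text \<open>
  This is the factorisation into a marginal and a conditional density.  If \<open>S w = y - \<mu>\<close>, then the
  conditional covariance maps \<open>w\<close> without its \<open>j\<close>th entry to the deviation from the conditional
  mean, so that \<open>quadratic_form_split\<close> splits the exponent; the determinants split as well.
\<close>

lemma mvn_density_condition:
  assumes mu: "\<mu> \<in> carrier_vec p" and S: "pos_def_mat p S" and j: "j < p" and y: "y \<in> carrier_vec p"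
  shows "mvn_density \<mu> S y = normal_density (\<mu> $ j) (sqrt (S $$ (j,j))) (y $ j) *
    mvn_density (cond_mean \<mu> S j (y $ j)) (cond_cov S j) (vec_delete j y)"
proof -
  note Sc = pos_def_carrier[OF S] and d = pos_def_diag[OF S j]
  note C = pos_def_cond_cov[OF S j]
  define z w u where "z = y - \<mu>" and "w = inv_mat S *\<^sub>v z"
    and "u = vec_delete j y - cond_mean \<mu> S j (y $ j)"
  have z: "z \<in> carrier_vec p" using y mu by (simp add: z_def)
  have w: "w \<in> carrier_vec p" "S *\<^sub>v w = z"
    using inv_mat_inverse(1)[OF Sc pos_def_det[OF S]] inv_mat_mult_vec[OF Sc pos_def_det[OF S] z] z
    by (auto simp: w_def)
  have "u = vec_delete j z - (z $ j / S $$ (j,j)) \<cdot>\<^sub>v vec_delete j (col S j)"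
    using mu y j Sc insert_index_less[OF j]
    by (intro eq_vecI) (auto simp: u_def cond_mean_def z_def vec_delete_index)
  then have u: "u = cond_cov S j *\<^sub>v vec_delete j w"
    using cond_cov_mult_vec[OF Sc j _ w(1)] d w(2) by simp
  have "inv_mat (cond_cov S j) *\<^sub>v u = vec_delete j w"
    unfolding u using w by (intro inv_mat_mult_vec[OF pos_def_carrier[OF C] pos_def_det[OF C]]) simp
  then have q: "z \<bullet> (inv_mat S *\<^sub>v z) = (z $ j)\<^sup>2 / S $$ (j,j) + u \<bullet> (inv_mat (cond_cov S j) *\<^sub>v u)"
    using quadratic_form_split[OF S j w(1)] w(2) by (simp add: u flip: w_def)
  have dim: "dim_vec (cond_mean \<mu> S j (y $ j)) = p - 1" using mu Sc by (simp add: cond_mean_def)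
  have pp: "(2 * pi) ^ p = (2 * pi) * (2 * pi) ^ (p - 1)" using j by (cases p) auto
  have "sqrt ((2 * pi) ^ p * det S) = sqrt (2 * pi * S $$ (j,j)) * sqrt ((2 * pi) ^ (p - 1) * det (cond_cov S j))"
    unfolding det_Schur_complement[OF Sc j less_imp_neq[OF d, symmetric]] pp
    by (simp only: real_sqrt_mult[symmetric]) (simp add: algebra_simps)
  moreover have "exp (- (z \<bullet> (inv_mat S *\<^sub>v z)) / 2) = exp (- (y $ j - \<mu> $ j)\<^sup>2 / (2 * S $$ (j,j))) *
      exp (- (u \<bullet> (inv_mat (cond_cov S j) *\<^sub>v u)) / 2)"
    unfolding q exp_add[symmetric] using j mu y d by (simp add: z_def field_simps)
  ultimately show ?thesis using mu d
    by (simp add: mvn_density_def normal_density_def dim flip: z_def u_def)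
qed

section \<open>Factorisations of the extended skew-normal density\<close>

lemma sqrt_mat_form:
  assumes S: "pos_def_mat p S" and u: "u \<in> carrier_vec p" and v: "v \<in> carrier_vec p"
  shows "(sqrt_mat S *\<^sub>v u) \<bullet> (sqrt_mat S *\<^sub>v v) = u \<bullet> (S *\<^sub>v v)"
proof -
  note R = sqrt_mat_pos_def[OF S] note Rc = pos_def_carrier[OF R(1)]
  have "S *\<^sub>v v = sqrt_mat S *\<^sub>v (sqrt_mat S *\<^sub>v v)"
    using assoc_mult_mat_vec[OF Rc Rc v] R(2) by simp
  then show ?thesis
    using pos_def_symmetric_form[OF R(1) u mult_mat_vec_carrier[OF Rc v]] by simp
qed

lemma sqrt_mat_inv_form:
  assumes S: "pos_def_mat p S" and u: "u \<in> carrier_vec p" and v: "v \<in> carrier_vec p"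
  shows "(sqrt_mat S *\<^sub>v u) \<bullet> (inv_mat (sqrt_mat S) *\<^sub>v v) = u \<bullet> v"
proof -
  note R = sqrt_mat_pos_def[OF S] note Rc = pos_def_carrier[OF R(1)] and Rd = pos_def_det[OF R(1)]
  have "inv_mat (sqrt_mat S) *\<^sub>v v \<in> carrier_vec p"
    using inv_mat_inverse(1)[OF Rc Rd] v by simp
  then show ?thesis
    using pos_def_symmetric_form[OF R(1) u, of "inv_mat (sqrt_mat S) *\<^sub>v v"] inv_mat_mult_vec(2)[OF Rc Rd v] by simp
qed

text \<open>
  With the shape vector written as \<open>\<Sigma>\<^sup>1\<^sup>/\<^sup>2 h\<close> the square root disappears from the density.  The
  joint density, the conditional ones and the univariate ones are all brought to this form.
\<close>

lemma esn_density_eq: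
  assumes S: "pos_def_mat p S" and mu: "\<mu> \<in> carrier_vec p" and h: "h \<in> carrier_vec p" and y: "y \<in> carrier_vec p"
  shows "esn_density \<mu> S (sqrt_mat S *\<^sub>v h) \<tau> y =
    inverse (std_normal_cdf (\<tau> / sqrt (1 + h \<bullet> (S *\<^sub>v h)))) * mvn_density \<mu> S y * std_normal_cdf (\<tau> + h \<bullet> (y - \<mu>))"
  using mu y by (simp add: esn_density_def esn_xi_def sqrt_mat_form[OF S h h] sqrt_mat_inv_form[OF S h])

lemma sqrt_mat_esn_phi:
  assumes S: "pos_def_mat p S" and l: "l \<in> carrier_vec p"
  shows "esn_phi S l \<in> carrier_vec p" "sqrt_mat S *\<^sub>v esn_phi S l = l"
    "sqrt_mat S *\<^sub>v l = S *\<^sub>v esn_phi S l"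
proof -
  note R = sqrt_mat_pos_def[OF S] note Rc = pos_def_carrier[OF R(1)] and Rd = pos_def_det[OF R(1)]
  show c: "esn_phi S l \<in> carrier_vec p" using inv_mat_inverse(1)[OF Rc Rd] l by (simp add: esn_phi_def)
  show e: "sqrt_mat S *\<^sub>v esn_phi S l = l" using inv_mat_mult_vec(2)[OF Rc Rd l] by (simp add: esn_phi_def)
  show "sqrt_mat S *\<^sub>v l = S *\<^sub>v esn_phi S l" using assoc_mult_mat_vec[OF Rc Rc c] R(2) e by simp
qed

lemma mvn_density_dim0:
  assumes "dim_vec \<mu> = 0" "S \<in> carrier_mat 0 0" "dim_vec y = 0" shows "mvn_density \<mu> S y = 1"
proof -
  have "S = 1\<^sub>m 0" using assms(2) by auto
  then show ?thesis using assms by (simp add: mvn_density_def scalar_prod_def)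
qed

lemma esn1_density_eq:
  assumes v: "v > 0"
  shows "esn1_density m v k \<tau> y = inverse (std_normal_cdf (\<tau> / sqrt (1 + k\<^sup>2))) * normal_density m (sqrt v) y *
    std_normal_cdf (\<tau> + k * (y - m) / sqrt v)"
proof -
  let ?M = "\<lambda>c. mat 1 1 (\<lambda>_. c) :: real mat"
  let ?v = "\<lambda>c. vec 1 (\<lambda>_. c) :: real vec"
  have pd: "pos_def_mat 1 (?M c)" if "c > 0" for c
    unfolding pos_def_mat_def
  proof (intro conjI ballI impI)
    fix u :: "real vec" assume u: "u \<in> carrier_vec 1" "u \<noteq> 0\<^sub>v 1"
    then have "u $ 0 \<noteq> 0" by (metis carrier_vecD eq_vecI index_zero_vec less_one)
    then have "0 < c * (u $ 0 * u $ 0)" using that by (metis mult_pos_pos not_real_square_gt_zero)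
    then show "u \<bullet> (?M c *\<^sub>v u) > 0" using u by (simp add: scalar_prod_def mult.left_commute One_nat_def)
  qed auto
  have "?M (sqrt v) * ?M (sqrt v) = ?M v" using v by (intro eq_matI) (auto simp: scalar_prod_def)
  then have R: "sqrt_mat (?M v) = ?M (sqrt v)"
    using sqrt_mat_pos_def(2)[OF pd[OF v]] by (intro pos_def_sqrt_unique[OF sqrt_mat_pos_def(1)[OF pd[OF v]] pd]) (use v in simp_all)
  let ?h = "?v (k / sqrt v)"
  have l: "?v k = sqrt_mat (?M v) *\<^sub>v ?h" unfolding R using v by (intro eq_vecI) (auto simp: scalar_prod_def)
  have mv: "mvn_density (?v m) (?M v) (?v y) = normal_density m (sqrt v) y"
    by (subst mvn_density_condition[OF _ pd[OF v], of _ 0])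
       (use cond_cov_carrier[of "?M v" 1 0] in \<open>auto simp: cond_mean_def intro!: mvn_density_dim0\<close>)
  have "?h \<bullet> (?M v *\<^sub>v ?h) = k\<^sup>2" 
    using v by (simp add: scalar_prod_def power2_eq_square field_simps)
  moreover have "?h \<bullet> (?v y - ?v m) = k * (y - m) / sqrt v" by (simp add: scalar_prod_def)
  ultimately show ?thesis
    unfolding esn1_density_def l by (subst esn_density_eq[OF pd[OF v]]) (simp_all add: mv)
qed

text \<open>
  Let \<open>q = h' \<bullet> cond_cov S j h'\<close>, where \<open>h'\<close> is \<open>h\<close> without its \<open>j\<close>th entry, and let \<open>k\<close> be the
  slope \<open>cond_phi\<close>, which equals \<open>(S h)\<^sub>j / S\<^sub>j\<^sub>j\<close>.  Then \<open>h \<bullet> S h = S\<^sub>j\<^sub>j k\<^sup>2 + q\<close> and \<open>c = (1 + q)\<^sup>-\<^sup>1\<^sup>/\<^sup>2\<close>, so the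
  normalising constant of the marginal density is that of the joint one.  The normalising constant
  of the conditional density is the factor \<open>\<Phi>\<close> of the marginal density and cancels against it.
\<close>

lemma esn_density_condition:
  assumes S: "pos_def_mat p S" and mu: "\<mu> \<in> carrier_vec p" and l: "l \<in> carrier_vec p"
    and j: "j < p" and y: "y \<in> carrier_vec p"
  shows "esn_density \<mu> S l \<tau> y =
    esn1_density (\<mu> $ j) (S $$ (j,j)) (esn_c S l j * sqrt (S $$ (j,j)) * cond_phi S l j) (esn_c S l j * \<tau>) (y $ j) *
    esn_density (cond_mean \<mu> S j (y $ j)) (cond_cov S j) (sqrt_mat (cond_cov S j) *\<^sub>v vec_delete j (esn_phi S l))
       (cond_tau \<mu> S l \<tau> j (y $ j)) (vec_delete j y)"
proof -
  note Sc = pos_def_carrier[OF S] and d = pos_def_diag[OF S j]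
  note C = pos_def_cond_cov[OF S j] note Cc = pos_def_carrier[OF C]
  define h where "h = esn_phi S l"
  define h' where "h' = vec_delete j h"
  define s where "s = vec_delete j (col S j)"
  define z where "z = y - \<mu>"
  define \<sigma> where "\<sigma> = S $$ (j,j)"
  define k where "k = cond_phi S l j"
  define q where "q = h' \<bullet> (cond_cov S j *\<^sub>v h')"
  define c where "c = esn_c S l j"
  have h: "h \<in> carrier_vec p" "sqrt_mat S *\<^sub>v h = l" using sqrt_mat_esn_phi[OF S l] by (auto simp: h_def)
  have h': "h' \<in> carrier_vec (p - 1)" using h by (simp add: h'_def)
  have z: "z \<in> carrier_vec p" using mu y by (simp add: z_def)
  have s: "s \<in> carrier_vec (p - 1)" using Sc j by (simp add: s_def)
  have \<sigma>: "\<sigma> > 0" using d by (simp add: \<sigma>_def)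
  have q: "q \<ge> 0" unfolding q_def by (rule pos_def_nonneg[OF C h'])
  have c: "c = 1 / sqrt (1 + q)" by (simp add: c_def esn_c_def q_def h'_def h_def)
  have sh: "s \<bullet> h' = \<sigma> * (k - h $ j)"
    using \<sigma> by (simp add: k_def cond_phi_def pos_def_row_col[OF S j] \<sigma>_def s_def h'_def h_def)
  have "(S *\<^sub>v h) $ j = col S j \<bullet> h" using Sc j h pos_def_row_col[OF S j] by simp
  also have "\<dots> = \<sigma> * h $ j + s \<bullet> h'"
    using Sc j h by (subst scalar_prod_delete[of _ p _ j]) (auto simp: s_def h'_def \<sigma>_def)
  finally have Shj: "(S *\<^sub>v h) $ j = \<sigma> * k" by (simp add: sh algebra_simps)
  have hSh: "h \<bullet> (S *\<^sub>v h) = \<sigma> * k\<^sup>2 + q"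
    using quadratic_form_split[OF S j h(1)] Shj \<sigma> comm_scalar_prod[OF h(1) mult_mat_vec_carrier[OF Sc h(1)]]
      comm_scalar_prod[OF h' mult_mat_vec_carrier[OF Cc h']]
    by (simp add: q_def power2_eq_square flip: \<sigma>_def h'_def)
  define u where "u = vec_delete j y - cond_mean \<mu> S j (y $ j)"
  have "u = vec_delete j z - (z $ j / \<sigma>) \<cdot>\<^sub>v s"
    using mu y j Sc insert_index_less[OF j]
    by (intro eq_vecI) (auto simp: u_def cond_mean_def z_def vec_delete_index s_def \<sigma>_def)
  then have "h' \<bullet> u = h' \<bullet> vec_delete j z - z $ j / \<sigma> * (h' \<bullet> s)"
    using h' s z by (simp add: scalar_prod_minus_distrib[of _ "p - 1"])
  also have "h' \<bullet> s = \<sigma> * (k - h $ j)" using comm_scalar_prod[OF h' s] sh by simp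
  also have "h' \<bullet> vec_delete j z = h \<bullet> z - h $ j * z $ j"
    using scalar_prod_delete[OF h(1) z j] by (simp add: h'_def)
  finally have hu: "h' \<bullet> u = h \<bullet> z - k * z $ j" using \<sigma> by (simp add: field_simps)
  have zj: "z $ j = y $ j - \<mu> $ j" using j y mu by (simp add: z_def)
  have t: "cond_tau \<mu> S l \<tau> j (y $ j) = \<tau> + k * z $ j" by (simp add: cond_tau_def k_def zj)
  have cm: "cond_mean \<mu> S j (y $ j) \<in> carrier_vec (p - 1)" using mu Sc j by (simp add: cond_mean_def)
  have E: "esn_density \<mu> S l \<tau> y = inverse (std_normal_cdf (\<tau> / sqrt (1 + (\<sigma> * k\<^sup>2 + q)))) * 
     mvn_density \<mu> S y * std_normal_cdf (\<tau> + h \<bullet> z)"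
    using esn_density_eq[OF S mu h(1) y, of \<tau>] by (simp add: h hSh z_def)
  have E': "esn_density (cond_mean \<mu> S j (y $ j)) (cond_cov S j) (sqrt_mat (cond_cov S j) *\<^sub>v h')
       (cond_tau \<mu> S l \<tau> j (y $ j)) (vec_delete j y) = 
     inverse (std_normal_cdf ((\<tau> + k * z $ j) / sqrt (1 + q))) * 
     mvn_density (cond_mean \<mu> S j (y $ j)) (cond_cov S j) (vec_delete j y) * std_normal_cdf (\<tau> + h \<bullet> z)"
    using y by (subst esn_density_eq[OF C cm h']) (simp_all add: t hu flip: q_def u_def)
  have "c * \<tau> + c * sqrt \<sigma> * k * (y $ j - \<mu> $ j) / sqrt \<sigma> = (\<tau> + k * z $ j) / sqrt (1 + q)"
    using \<sigma> by (simp add: c zj add_divide_distrib)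
  moreover have "c * \<tau> / sqrt (1 + (c * sqrt \<sigma> * k)\<^sup>2) = \<tau> / sqrt (1 + (\<sigma> * k\<^sup>2 + q))"
  proof -
    have "1 + (c * sqrt \<sigma> * k)\<^sup>2 = (1 + (\<sigma> * k\<^sup>2 + q)) / (1 + q)"
      using q \<sigma> by (simp add: c power_mult_distrib power_divide field_simps)
    then show ?thesis using q by (simp add: c real_sqrt_divide)
  qed
  ultimately have E1: "esn1_density (\<mu> $ j) \<sigma> (c * sqrt \<sigma> * k) (c * \<tau>) (y $ j) =
     inverse (std_normal_cdf (\<tau> / sqrt (1 + (\<sigma> * k\<^sup>2 + q)))) * normal_density (\<mu> $ j) (sqrt \<sigma>) (y $ j) *
     std_normal_cdf ((\<tau> + k * z $ j) / sqrt (1 + q))"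
    by (subst esn1_density_eq[OF \<sigma>]) simp
  show ?thesis
    unfolding h_def[symmetric] h'_def[symmetric] \<sigma>_def[symmetric] k_def[symmetric] c_def[symmetric] E E' E1
    using std_normal_cdf_pos[of "(\<tau> + k * z $ j) / sqrt (1 + q)"]
    by (simp add: mvn_density_condition[OF mu S j y] field_simps flip: \<sigma>_def)
qed

section \<open>Completing the square in the skewing factor\<close>

text \<open>
  Bordering the identity with \<open>v\<close> and \<open>u\<close> gives a matrix of size \<open>p + 1\<close>; eliminating either one of
  the two border blocks computes its determinant as \<open>1 - u \<bullet> v\<close> or as the left-hand side.
\<close>

lemma det_one_minus_outer_prod:
  fixes u v :: "real vec"
  assumes u: "u \<in> carrier_vec p" and v: "v \<in> carrier_vec p"
  shows "det (1\<^sub>m p - outer_prod u v) = 1 - u \<bullet> v"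
proof -
  define U where "U = mat p 1 (\<lambda>(i,_). u $ i)"
  define V where "V = mat 1 p (\<lambda>(_,k). v $ k)"
  have c: "U \<in> carrier_mat p 1" "V \<in> carrier_mat 1 p" by (auto simp: U_def V_def)
  let ?E = "1\<^sub>m p :: real mat" and ?e = "1\<^sub>m 1 :: real mat"
  define A where "A = four_block_mat ?e V U ?E"
  have A: "A \<in> carrier_mat (1 + p) (1 + p)" using c by (simp add: A_def)
  have 1: "A * four_block_mat ?e (0\<^sub>m 1 p) (- U) ?E = four_block_mat (?e - V * U) V (0\<^sub>m p 1) ?E"
    unfolding A_def
    by (subst mult_four_block_mat[of _ 1 1 _ p _ p _ _ 1 _ p]) 
       (use c in \<open>auto intro!: cong_four_block_mat\<close>)
  have 2: "A * four_block_mat ?e (- V) (0\<^sub>m p 1) ?E = four_block_mat ?e (0\<^sub>m 1 p) U (?E - U * V)"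
    unfolding A_def
    by (subst mult_four_block_mat[of _ 1 1 _ p _ p _ _ 1 _ p]) 
       (use c in \<open>auto intro!: cong_four_block_mat\<close>)
  have "det A = det (four_block_mat (?e - V * U) V (0\<^sub>m p 1) ?E)"
    unfolding 1[symmetric] using c
    by (subst det_mult[OF A]) (auto simp: det_four_block_mat_upper_right_zero[of _ 1 _ p])
  also have "\<dots> = det (?e - V * U)"
    using c by (subst det_four_block_mat_lower_left_zero[of _ 1 _ p]) auto
  also have "\<dots> = 1 - u \<bullet> v"
    using u v by (subst det_single) (auto simp: U_def V_def scalar_prod_def mult.commute)
  finally have "det A = 1 - u \<bullet> v" .
  moreover have "det A = det (four_block_mat ?e (0\<^sub>m 1 p) U (?E - U * V))"
    unfolding 2[symmetric] using c
    by (subst det_mult[OF A]) (auto simp: det_four_block_mat_lower_left_zero[of _ 1 _ p])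
  moreover have "\<dots> = det (?E - U * V)"
    using c by (subst det_four_block_mat_upper_right_zero[of _ 1 _ p]) auto
  moreover have "U * V = outer_prod u v"
    using u v by (intro eq_matI) (auto simp: U_def V_def outer_prod_def scalar_prod_def)
  ultimately show ?thesis by simp
qed

lemma outer_prod_mult_vec:
  assumes "u \<in> carrier_vec n" "v \<in> carrier_vec m" "w \<in> carrier_vec m"
  shows "outer_prod u v *\<^sub>v w = (v \<bullet> w) \<cdot>\<^sub>v u"
  using assms by (intro eq_vecI) (auto simp: outer_prod_def scalar_prod_def sum_distrib_left mult.assoc mult.commute mult.left_commute)

text \<open>
  Completing the square.  Put \<open>g = S h\<close> and \<open>L = l \<bullet> l = h \<bullet> g\<close>, so that \<open>\<Gamma> = S - g g\<^sup>T / (1 + L)\<close> and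
  \<open>\<mu>\<^sub>b = \<tau> g / (1 + L)\<close>.  With \<open>z = y - \<mu>\<close>, \<open>c = \<tau> + h \<bullet> z\<close> and \<open>v = S\<inverse> z + c h\<close> one finds
  \<open>\<Gamma> v = z + \<mu>\<^sub>b\<close>, which is the Sherman-Morrison formula, and
  \<open>z \<bullet> S\<inverse> z + c\<^sup>2 = (z + \<mu>\<^sub>b) \<bullet> v + \<tau>\<^sup>2 / (1 + L)\<close>.  The constants match because
  \<open>det \<Gamma> = det S / (1 + L)\<close>.
\<close>

lemma mvn_density_mult_normal:
  assumes S: "pos_def_mat p S" and mu: "\<mu> \<in> carrier_vec p" and l: "l \<in> carrier_vec p"
    and y: "y \<in> carrier_vec p"
  shows "mvn_density \<mu> S y * std_normal_density (\<tau> + esn_phi S l \<bullet> (y - \<mu>)) =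
    normal_density 0 (sqrt (1 + l \<bullet> l)) \<tau> * mvn_density (\<mu> - esn_mu_b S l \<tau>) (esn_Gamma S l) y"
proof -
  note Sc = pos_def_carrier[OF S]
  define h where "h = esn_phi S l"
  define g where "g = S *\<^sub>v h"
  define L where "L = l \<bullet> l"
  define G where "G = esn_Gamma S l"
  have h: "h \<in> carrier_vec p" "sqrt_mat S *\<^sub>v h = l" "sqrt_mat S *\<^sub>v l = g"
    using sqrt_mat_esn_phi[OF S l] by (auto simp: h_def g_def)
  have g: "g \<in> carrier_vec p" using h Sc by (simp add: g_def)
  have hg: "h \<bullet> g = L" using sqrt_mat_form[OF S h(1) h(1)] h by (simp add: L_def g_def)
  have gh: "g \<bullet> h = L" using comm_scalar_prod[OF g h(1)] hg by simp
  have L: "L \<ge> 0" using vec_norm_sq[of l] zero_le_power2[of "vec_norm l"] by (simp add: L_def)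
  define s where "s = sqrt (1 + L)"
  have s: "s > 0" "s * s = 1 + L" using L by (auto simp: s_def)
  have D: "esn_Delta S l = (1 / s) \<cdot>\<^sub>v g" by (simp add: esn_Delta_def h L_def s_def)
  have mb: "esn_mu_b S l \<tau> = (\<tau> / (1 + L)) \<cdot>\<^sub>v g"
    unfolding esn_mu_b_def esn_tau_def D using s
    by (simp add: smult_smult_assoc flip: L_def s_def)
  have out: "outer_prod (esn_Delta S l) (esn_Delta S l) = (1 / (1 + L)) \<cdot>\<^sub>m outer_prod g g"
    unfolding D s(2)[symmetric] by (intro eq_matI) (auto simp: outer_prod_def)
  have oc: "outer_prod g g \<in> carrier_mat p p" using g by (simp add: outer_prod_def)
  have Gc: "G \<in> carrier_mat p p" unfolding G_def esn_Gamma_def out using Sc oc by (auto intro!: minus_carrier_mat)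
  have Gv: "G *\<^sub>v v = S *\<^sub>v v - ((g \<bullet> v) / (1 + L)) \<cdot>\<^sub>v g" if v: "v \<in> carrier_vec p" for v
  proof -
    have "((1 / (1 + L)) \<cdot>\<^sub>m outer_prod g g) *\<^sub>v v = (1 / (1 + L)) \<cdot>\<^sub>v (outer_prod g g *\<^sub>v v)"
      using v oc by (intro eq_vecI) auto
    then show ?thesis
      unfolding G_def esn_Gamma_def out using v Sc oc g
      by (simp add: minus_mult_distrib_mat_vec[of _ p p] outer_prod_mult_vec[of _ p _ p] smult_smult_assoc)
  qed
  have detG: "det G = det S / (1 + L)"
  proof -
    define h' where "h' = (1 / (1 + L)) \<cdot>\<^sub>v h"
    have h': "h' \<in> carrier_vec p" using h by (simp add: h'_def)
    have oc': "outer_prod g h' \<in> carrier_mat p p" using g h' by (simp add: outer_prod_def)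
    have "outer_prod g h' * S = (1 / (1 + L)) \<cdot>\<^sub>m outer_prod g g"
    proof (intro eq_matI)
      fix i k assume "i < dim_row ((1 / (1 + L)) \<cdot>\<^sub>m outer_prod g g)" "k < dim_col ((1 / (1 + L)) \<cdot>\<^sub>m outer_prod g g)"
      then have ik: "i < p" "k < p" using g by (auto simp: outer_prod_def)
      have "g $ k = col S k \<bullet> h" using ik h Sc pos_def_row_col[OF S ik(2)] by (simp add: g_def)
      also have "\<dots> = (\<Sum>m<p. S $$ (m,k) * h $ m)"
        using ik Sc h by (subst scalar_prod_sum[of _ p]) auto
      finally have gk: "g $ k = (\<Sum>m<p. S $$ (m,k) * h $ m)" .
      have "(outer_prod g h' * S) $$ (i,k) = (\<Sum>m<p. g $ i * h' $ m * S $$ (m,k))"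
        using ik Sc oc' g h' by (simp add: scalar_prod_sum[of _ p]) (simp add: outer_prod_def)
      also have "\<dots> = g $ i / (1 + L) * g $ k"
        unfolding gk sum_distrib_left using h by (intro sum.cong) (auto simp: h'_def)
      finally show "(outer_prod g h' * S) $$ (i,k) = ((1 / (1 + L)) \<cdot>\<^sub>m outer_prod g g) $$ (i,k)"
        using ik g by (simp add: outer_prod_def)
    qed (use Sc oc oc' in auto)
    then have "G = (1\<^sub>m p - outer_prod g h') * S"
      unfolding G_def esn_Gamma_def out minus_mult_distrib_mat[OF one_carrier_mat oc' Sc] using Sc by simp
    then have "det G = det (1\<^sub>m p - outer_prod g h') * det S"
      using oc' by (simp add: det_mult[of _ p] minus_carrier_mat Sc)
    also have "det (1\<^sub>m p - outer_prod g h') = 1 - L / (1 + L)"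
      unfolding det_one_minus_outer_prod[OF g h'] using g h gh by (simp add: h'_def)
    finally show ?thesis using L by (simp add: field_simps)
  qed
  have dG: "det G \<noteq> 0" using detG pos_def_det[OF S] L by simp
  define z w where "z = y - \<mu>" and "w = inv_mat S *\<^sub>v z"
  have z: "z \<in> carrier_vec p" using y mu by (simp add: z_def)
  have w: "w \<in> carrier_vec p" "S *\<^sub>v w = z"
    using inv_mat_inverse(1)[OF Sc pos_def_det[OF S]] inv_mat_mult_vec[OF Sc pos_def_det[OF S] z] z
    by (auto simp: w_def)
  define x where "x = h \<bullet> z"
  have gw: "g \<bullet> w = x"
    using pos_def_symmetric_form[OF S h(1) w(1)] w by (simp add: g_def x_def)
  have zh: "z \<bullet> h = x" using comm_scalar_prod[OF z h(1)] by (simp add: x_def)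
  define c where "c = \<tau> + x"
  define z' where "z' = z + (\<tau> / (1 + L)) \<cdot>\<^sub>v g"
  have z'_eq: "y - (\<mu> - esn_mu_b S l \<tau>) = z'"
    using y mu g by (intro eq_vecI) (auto simp: mb z'_def z_def)
  have z': "z' \<in> carrier_vec p" using z g by (simp add: z'_def)
  define v where "v = w + c \<cdot>\<^sub>v h"
  have v: "v \<in> carrier_vec p" using w h by (simp add: v_def)
  have "G *\<^sub>v v = z'"
  proof -
    have Sv: "S *\<^sub>v v = z + c \<cdot>\<^sub>v g"
      using w h Sc by (simp add: v_def mult_add_distrib_mat_vec[of _ p p] mult_mat_vec[of _ p p] g_def)
    have gv: "g \<bullet> v = x + c * L"
      using w h g gh by (simp add: v_def scalar_prod_add_distrib[of _ p] gw)
    have "c - (x + c * L) / (1 + L) = \<tau> / (1 + L)" using L by (simp add: c_def field_simps)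
    moreover have "z $ i + c * g $ i - a * g $ i = z $ i + (c - a) * g $ i" for i a
      by (simp add: left_diff_distrib)
    ultimately have "z $ i + c * g $ i - (x + c * L) / (1 + L) * g $ i = z $ i + \<tau> / (1 + L) * g $ i" for i
      by metis
    then show ?thesis
      unfolding Gv[OF v] Sv gv z'_def using z g by (intro eq_vecI) auto
  qed
  then have iG: "inv_mat G *\<^sub>v z' = v" using inv_mat_mult_vec(1)[OF Gc dG v] by simp
  have "z' \<bullet> v = z \<bullet> w + c * x + \<tau> / (1 + L) * (x + c * L)"
    using z g w h gh gw zh by (simp add: z'_def v_def add_scalar_prod_distrib[of _ p] scalar_prod_add_distrib[of _ p] algebra_simps add_divide_distrib)
  then have q: "z \<bullet> w + c\<^sup>2 = z' \<bullet> v + \<tau>\<^sup>2 / (1 + L)"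
    using L by (simp add: c_def field_simps power2_eq_square)
  have dim: "dim_vec (\<mu> - esn_mu_b S l \<tau>) = p" using g by (simp add: mb)
  have E: "exp (- (z \<bullet> w) / 2) * exp (- c\<^sup>2 / 2) = exp (- \<tau>\<^sup>2 / (2 * (1 + L))) * exp (- (z' \<bullet> v) / 2)"
  proof -
    have "- (z \<bullet> w) / 2 + - c\<^sup>2 / 2 = - \<tau>\<^sup>2 / (2 * (1 + L)) + - (z' \<bullet> v) / 2"
      using q L by (simp add: field_simps)
    then show ?thesis by (simp only: exp_add[symmetric])
  qed
  have K: "sqrt (2 * pi * (1 + L)) * sqrt ((2 * pi) ^ p * det G) = sqrt ((2 * pi) ^ p * det S) * sqrt (2 * pi)"
    unfolding real_sqrt_mult[symmetric] detG using L by simp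
  have N: "normal_density 0 (sqrt (1 + l \<bullet> l)) \<tau> = 1 / sqrt (2 * pi * (1 + L)) * exp (- \<tau>\<^sup>2 / (2 * (1 + L)))"
    using L by (simp add: normal_density_def L_def)
  have "mvn_density \<mu> S y * std_normal_density (\<tau> + h \<bullet> (y - \<mu>)) = 
      (exp (- (z \<bullet> w) / 2) * exp (- c\<^sup>2 / 2)) / (sqrt ((2 * pi) ^ p * det S) * sqrt (2 * pi))"
    using mu by (simp add: mvn_density_def std_normal_density_def c_def x_def flip: z_def w_def)
  also have "\<dots> = normal_density 0 (sqrt (1 + l \<bullet> l)) \<tau> * mvn_density (\<mu> - esn_mu_b S l \<tau>) G y"
    unfolding E K[symmetric] N mvn_density_def z'_eq iG dim by simp
  finally show ?thesis by (simp add: h_def G_def)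
qed

section \<open>Integration by parts over a box\<close>

interpretation lborel_prod: product_sigma_finite "\<lambda>_ :: nat. lborel :: real measure"
  by standard

lemma integrable_exp_minus_abs: "integrable lborel (\<lambda>x :: real. exp (- \<bar>x\<bar>))"
proof -
  interpret E: prob_space "density lborel (exponential_density 1)"
    by (rule prob_space_exponential_density) simp
  have "integrable (density lborel (exponential_density 1)) (\<lambda>_. 1 :: real)" by simp
  then have e: "integrable lborel (exponential_density 1)"
    by (subst (asm) integrable_density) (simp_all add: exponential_density_def[abs_def])
  then have e': "integrable lborel (\<lambda>x. exponential_density 1 (0 + (-1) * x))"
    by (intro lborel_integrable_real_affine) auto
  from Bochner_Integration.integrable_add[OF e e'] show ?thesis
    by (rule Bochner_Integration.integrable_bound) (auto simp: exponential_density_def)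
qed

lemma integrable_PiM_exp_bound:
  fixes f :: "(nat \<Rightarrow> real) \<Rightarrow> real"
  assumes "finite I" and "f \<in> borel_measurable (\<Pi>\<^sub>M i\<in>I. lborel)"
    and bd: "\<And>x. \<bar>f x\<bar> \<le> C * (\<Prod>i\<in>I. exp (- \<bar>x i\<bar>))"
  shows "integrable (\<Pi>\<^sub>M i\<in>I. lborel) f"
proof (rule Bochner_Integration.integrable_bound)
  show "integrable (\<Pi>\<^sub>M i\<in>I. lborel) (\<lambda>x. C * (\<Prod>i\<in>I. exp (- \<bar>x i\<bar>)))"
    using assms(1) integrable_exp_minus_abs
    by (intro integrable_mult_right lborel_prod.product_integrable_prod[of I "\<lambda>_ x. exp (- \<bar>x\<bar>)"]) auto
  show "AE x in \<Pi>\<^sub>M i\<in>I. lborel. norm (f x) \<le> norm (C * (\<Prod>i\<in>I. exp (- \<bar>x i\<bar>)))"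
    using bd by (intro AE_I2) (smt (verit) real_norm_def)
qed (use assms in auto)

text \<open>
  The fundamental theorem of calculus with endpoints that may be infinite, where the decay of \<open>F\<close>
  gives the value \<open>0\<close>.
\<close>

lemma integral_truncated_derivative:
  fixes F f :: "real \<Rightarrow> real" and a b :: ereal
  assumes ab: "a \<noteq> \<infinity>" "b \<noteq> -\<infinity>" "a \<le> b"
    and F: "\<And>x. (F has_real_derivative f x) (at x)" and f: "continuous_on UNIV f"
    and bd: "\<And>x. \<bar>F x\<bar> \<le> C * exp (- \<bar>x\<bar>)" "\<And>x. \<bar>f x\<bar> \<le> C * exp (- \<bar>x\<bar>)"
  shows "(LINT x|lborel. indicator {x. a \<le> ereal x \<and> ereal x \<le> b} x * f x) =
    (if b = \<infinity> then 0 else F (real_of_ereal b)) - (if a = -\<infinity> then 0 else F (real_of_ereal a))"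
proof -
  define A B where "A = (if a = -\<infinity> then 0 else F (real_of_ereal a))"
    and "B = (if b = \<infinity> then 0 else F (real_of_ereal b))"
  have fint: "integrable lborel f"
    by (rule Bochner_Integration.integrable_bound[OF integrable_mult_right[OF integrable_exp_minus_abs, of C]])
       (use bd(2) borel_measurable_continuous_onI[OF f] in \<open>auto intro!: AE_I2 simp: abs_mult intro: order_trans[OF bd(2)] mult_right_mono\<close>)
  have tail: "(F \<longlongrightarrow> 0) at_top" "(F \<longlongrightarrow> 0) at_bot"
  proof -
    have "filterlim (abs :: real \<Rightarrow> real) at_top at_bot"
      using filterlim_uminus_at_top_at_bot
      by (rule filterlim_mono_eventually) (auto intro: eventually_mono[OF eventually_le_at_bot[of 0]])
    then have *: "((\<lambda>x :: real. C * exp (- \<bar>x\<bar>)) \<longlongrightarrow> 0) at_top" "((\<lambda>x :: real. C * exp (- \<bar>x\<bar>)) \<longlongrightarrow> 0) at_bot"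
      by (auto intro!: tendsto_mult_right_zero filterlim_compose[OF exp_at_bot] 
          filterlim_compose[OF filterlim_uminus_at_bot_at_top] filterlim_abs_real filterlim_at_infinity_imp_norm_at_top)
    show "(F \<longlongrightarrow> 0) at_top" by (rule Lim_null_comparison[OF _ *(1)]) (simp add: bd)
    show "(F \<longlongrightarrow> 0) at_bot" by (rule Lim_null_comparison[OF _ *(2)]) (simp add: bd)
  qed
  have cont: "isCont F x" for x using F DERIV_isCont by blast
  \<comment> \<open>the fundamental theorem needs a nondegenerate interval\<close>
  show ?thesis
  proof (cases "a = b")
    case True
    then obtain r where r: "a = ereal r" "b = ereal r" using ab by (cases a) auto
    have "AE x in lborel. indicator {x. a \<le> ereal x \<and> ereal x \<le> b} x * f x = 0"
      using AE_lborel_singleton[of r] by eventually_elim (auto simp: r indicator_def)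
    then have "(LINT x|lborel. indicator {x. a \<le> ereal x \<and> ereal x \<le> b} x * f x) = 0"
      by (rule integral_eq_zero_AE)
    then show ?thesis by (simp add: r)
  next
    case False
    then have less: "a < b" using ab by simp
    have lim_a: "((F \<circ> real_of_ereal) \<longlongrightarrow> A) (at_right a)"
    proof (cases a)
      case (real r)
      then show ?thesis using cont[of r]
        by (auto simp: A_def ereal_tendsto_simps isCont_def intro: filterlim_mono[OF _ _ at_le])
    qed (use ab tail in \<open>auto simp: A_def ereal_tendsto_simps\<close>)
    have lim_b: "((F \<circ> real_of_ereal) \<longlongrightarrow> B) (at_left b)"
    proof (cases b)
      case (real r)
      then show ?thesis using cont[of r]
        by (auto simp: B_def ereal_tendsto_simps isCont_def intro: filterlim_mono[OF _ _ at_le])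
    qed (use ab tail in \<open>auto simp: B_def ereal_tendsto_simps\<close>)
    have "(LBINT x=a..b. f x) = B - A"
    proof (rule interval_integral_FTC_integrable[OF less])
      show "(F has_vector_derivative f x) (at x)" for x
        using F has_real_derivative_iff_has_vector_derivative by blast
      show "isCont f x" for x using f by (simp add: continuous_on_eq_continuous_at)
      show "set_integrable lborel (einterval a b) f"
        unfolding set_integrable_def using fint by (intro integrable_mult_indicator) auto
    qed (rule lim_a lim_b)+
    moreover have "(LINT x|lborel. indicator {x. a \<le> ereal x \<and> ereal x \<le> b} x * f x) = (LBINT x=a..b. f x)"
      unfolding interval_lebesgue_integral_def set_lebesgue_integral_def
    proof (simp add: ab, rule integral_cong_AE)
      show "(\<lambda>x. indicator {x. a \<le> ereal x \<and> ereal x \<le> b} x * f x) \<in> borel_measurable lborel"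
        using fint by (intro borel_measurable_times borel_measurable_indicator) auto
      show "(\<lambda>x. indicator (einterval a b) x * f x) \<in> borel_measurable lborel"
        using fint by (intro borel_measurable_times borel_measurable_indicator) auto
      show "AE x in lborel. indicator {x. a \<le> ereal x \<and> ereal x \<le> b} x * f x = indicator (einterval a b) x * f x"
        using AE_lborel_singleton[of "real_of_ereal a"] AE_lborel_singleton[of "real_of_ereal b"]
        by eventually_elim (cases a; cases b; auto simp: indicator_def einterval_def)
    qed
    ultimately show ?thesis by (simp add: A_def B_def)
  qed
qed

text \<open>
  Inverse to the deletion of coordinate \<open>j\<close>: the later coordinates of \<open>x\<close> move up by one place.
\<close>

definition insert_coord :: "nat \<Rightarrow> real \<Rightarrow> (nat \<Rightarrow> real) \<Rightarrow> nat \<Rightarrow> real" where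
  "insert_coord j t x i = (if i = j then t else x (delete_index j i))"

text \<open>
  Renumbering the coordinates other than \<open>j\<close> as \<open>0, ..., p - 2\<close> preserves the product measure.  The
  renumbered point is not extensional on the original index set, hence the assumption that \<open>f\<close>
  depends only on those coordinates.
\<close>

lemma integral_PiM_delete_coord:
  fixes f :: "(nat \<Rightarrow> real) \<Rightarrow> real"
  assumes j: "j < p" and f: "f \<in> borel_measurable (\<Pi>\<^sub>M i\<in>{..<p} - {j}. lborel)"
    and dep: "\<And>x y. (\<And>i. i \<in> {..<p} - {j} \<Longrightarrow> x i = y i) \<Longrightarrow> f x = f y"
  shows "(LINT x|(\<Pi>\<^sub>M i\<in>{..<p} - {j}. lborel). f x) = 
    (LINT x|(\<Pi>\<^sub>M i\<in>{..<p - 1}. lborel). f (\<lambda>i. x (delete_index j i)))"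
proof -
  let ?I = "{..<p} - {j}"
  define T :: "(nat \<Rightarrow> real) \<Rightarrow> nat \<Rightarrow> real" where "T x = (\<lambda>i\<in>?I. x (delete_index j i))" for x
  have bij: "bij_betw (delete_index j) ?I {..<p - 1}"
    by (rule bij_betw_byWitness[where f' = "insert_index j"])
       (use j in \<open>auto simp: insert_index_def delete_index_def\<close>)
  have dl: "delete_index j i < p - 1" if "i \<in> ?I" for i using bij that by (auto simp: bij_betw_def)
  have T[measurable]: "T \<in> measurable (\<Pi>\<^sub>M i\<in>{..<p - 1}. lborel) (\<Pi>\<^sub>M i\<in>?I. lborel)"
    unfolding T_def by (intro measurable_restrict measurable_component_singleton) (use dl in auto)
  have "distr (\<Pi>\<^sub>M i\<in>{..<p - 1}. lborel) (\<Pi>\<^sub>M i\<in>?I. lborel) T = (\<Pi>\<^sub>M i\<in>?I. lborel)"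
  proof (rule lborel_prod.PiM_eqI)
    fix A :: "nat \<Rightarrow> real set" assume A: "\<And>i. i \<in> ?I \<Longrightarrow> A i \<in> sets lborel"
    have "T -` Pi\<^sub>E ?I A \<inter> space (\<Pi>\<^sub>M i\<in>{..<p - 1}. lborel) = (\<Pi>\<^sub>E i\<in>{..<p - 1}. A (insert_index j i))"
    proof (intro equalityI subsetI)
      fix x assume x: "x \<in> T -` Pi\<^sub>E ?I A \<inter> space (\<Pi>\<^sub>M i\<in>{..<p - 1}. lborel)"
      have "x i \<in> A (insert_index j i)" if "i < p - 1" for i
      proof -
        have "insert_index j i \<in> ?I" "delete_index j (insert_index j i) = i"
          using that j by (auto simp: insert_index_def delete_index_def)
        then show ?thesis using x by (auto simp: T_def PiE_def Pi_def dest!: bspec[of _ _ "insert_index j i"])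
      qed
      then show "x \<in> (\<Pi>\<^sub>E i\<in>{..<p - 1}. A (insert_index j i))" using x by (auto simp: space_PiM PiE_def)
    next
      fix x assume x: "x \<in> (\<Pi>\<^sub>E i\<in>{..<p - 1}. A (insert_index j i))"
      have "x (delete_index j i) \<in> A i" if "i \<in> ?I" for i
      proof -
        have "insert_index j (delete_index j i) = i"
          using that by (auto simp: insert_index_def delete_index_def)
        then show ?thesis using x dl[OF that] by (metis PiE_mem lessThan_iff)
      qed
      then show "x \<in> T -` Pi\<^sub>E ?I A \<inter> space (\<Pi>\<^sub>M i\<in>{..<p - 1}. lborel)"
        using x by (auto simp: T_def space_PiM PiE_def)
    qed
    moreover have "emeasure (\<Pi>\<^sub>M i\<in>{..<p - 1}. lborel) (\<Pi>\<^sub>E i\<in>{..<p - 1}. A (insert_index j i)) = 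
        (\<Prod>i<p - 1. emeasure lborel (A (insert_index j i)))"
      using j A by (intro lborel_prod.emeasure_PiM) (auto simp: insert_index_def)
    moreover have "(\<Prod>i<p - 1. emeasure lborel (A (insert_index j i))) = (\<Prod>i\<in>?I. emeasure lborel (A i))"
      by (rule sym, rule prod.reindex_bij_witness[of _ "insert_index j" "delete_index j"])
         (use dl j in \<open>auto simp: insert_index_def delete_index_def\<close>)
    ultimately show "emeasure (distr (\<Pi>\<^sub>M i\<in>{..<p - 1}. lborel) (\<Pi>\<^sub>M i\<in>?I. lborel) T) (Pi\<^sub>E ?I A) = 
        (\<Prod>i\<in>?I. emeasure lborel (A i))"
      using A by (subst emeasure_distr) (auto intro!: sets_PiM_I_finite)
  qed auto
  then have "(LINT x|(\<Pi>\<^sub>M i\<in>?I. lborel). f x) = 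
      (LINT x|distr (\<Pi>\<^sub>M i\<in>{..<p - 1}. lborel) (\<Pi>\<^sub>M i\<in>?I. lborel) T. f x)" by simp
  also have "\<dots> = (LINT x|(\<Pi>\<^sub>M i\<in>{..<p - 1}. lborel). f (T x))"
    by (rule integral_distr[OF T f])
  also have "\<dots> = (LINT x|(\<Pi>\<^sub>M i\<in>{..<p - 1}. lborel). f (\<lambda>i. x (delete_index j i)))"
    by (intro Bochner_Integration.integral_cong refl dep) (auto simp: T_def)
  finally show ?thesis .
qed

text \<open>
  Points are functions on all of \<open>nat\<close>, of which only the first \<open>p\<close> coordinates matter; this is the
  form in which the truncated moments are integrals over a product measure.
\<close>

definition truncation_box :: "nat \<Rightarrow> ereal vec \<Rightarrow> ereal vec \<Rightarrow> (nat \<Rightarrow> real) set" where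
  "truncation_box p a b = {x. \<forall>i<p. a $ i \<le> ereal (x i) \<and> ereal (x i) \<le> b $ i}"

text \<open>
  Covers the full box (\<open>J\<close> empty) and the box without its \<open>j\<close>th side (\<open>J = {j}\<close>), which appears after
  the \<open>j\<close>th coordinate has been integrated out.
\<close>

lemma measurable_truncation_indicator:
  assumes "{..<p} - J \<subseteq> I" 
  shows "(\<lambda>x. indicator {x. \<forall>i\<in>{..<p} - J. a $ i \<le> ereal (x i) \<and> ereal (x i) \<le> b $ i} x :: real) 
    \<in> borel_measurable (\<Pi>\<^sub>M i\<in>I. lborel)"
proof -
  have m: "(\<lambda>x. ereal (x i)) \<in> borel_measurable (\<Pi>\<^sub>M i\<in>I. lborel)" if "i \<in> {..<p} - J" for i
    using that assms by (intro borel_measurable_ereal) (auto intro!: measurable_component_singleton[THEN measurable_compose] )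
  have "(\<lambda>x. indicator {x. \<forall>i\<in>{..<p} - J. a $ i \<le> ereal (x i) \<and> ereal (x i) \<le> b $ i} x :: real) =
    (\<lambda>x. \<Prod>i\<in>{..<p} - J. indicator {a $ i .. b $ i} (ereal (x i)))"
    by (intro ext) (auto simp: indicator_def prod_zero_iff)
  also have "\<dots> \<in> borel_measurable (\<Pi>\<^sub>M i\<in>I. lborel)"
    by (intro borel_measurable_prod measurable_compose[OF m] borel_measurable_indicator) auto
  finally show ?thesis .
qed

text \<open>
  Integrate out the \<open>j\<close>th coordinate first and apply the fundamental theorem of calculus on each line
  parallel to the \<open>j\<close>th axis.  A product bound restricts to every line and every face, so it
  provides all the integrability needed and also the vanishing at infinite endpoints.
\<close>

lemma integral_box_partial_derivative:
  fixes H D :: "(nat \<Rightarrow> real) \<Rightarrow> real"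
  assumes j: "j < p" and ab: "a $ j \<noteq> \<infinity>" "b $ j \<noteq> -\<infinity>" "a $ j \<le> b $ j"
    and dims: "dim_vec a = p" "dim_vec b = p"
    and der: "\<And>x y. ((\<lambda>y. H (x(j := y))) has_real_derivative D (x(j := y))) (at y)"
    and cont: "\<And>x. continuous_on UNIV (\<lambda>y. D (x(j := y)))"
    and bdH: "\<And>x. \<bar>H x\<bar> \<le> C * (\<Prod>i<p. exp (- \<bar>x i\<bar>))"
    and bdD: "\<And>x. \<bar>D x\<bar> \<le> C * (\<Prod>i<p. exp (- \<bar>x i\<bar>))"
    and mH: "H \<in> borel_measurable (\<Pi>\<^sub>M i\<in>{..<p}. lborel)"
    and mD: "D \<in> borel_measurable (\<Pi>\<^sub>M i\<in>{..<p}. lborel)"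
    and dep: "\<And>x y. (\<And>i. i < p \<Longrightarrow> x i = y i) \<Longrightarrow> H x = H y"
  defines "B \<equiv> \<lambda>t. LINT x|(\<Pi>\<^sub>M i\<in>{..<p - 1}. lborel). 
    indicator (truncation_box (p - 1) (vec_delete j a) (vec_delete j b)) x * H (insert_coord j t x)"
  shows "(LINT x|(\<Pi>\<^sub>M i\<in>{..<p}. lborel). indicator (truncation_box p a b) x * D x) =
    (if b $ j = \<infinity> then 0 else B (real_of_ereal (b $ j))) - 
    (if a $ j = -\<infinity> then 0 else B (real_of_ereal (a $ j)))"
proof -
  define I where "I = {..<p} - {j}"
  have I: "finite I" "j \<notin> I" "insert j I = {..<p}" using j by (auto simp: I_def)
  define X where "X = {x. \<forall>i\<in>I. a $ i \<le> ereal (x i) \<and> ereal (x i) \<le> b $ i}"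
  have box_eq: "truncation_box p a b = {x. \<forall>i\<in>{..<p} - {}. a $ i \<le> ereal (x i) \<and> ereal (x i) \<le> b $ i}"
    by (auto simp: truncation_box_def)
  have mbox: "(\<lambda>x. indicator (truncation_box p a b) x :: real) \<in> borel_measurable (\<Pi>\<^sub>M i\<in>{..<p}. lborel)"
    unfolding box_eq by (rule measurable_truncation_indicator) auto
  have mX: "(\<lambda>x. indicator X x :: real) \<in> borel_measurable (\<Pi>\<^sub>M i\<in>I. lborel)"
    unfolding X_def I_def by (rule measurable_truncation_indicator) auto
  have ind: "indicator (truncation_box p a b) (x(j := y)) = 
      (indicator X x * indicator {y. a $ j \<le> ereal y \<and> ereal y \<le> b $ j} y :: real)" for x y
    using j by (auto simp: truncation_box_def X_def I_def indicator_def)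
  have prodI: "(\<Prod>i<p. exp (- \<bar>(x(j := y)) i\<bar>)) = exp (- \<bar>y\<bar>) * (\<Prod>i\<in>I. exp (- \<bar>x i\<bar>))" for x :: "nat \<Rightarrow> real" and y
  proof -
    have "(\<Prod>i\<in>I. exp (- \<bar>(x(j := y)) i\<bar>)) = (\<Prod>i\<in>I. exp (- \<bar>x i\<bar>))"
      using I(2) by (intro prod.cong) auto
    then show ?thesis unfolding I(3)[symmetric] prod.insert[OF I(1,2)] by simp
  qed
  have intD: "integrable (\<Pi>\<^sub>M i\<in>insert j I. lborel) (\<lambda>x. indicator (truncation_box p a b) x * D x)"
  proof (rule integrable_PiM_exp_bound)
    show "\<bar>indicator (truncation_box p a b) x * D x\<bar> \<le> C * (\<Prod>i\<in>insert j I. exp (- \<bar>x i\<bar>))" for x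
      using bdD[of x] unfolding I(3) by (auto simp: indicator_def)
  qed (use mD mbox I in auto)
  define E where "E t x = indicator X x * H (x(j := t))" for t x
  have mE: "E t \<in> borel_measurable (\<Pi>\<^sub>M i\<in>I. lborel)" for t
  proof -
    have "(\<lambda>x. x(j := t)) \<in> measurable (\<Pi>\<^sub>M i\<in>I. lborel) (\<Pi>\<^sub>M i\<in>insert j I. lborel :: real measure)"
      using I by (intro measurable_fun_upd[of _ I]) auto
    then have "(\<lambda>x. H (x(j := t))) \<in> borel_measurable (\<Pi>\<^sub>M i\<in>I. lborel)"
      using mH unfolding I(3) by (rule measurable_compose)
    then show ?thesis unfolding E_def using mX by simp
  qed
  have intE: "integrable (\<Pi>\<^sub>M i\<in>I. lborel) (E t)" for t
  proof (rule integrable_PiM_exp_bound[OF I(1) mE])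
    fix x :: "nat \<Rightarrow> real"
    have "\<bar>E t x\<bar> \<le> \<bar>H (x(j := t))\<bar>" by (auto simp: E_def indicator_def)
    also have "\<dots> \<le> (C * exp (- \<bar>t\<bar>)) * (\<Prod>i\<in>I. exp (- \<bar>x i\<bar>))"
      using bdH[of "x(j := t)"] unfolding prodI by (simp add: mult.assoc)
    finally show "\<bar>E t x\<bar> \<le> (C * exp (- \<bar>t\<bar>)) * (\<Prod>i\<in>I. exp (- \<bar>x i\<bar>))" .
  qed
  have LE: "(LINT x|(\<Pi>\<^sub>M i\<in>I. lborel). E t x) = B t" for t
  proof -
    have depE: "E t x = E t y" if "\<And>i. i \<in> {..<p} - {j} \<Longrightarrow> x i = y i" for x y
    proof -
      have "(x \<in> X) = (y \<in> X)" using that by (auto simp: X_def I_def)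
      moreover have "H (x(j := t)) = H (y(j := t))" using that by (intro dep) auto
      ultimately show ?thesis by (simp add: E_def indicator_def)
    qed
    have "(LINT x|(\<Pi>\<^sub>M i\<in>I. lborel). E t x) = (LINT x|(\<Pi>\<^sub>M i\<in>{..<p - 1}. lborel). E t (\<lambda>i. x (delete_index j i)))"
      unfolding I_def by (rule integral_PiM_delete_coord[OF j mE[unfolded I_def] depE])
    also have "\<dots> = B t" unfolding B_def
    proof (intro Bochner_Integration.integral_cong refl)
      fix x :: "nat \<Rightarrow> real"
      have "(\<lambda>i. x (delete_index j i)) \<in> X \<longleftrightarrow> x \<in> truncation_box (p - 1) (vec_delete j a) (vec_delete j b)"
      proof
        assume l: "(\<lambda>i. x (delete_index j i)) \<in> X"
        show "x \<in> truncation_box (p - 1) (vec_delete j a) (vec_delete j b)"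
          unfolding truncation_box_def
        proof (intro CollectI allI impI)
          fix i assume i: "i < p - 1"
          then have m: "insert_index j i \<in> I" "delete_index j (insert_index j i) = i"
            using j by (auto simp: I_def insert_index_def delete_index_def)
          show "vec_delete j a $ i \<le> ereal (x i) \<and> ereal (x i) \<le> vec_delete j b $ i"
            using l m i dims unfolding X_def by (auto simp: vec_delete_def insert_index_def dest!: bspec[of I _ "insert_index j i"])
        qed
      next
        assume r: "x \<in> truncation_box (p - 1) (vec_delete j a) (vec_delete j b)"
        show "(\<lambda>i. x (delete_index j i)) \<in> X" unfolding X_def
        proof (intro CollectI ballI)
          fix i assume i: "i \<in> I"
          then have m: "delete_index j i < p - 1" "insert_index j (delete_index j i) = i"
            using j by (auto simp: I_def insert_index_def delete_index_def)
          then show "a $ i \<le> ereal (x (delete_index j i)) \<and> ereal (x (delete_index j i)) \<le> b $ i"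
            using r dims unfolding truncation_box_def vec_delete_def by (auto simp: insert_index_def dest!: spec[of _ "delete_index j i"])
        qed
      qed
      moreover have "(\<lambda>i. x (delete_index j i))(j := t) = insert_coord j t x" by (auto simp: insert_coord_def)
      ultimately show "E t (\<lambda>i. x (delete_index j i)) = 
          indicator (truncation_box (p - 1) (vec_delete j a) (vec_delete j b)) x * H (insert_coord j t x)"
        by (simp add: E_def indicator_def)
    qed
    finally show ?thesis .
  qed
  have "(LINT x|(\<Pi>\<^sub>M i\<in>{..<p}. lborel). indicator (truncation_box p a b) x * D x) = 
     (LINT x|(\<Pi>\<^sub>M i\<in>I. lborel). (LINT y|lborel. indicator (truncation_box p a b) (x(j := y)) * D (x(j := y))))"
    using lborel_prod.product_integral_insert[OF I(1,2) intD] I(3) by simp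
  also have "\<dots> = (LINT x|(\<Pi>\<^sub>M i\<in>I. lborel). (if b $ j = \<infinity> then 0 else E (real_of_ereal (b $ j)) x)
      - (if a $ j = -\<infinity> then 0 else E (real_of_ereal (a $ j)) x))"
  proof (intro Bochner_Integration.integral_cong refl)
    fix x :: "nat \<Rightarrow> real"
    define C' where "C' = C * (\<Prod>i\<in>I. exp (- \<bar>x i\<bar>))"
    have "(LINT y|lborel. indicator (truncation_box p a b) (x(j := y)) * D (x(j := y))) = 
        indicator X x * (LINT y|lborel. indicator {y. a $ j \<le> ereal y \<and> ereal y \<le> b $ j} y * D (x(j := y)))"
      by (simp add: ind mult.assoc)
    also have "(LINT y|lborel. indicator {y. a $ j \<le> ereal y \<and> ereal y \<le> b $ j} y * D (x(j := y))) = 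
       (if b $ j = \<infinity> then 0 else H (x(j := real_of_ereal (b $ j)))) - 
       (if a $ j = -\<infinity> then 0 else H (x(j := real_of_ereal (a $ j))))"
    proof (rule integral_truncated_derivative[OF ab der cont])
      show "\<bar>H (x(j := y))\<bar> \<le> C' * exp (- \<bar>y\<bar>)" for y
        using bdH[of "x(j := y)"] unfolding prodI C'_def by (simp add: mult_ac)
      show "\<bar>D (x(j := y))\<bar> \<le> C' * exp (- \<bar>y\<bar>)" for y
        using bdD[of "x(j := y)"] unfolding prodI C'_def by (simp add: mult_ac)
    qed
    also have "indicator X x * \<dots> = (if b $ j = \<infinity> then 0 else E (real_of_ereal (b $ j)) x)
      - (if a $ j = -\<infinity> then 0 else E (real_of_ereal (a $ j)) x)"
      by (simp add: E_def right_diff_distrib)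
    finally show "(LINT y|lborel. indicator (truncation_box p a b) (x(j := y)) * D (x(j := y))) = 
       (if b $ j = \<infinity> then 0 else E (real_of_ereal (b $ j)) x)
      - (if a $ j = -\<infinity> then 0 else E (real_of_ereal (a $ j)) x)" .
  qed
  also have "\<dots> = (if b $ j = \<infinity> then 0 else B (real_of_ereal (b $ j))) - 
    (if a $ j = -\<infinity> then 0 else B (real_of_ereal (a $ j)))"
    using intE by (auto simp: LE)
  finally show ?thesis .
qed

section \<open>Polynomial growth against Gaussian decay\<close>

text \<open>
  Growth is measured by a product over coordinates, so that it can be compared factor by factor with a
  product of univariate Gaussian functions.  Bounded factors are covered by \<open>N = 0\<close>.
\<close>

definition poly_growth :: "nat \<Rightarrow> ((nat \<Rightarrow> real) \<Rightarrow> real) \<Rightarrow> bool" where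
  "poly_growth p q \<longleftrightarrow> (\<exists>K N. 0 \<le> K \<and> (\<forall>x. \<bar>q x\<bar> \<le> K * (\<Prod>i<p. (1 + \<bar>x i\<bar>) ^ N)))"

lemma poly_growthI:
  "0 \<le> K \<Longrightarrow> (\<And>x. \<bar>q x\<bar> \<le> K * (\<Prod>i<p. (1 + \<bar>x i\<bar>) ^ N)) \<Longrightarrow> poly_growth p q"
  by (auto simp: poly_growth_def)

lemma poly_growth_bounded:
  assumes "\<And>x. \<bar>q x\<bar> \<le> K" shows "poly_growth p q"
  using assms order_trans[OF abs_ge_zero assms] by (intro poly_growthI[where K = K and N = 0]) auto

lemma poly_growth_const: "poly_growth p (\<lambda>_. c)"
  by (rule poly_growth_bounded[of _ "\<bar>c\<bar>"]) simp

lemma poly_growth_coord: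
  assumes "k < p" shows "poly_growth p (\<lambda>x. x k)"
proof (rule poly_growthI[where K = 1 and N = 1])
  fix x :: "nat \<Rightarrow> real"
  have "\<bar>x k\<bar> \<le> (1 + \<bar>x k\<bar>) * 1" by simp
  also have "\<dots> \<le> (1 + \<bar>x k\<bar>) * (\<Prod>i\<in>{..<p} - {k}. 1 + \<bar>x i\<bar>)"
    by (intro mult_left_mono prod_ge_1) auto
  also have "\<dots> = (\<Prod>i<p. 1 + \<bar>x i\<bar>)" using assms by (subst prod.remove[of _ k]) auto
  finally show "\<bar>x k\<bar> \<le> 1 * (\<Prod>i<p. (1 + \<bar>x i\<bar>) ^ 1)" by simp
qed simp

lemma poly_growth_mult:
  assumes "poly_growth p q" "poly_growth p r" shows "poly_growth p (\<lambda>x. q x * r x)"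
proof -
  obtain K N K' N' where K: "0 \<le> K" "\<And>x. \<bar>q x\<bar> \<le> K * (\<Prod>i<p. (1 + \<bar>x i\<bar>) ^ N)"
    "0 \<le> K'" "\<And>x. \<bar>r x\<bar> \<le> K' * (\<Prod>i<p. (1 + \<bar>x i\<bar>) ^ N')"
    using assms by (auto simp: poly_growth_def)
  show ?thesis
  proof (rule poly_growthI[where K = "K * K'" and N = "N + N'"])
    fix x
    have "\<bar>q x * r x\<bar> \<le> (K * (\<Prod>i<p. (1 + \<bar>x i\<bar>) ^ N)) * (K' * (\<Prod>i<p. (1 + \<bar>x i\<bar>) ^ N'))"
      unfolding abs_mult by (rule mult_mono[OF K(2,4)]) (use K in \<open>auto intro!: mult_nonneg_nonneg prod_nonneg\<close>)
    then show "\<bar>q x * r x\<bar> \<le> K * K' * (\<Prod>i<p. (1 + \<bar>x i\<bar>) ^ (N + N'))"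
      by (simp add: power_add prod.distrib mult_ac)
  qed (use K in auto)
qed

lemma poly_growth_add:
  assumes "poly_growth p q" "poly_growth p r" shows "poly_growth p (\<lambda>x. q x + r x)"
proof -
  obtain K N K' N' where K: "0 \<le> K" "\<And>x. \<bar>q x\<bar> \<le> K * (\<Prod>i<p. (1 + \<bar>x i\<bar>) ^ N)"
    "0 \<le> K'" "\<And>x. \<bar>r x\<bar> \<le> K' * (\<Prod>i<p. (1 + \<bar>x i\<bar>) ^ N')"
    using assms by (auto simp: poly_growth_def)
  show ?thesis
  proof (rule poly_growthI[where K = "K + K'" and N = "N + N'"])
    fix x :: "nat \<Rightarrow> real"
    have m: "(\<Prod>i<p. (1 + \<bar>x i\<bar>) ^ n) \<le> (\<Prod>i<p. (1 + \<bar>x i\<bar>) ^ (N + N'))" if "n \<le> N + N'" for n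
      using that by (intro prod_mono conjI power_increasing) auto
    have "\<bar>q x + r x\<bar> \<le> K * (\<Prod>i<p. (1 + \<bar>x i\<bar>) ^ N) + K' * (\<Prod>i<p. (1 + \<bar>x i\<bar>) ^ N')"
      using K(2)[of x] K(4)[of x] by linarith
    also have "\<dots> \<le> K * (\<Prod>i<p. (1 + \<bar>x i\<bar>) ^ (N + N')) + K' * (\<Prod>i<p. (1 + \<bar>x i\<bar>) ^ (N + N'))"
      using K by (intro add_mono mult_left_mono m) auto
    finally show "\<bar>q x + r x\<bar> \<le> (K + K') * (\<Prod>i<p. (1 + \<bar>x i\<bar>) ^ (N + N'))" by (simp add: distrib_right)
  qed (use K in auto)
qed

lemma poly_growth_diff:
  assumes "poly_growth p q" "poly_growth p r" shows "poly_growth p (\<lambda>x. q x - r x)"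
  using poly_growth_add[OF assms(1) poly_growth_mult[OF poly_growth_const[of p "-1"] assms(2)]] by simp

lemma poly_growth_sum:
  assumes "\<And>i. i \<in> A \<Longrightarrow> poly_growth p (q i)" shows "poly_growth p (\<lambda>x. \<Sum>i\<in>A. q i x)"
  using assms by (induction A rule: infinite_finite_induct) (auto intro: poly_growth_const poly_growth_add)

lemma poly_growth_power:
  assumes "poly_growth p q" shows "poly_growth p (\<lambda>x. q x ^ n)"
  by (induction n) (auto intro: poly_growth_const poly_growth_mult assms)

lemma poly_growth_prod:
  assumes "\<And>i. i \<in> A \<Longrightarrow> poly_growth p (q i)" shows "poly_growth p (\<lambda>x. \<Prod>i\<in>A. q i x)"
  using assms by (induction A rule: infinite_finite_induct) (auto intro: poly_growth_const poly_growth_mult)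

lemmas poly_growth_intros = poly_growth_const poly_growth_coord poly_growth_mult poly_growth_add 
  poly_growth_diff poly_growth_sum poly_growth_power poly_growth_prod

text \<open>
  Use \<open>(1 + |x|)\<^sup>N \<le> N! exp (1 + |x|)\<close>, \<open>(x - m)\<^sup>2 \<ge> x\<^sup>2 / 2 - m\<^sup>2\<close> and
  \<open>2 |x| - x\<^sup>2 / (2 s) \<le> 2 s\<close>; the last is a completed square.
\<close>

lemma poly_gauss_le_exp:
  fixes s m :: real assumes s: "s > 0"
  shows "\<exists>C\<ge>0. \<forall>x. (1 + \<bar>x\<bar>) ^ N * exp (- (x - m)\<^sup>2 / s) \<le> C * exp (- \<bar>x\<bar>)"
proof (intro exI conjI allI)
  let ?C = "fact N * exp (1 + m\<^sup>2 / s + 2 * s)"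
  show "?C \<ge> 0" by simp
  fix x :: real
  have "(1 + \<bar>x\<bar>) ^ N / fact N \<le> exp (1 + \<bar>x\<bar>)"
    using sum_le_suminf[OF summable_exp[of "1 + \<bar>x\<bar>"], of "{N}"]
    by (simp add: exp_def divide_inverse mult.commute)
  then have 1: "(1 + \<bar>x\<bar>) ^ N \<le> fact N * exp (1 + \<bar>x\<bar>)" by (simp add: divide_le_eq mult.commute)
  have "x\<^sup>2 / 2 - m\<^sup>2 \<le> (x - m)\<^sup>2" using zero_le_power2[of "x - 2 * m"] by (simp add: power2_eq_square algebra_simps)
  then have "- (x - m)\<^sup>2 / s \<le> - (x\<^sup>2 / 2 - m\<^sup>2) / s" using s by (intro divide_right_mono) auto
  moreover have "2 * \<bar>x\<bar> - x\<^sup>2 / (2 * s) \<le> 2 * s"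
    using zero_le_power2[of "\<bar>x\<bar> - 2 * s"] s by (simp add: power2_diff field_simps)(simp add: power2_eq_square)
  ultimately have "(1 + \<bar>x\<bar>) + - (x - m)\<^sup>2 / s \<le> (1 + m\<^sup>2 / s + 2 * s) + - \<bar>x\<bar>"
    by (simp add: diff_divide_distrib)
  then have 2: "exp (1 + \<bar>x\<bar>) * exp (- (x - m)\<^sup>2 / s) \<le> exp (1 + m\<^sup>2 / s + 2 * s) * exp (- \<bar>x\<bar>)"
    by (simp only: exp_add[symmetric] exp_le_cancel_iff)
  have "(1 + \<bar>x\<bar>) ^ N * exp (- (x - m)\<^sup>2 / s) \<le> fact N * exp (1 + \<bar>x\<bar>) * exp (- (x - m)\<^sup>2 / s)"
    using 1 by (rule mult_right_mono) simp
  also have "\<dots> \<le> fact N * (exp (1 + m\<^sup>2 / s + 2 * s) * exp (- \<bar>x\<bar>))"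
    unfolding mult.assoc using 2 by (rule mult_left_mono) simp
  finally show "(1 + \<bar>x\<bar>) ^ N * exp (- (x - m)\<^sup>2 / s) \<le> ?C * exp (- \<bar>x\<bar>)" by (simp add: mult.assoc)
qed

lemma mvn_density_vec:
  assumes "\<mu> \<in> carrier_vec p" "pos_def_mat p S"
  shows "mvn_density \<mu> S (vec p x) = 
    exp (- (\<Sum>i<p. (x i - \<mu> $ i) * (\<Sum>k<p. inv_mat S $$ (i,k) * (x k - \<mu> $ k))) / 2) / sqrt ((2 * pi) ^ p * det S)"
proof -
  note I = inv_mat_inverse(1)[OF pos_def_carrier[OF assms(2)] pos_def_det[OF assms(2)]]
  have "(vec p x - \<mu>) \<bullet> (inv_mat S *\<^sub>v (vec p x - \<mu>)) = 
      (\<Sum>i<p. (x i - \<mu> $ i) * (\<Sum>k<p. inv_mat S $$ (i,k) * (x k - \<mu> $ k)))"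
    using I assms(1) by (auto simp: scalar_prod_def lessThan_atLeast0 intro!: sum.cong)
  then show ?thesis using assms(1) by (simp add: mvn_density_def)
qed

text \<open>
  By coercivity of \<open>S\<inverse>\<close> the normal density is at most a constant times a product of univariate
  Gaussian factors, and each of these absorbs the polynomial factor in its own coordinate.
\<close>

lemma poly_growth_mvn_bound:
  assumes mu: "\<mu> \<in> carrier_vec p" and S: "pos_def_mat p S" and q: "poly_growth p q"
  shows "\<exists>C. \<forall>x. \<bar>q x * mvn_density \<mu> S (vec p x)\<bar> \<le> C * (\<Prod>i<p. exp (- \<bar>x i\<bar>))"
proof -
  define A where "A = inv_mat S"
  have A: "pos_def_mat p A" unfolding A_def by (rule pos_def_inverse[OF S])
  obtain K0 where K0: "K0 > 0" "\<And>z i. z \<in> carrier_vec p \<Longrightarrow> i < p \<Longrightarrow> (z $ i)\<^sup>2 \<le> K0 * (z \<bullet> (A *\<^sub>v z))"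
    using pos_def_coercive[OF A] by blast
  \<comment> \<open>averaging the coordinate bounds costs a factor \<open>p\<close>; \<open>p + 1\<close> keeps \<open>s\<close> positive in dimension 0\<close>
  define s where "s = 2 * (real p + 1) * K0"
  have s: "s > 0" using K0 by (simp add: s_def)
  define c where "c = \<bar>1 / sqrt ((2 * pi) ^ p * det S)\<bar>"
  have mvn: "\<bar>mvn_density \<mu> S (vec p x)\<bar> \<le> c * (\<Prod>i<p. exp (- (x i - \<mu> $ i)\<^sup>2 / s))" for x
  proof -
    define z where "z = vec p x - \<mu>"
    have z: "z \<in> carrier_vec p" using mu by (simp add: z_def)
    have "(\<Sum>i<p. (z $ i)\<^sup>2) \<le> p * (K0 * (z \<bullet> (A *\<^sub>v z)))"
      using sum_bounded_above[of "{..<p}" "\<lambda>i. (z $ i)\<^sup>2"] K0(2)[OF z] by simp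
    also have "\<dots> \<le> (p + 1) * (K0 * (z \<bullet> (A *\<^sub>v z)))"
      using pos_def_nonneg[OF A z] K0 by (intro mult_right_mono) auto
    finally have "(\<Sum>i<p. (z $ i)\<^sup>2) / s \<le> (z \<bullet> (A *\<^sub>v z)) / 2"
      using s K0 by (simp add: s_def field_simps)
    then have "exp (- (z \<bullet> (A *\<^sub>v z)) / 2) \<le> exp (\<Sum>i<p. - (z $ i)\<^sup>2 / s)"
      by (simp add: sum_negf sum_divide_distrib)
    also have "\<dots> = (\<Prod>i<p. exp (- (x i - \<mu> $ i)\<^sup>2 / s))"
      unfolding exp_sum[OF finite_lessThan] using mu by (intro prod.cong) (auto simp: z_def)
    finally show ?thesis
      using mu by (simp add: mvn_density_def c_def abs_mult abs_divide divide_right_mono flip: z_def A_def)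
  qed
  obtain K N where K: "0 \<le> K" "\<And>x. \<bar>q x\<bar> \<le> K * (\<Prod>i<p. (1 + \<bar>x i\<bar>) ^ N)"
    using q by (auto simp: poly_growth_def)
  obtain C where C: "\<And>i. C i \<ge> 0" "\<And>i x. (1 + \<bar>x\<bar>) ^ N * exp (- (x - \<mu> $ i)\<^sup>2 / s) \<le> C i * exp (- \<bar>x\<bar>)"
  proof -
    have "\<forall>i. \<exists>C\<ge>0. \<forall>x. (1 + \<bar>x\<bar>) ^ N * exp (- (x - \<mu> $ i)\<^sup>2 / s) \<le> C * exp (- \<bar>x\<bar>)"
      using poly_gauss_le_exp[OF s] by blast
    then show ?thesis using that by metis
  qed
  have "\<bar>q x * mvn_density \<mu> S (vec p x)\<bar> \<le> (K * c * (\<Prod>i<p. C i)) * (\<Prod>i<p. exp (- \<bar>x i\<bar>))" for x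
  proof -
    have "\<bar>q x * mvn_density \<mu> S (vec p x)\<bar> \<le> (K * (\<Prod>i<p. (1 + \<bar>x i\<bar>) ^ N)) * (c * (\<Prod>i<p. exp (- (x i - \<mu> $ i)\<^sup>2 / s)))"
      unfolding abs_mult by (rule mult_mono[OF K(2) mvn]) (use K in \<open>auto intro!: mult_nonneg_nonneg prod_nonneg\<close>)
    also have "\<dots> = K * c * (\<Prod>i<p. (1 + \<bar>x i\<bar>) ^ N * exp (- (x i - \<mu> $ i)\<^sup>2 / s))"
      by (simp add: prod.distrib)
    also have "\<dots> \<le> K * c * (\<Prod>i<p. C i * exp (- \<bar>x i\<bar>))"
      using K C by (intro mult_left_mono prod_mono conjI) (auto simp: c_def)
    finally show ?thesis by (simp add: prod.distrib mult.assoc)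
  qed
  then show ?thesis by blast
qed

section \<open>Derivatives along a coordinate\<close>

lemma has_derivative_fun_upd [derivative_intros]:
  "((\<lambda>y. (x(j := y)) k) has_real_derivative (if k = j then 1 else 0)) (at (y :: real))"
  by (cases "k = j") auto

lemma continuous_on_fun_upd [continuous_intros]:
  "continuous_on UNIV (\<lambda>y. (x(j := y)) k :: real)"
  by (cases "k = j") auto

text \<open>
  Near \<open>x\<close> the distribution function differs by a constant from the integral of the density
  over an interval starting at \<open>x - 1\<close>.
\<close>

lemma std_normal_cdf_has_derivative:
  "(std_normal_cdf has_real_derivative std_normal_density x) (at x)"
proof -
  interpret N: real_distribution std_normal_distribution by (rule real_dist_normal_dist)
  define G where "G u = integral {x - 1..u} std_normal_density" for u
  have c: "continuous_on A std_normal_density" for A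
    by (auto simp: std_normal_density_def intro!: continuous_intros)
  have eq: "std_normal_cdf u = std_normal_cdf (x - 1) + G u" if "u \<in> {x - 1<..<x + 1}" for u
  proof -
    have "std_normal_cdf u - std_normal_cdf (x - 1) = measure std_normal_distribution {x - 1<..u}"
      using that unfolding std_normal_cdf_def by (intro N.cdf_diff_eq) simp
    also have "\<dots> = (LINT t:{x - 1<..u}|lborel. std_normal_density t)"
    proof -
      have "measure std_normal_distribution {x - 1<..u} = (LINT t|std_normal_distribution. indicator {x - 1<..u} t)"
        by simp
      also have "\<dots> = (LINT t|lborel. std_normal_density t *\<^sub>R indicator {x - 1<..u} t)"
        by (rule integral_density) auto
      finally show ?thesis by (simp add: set_lebesgue_integral_def mult.commute)
    qed
    also have "\<dots> = (LINT t:{x - 1..u}|lborel. std_normal_density t)"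
      unfolding set_lebesgue_integral_def 
      by (intro integral_cong_AE) (use AE_lborel_singleton[of "x - 1"] in \<open>auto elim!: eventually_mono simp: indicator_def\<close>)
    also have "\<dots> = G u" unfolding G_def
      by (intro set_borel_integral_eq_integral borel_integrable_atLeastAtMost' c)
    finally show ?thesis by simp
  qed
  have "(G has_vector_derivative std_normal_density x) (at x within {x - 1..x + 1})"
    unfolding G_def by (rule integral_has_vector_derivative[OF c]) auto
  then have "(G has_real_derivative std_normal_density x) (at x)"
    by (simp add: has_real_derivative_iff_has_vector_derivative at_within_Icc_at)
  then have "((\<lambda>u. std_normal_cdf (x - 1) + G u) has_real_derivative std_normal_density x) (at x)"
    by (auto intro!: derivative_eq_intros)
  then show ?thesis
    by (rule has_field_derivative_transform_within_open[of _ _ _ "{x - 1<..<x + 1}"]) (auto simp: eq)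
qed

lemma std_normal_cdf_le_1: "std_normal_cdf x \<le> 1"
proof -
  interpret N: real_distribution std_normal_distribution by (rule real_dist_normal_dist)
  show ?thesis unfolding std_normal_cdf_def cdf_def by simp
qed

lemma std_normal_density_le_1: "std_normal_density x \<le> 1"
proof -
  have "exp (- x\<^sup>2 / 2) \<le> 1" by simp
  moreover have "1 \<le> sqrt (2 * pi)" using pi_gt3 by simp
  ultimately have "exp (- x\<^sup>2 / 2) \<le> sqrt (2 * pi)" by (rule order_trans)
  then show ?thesis by (simp add: std_normal_density_def)
qed

text \<open>
  The symmetry of \<open>S\<inverse>\<close> makes the two contributions of the quadratic form equal, which cancels the
  factor \<open>1/2\<close> in the exponent.
\<close>

lemma mvn_density_coord_derivative:
  assumes mu: "\<mu> \<in> carrier_vec p" and S: "pos_def_mat p S" and j: "j < p"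
  shows "((\<lambda>y. mvn_density \<mu> S (vec p (x(j := y)))) has_real_derivative
    - (\<Sum>k<p. inv_mat S $$ (j,k) * ((x(j := y)) k - \<mu> $ k)) * mvn_density \<mu> S (vec p (x(j := y)))) (at y)"
proof -
  define A where "A = inv_mat S"
  have A: "pos_def_mat p A" unfolding A_def by (rule pos_def_inverse[OF S])
  define z where "z i y = (x(j := y)) i - \<mu> $ i" for i y
  define \<delta> :: "nat \<Rightarrow> real" where "\<delta> i = (if i = j then 1 else 0)" for i
  have dz: "((\<lambda>y. z i y) has_real_derivative \<delta> i) (at y)" for i y
    unfolding z_def \<delta>_def by (auto intro!: derivative_eq_intros)
  have dq: "((\<lambda>y. \<Sum>i<p. z i y * (\<Sum>k<p. A $$ (i,k) * z k y)) has_real_derivative 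
      (\<Sum>i<p. \<delta> i * (\<Sum>k<p. A $$ (i,k) * z k y) + (\<Sum>k<p. A $$ (i,k) * \<delta> k) * z i y)) (at y)"
    by (intro DERIV_sum DERIV_mult DERIV_cmult dz)
  have "(\<Sum>i<p. \<delta> i * (\<Sum>k<p. A $$ (i,k) * z k y) + (\<Sum>k<p. A $$ (i,k) * \<delta> k) * z i y) =
      (\<Sum>i<p. if i = j then (\<Sum>k<p. A $$ (i,k) * z k y) else 0) + (\<Sum>i<p. A $$ (j,i) * z i y)"
    unfolding sum.distrib using j pos_def_sym_entry[OF A j]
    by (intro arg_cong2[of _ _ _ _ "(+)"] sum.cong) (auto simp: \<delta>_def if_distrib[of "(*) _"] cong: if_cong)
  also have "\<dots> = 2 * (\<Sum>k<p. A $$ (j,k) * z k y)" using j by simp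
  finally have e: "(\<Sum>i<p. \<delta> i * (\<Sum>k<p. A $$ (i,k) * z k y) + (\<Sum>k<p. A $$ (i,k) * \<delta> k) * z i y) = 
      2 * (\<Sum>k<p. A $$ (j,k) * z k y)" .
  have gen: "((\<lambda>y. exp (- Q y / 2) * c) has_real_derivative - d * (exp (- Q y / 2) * c)) (at y)"
    if "(Q has_real_derivative 2 * d) (at y)" for Q d c and y :: real
    using that by (auto intro!: derivative_eq_intros)
  from gen[OF dq[unfolded e], of "inverse (sqrt ((2 * pi) ^ p * det S))"]
  show ?thesis unfolding mvn_density_vec[OF mu S] z_def A_def divide_inverse[of "exp _"] .
qed

lemma monomial_coord_derivative:
  fixes \<kappa> :: "nat vec"
  assumes k: "\<kappa> \<in> carrier_vec p" and j: "j < p"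
  shows "((\<lambda>y. \<Prod>i<p. (x(j := y)) i ^ (\<kappa> $ i)) has_real_derivative
     real (\<kappa> $ j) * (\<Prod>i<p. (x(j := y)) i ^ ((\<kappa> - unit_vec p j) $ i))) (at y)"
proof -
  define P where "P = (\<Prod>i\<in>{..<p} - {j}. x i ^ (\<kappa> $ i))"
  have 1: "(\<Prod>i<p. (x(j := y)) i ^ (\<kappa> $ i)) = y ^ (\<kappa> $ j) * P" for y
    using j by (subst prod.remove[of _ j]) (auto simp: P_def intro!: prod.cong)
  have "(\<Prod>i\<in>{..<p} - {j}. (x(j := y)) i ^ ((\<kappa> - unit_vec p j) $ i)) = P"
    unfolding P_def using k j by (intro prod.cong) auto
  then have 2: "(\<Prod>i<p. (x(j := y)) i ^ ((\<kappa> - unit_vec p j) $ i)) = y ^ (\<kappa> $ j - 1) * P"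
    using k j by (subst prod.remove[of _ j]) auto
  show ?thesis unfolding 1 2 One_nat_def by (auto intro!: derivative_eq_intros)
qed

section \<open>The recurrence\<close>

text \<open>
  Functions of a point are taken on \<open>nat \<Rightarrow> real\<close>, where one coordinate can be varied by a function
  update.  The density has gradient \<open>h * skew_part - score * dens\<close>: the first summand comes from the
  skewing factor, the second from the normal density, whose score is \<open>S\<inverse> (x - \<mu>)\<close> up to sign.
\<close>

locale esn_parameters =
  fixes p :: nat and \<mu> l :: "real vec" and S :: "real mat" and \<tau> :: real
  assumes mu: "\<mu> \<in> carrier_vec p" and S: "pos_def_mat p S" and l: "l \<in> carrier_vec p"
begin

definition h :: "real vec" where "h = esn_phi S l"

definition skew :: "(nat \<Rightarrow> real) \<Rightarrow> real" where
  "skew x = \<tau> + (\<Sum>k<p. h $ k * (x k - \<mu> $ k))"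

definition gauss :: "(nat \<Rightarrow> real) \<Rightarrow> real" where
  "gauss x = mvn_density \<mu> S (vec p x)"

definition dens :: "(nat \<Rightarrow> real) \<Rightarrow> real" where
  "dens x = esn_density \<mu> S l \<tau> (vec p x)"

definition skew_part :: "(nat \<Rightarrow> real) \<Rightarrow> real" where
  "skew_part x = inverse (esn_xi l \<tau>) * std_normal_density (skew x) * gauss x"

definition score :: "nat \<Rightarrow> (nat \<Rightarrow> real) \<Rightarrow> real" where
  "score j x = (\<Sum>k<p. inv_mat S $$ (j,k) * (x k - \<mu> $ k))"

definition monomial :: "nat vec \<Rightarrow> (nat \<Rightarrow> real) \<Rightarrow> real" where
  "monomial \<kappa> x = (\<Prod>i<p. x i ^ (\<kappa> $ i))"

lemma h: "h \<in> carrier_vec p" "sqrt_mat S *\<^sub>v h = l" "sqrt_mat S *\<^sub>v l = S *\<^sub>v h"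
  using sqrt_mat_esn_phi[OF S l] by (simp_all add: h_def)

lemma skew_eq: "skew x = \<tau> + h \<bullet> (vec p x - \<mu>)"
  using mu by (simp add: skew_def scalar_prod_def lessThan_atLeast0)

lemma dens_eq: "dens x = inverse (esn_xi l \<tau>) * std_normal_cdf (skew x) * gauss x"
proof -
  have "esn_xi l \<tau> = std_normal_cdf (\<tau> / sqrt (1 + h \<bullet> (S *\<^sub>v h)))"
    using sqrt_mat_form[OF S h(1) h(1)] by (simp add: esn_xi_def h)
  then show ?thesis using esn_density_eq[OF S mu h(1), of "vec p x" \<tau>]
    by (simp add: dens_def gauss_def skew_eq h)
qed

lemma dens_coord_derivative:
  assumes j: "j < p"
  shows "((\<lambda>y. dens (x(j := y))) has_real_derivative 
    h $ j * skew_part (x(j := y)) - score j (x(j := y)) * dens (x(j := y))) (at y)"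
proof -
  have "((\<lambda>y. skew (x(j := y))) has_real_derivative (\<Sum>k<p. h $ k * (if k = j then 1 else 0))) (at y)"
    unfolding skew_def by (auto intro!: derivative_eq_intros sum.cong simp del: fun_upd_apply)
  then have "((\<lambda>y. skew (x(j := y))) has_real_derivative h $ j) (at y)"
    using j by (simp add: if_distrib[of "(*) _"] cong: if_cong)
  from DERIV_chain2[OF std_normal_cdf_has_derivative this]
  have 1: "((\<lambda>y. std_normal_cdf (skew (x(j := y)))) has_real_derivative 
      std_normal_density (skew (x(j := y))) * h $ j) (at y)" .
  have 2: "((\<lambda>y. gauss (x(j := y))) has_real_derivative - score j (x(j := y)) * gauss (x(j := y))) (at y)"
    unfolding gauss_def score_def by (rule mvn_density_coord_derivative[OF mu S j])
  show ?thesis unfolding dens_eq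
    by (rule DERIV_cong[OF DERIV_mult[OF DERIV_cmult[OF 1, of "inverse (esn_xi l \<tau>)"] 2]])
       (simp add: skew_part_def algebra_simps)
qed

lemma monom_coord_derivative:
  assumes "\<kappa> \<in> carrier_vec p" "j < p"
  shows "((\<lambda>y. monomial \<kappa> (x(j := y))) has_real_derivative real (\<kappa> $ j) * monomial (\<kappa> - unit_vec p j) (x(j := y))) (at y)"
  unfolding monomial_def by (rule monomial_coord_derivative[OF assms])

lemma measurable_coord: "k < p \<Longrightarrow> (\<lambda>x. x k) \<in> borel_measurable (\<Pi>\<^sub>M i\<in>{..<p}. lborel :: real measure)"
  using measurable_component_singleton[of k "{..<p}" "\<lambda>_. lborel :: real measure"] by simp

lemma measurable_affine: 
  "(\<lambda>x. \<Sum>k<p. c k * (x k - \<mu> $ k)) \<in> borel_measurable (\<Pi>\<^sub>M i\<in>{..<p}. lborel :: real measure)"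
  by (intro borel_measurable_sum borel_measurable_times borel_measurable_diff measurable_coord borel_measurable_const) auto

lemma measurable_monom: "monomial \<kappa> \<in> borel_measurable (\<Pi>\<^sub>M i\<in>{..<p}. lborel)"
  unfolding monomial_def[abs_def] by (intro borel_measurable_prod borel_measurable_power measurable_coord) auto

lemma measurable_skew: "skew \<in> borel_measurable (\<Pi>\<^sub>M i\<in>{..<p}. lborel)"
  unfolding skew_def[abs_def] by (intro borel_measurable_add measurable_affine) auto

lemma measurable_score: "score j \<in> borel_measurable (\<Pi>\<^sub>M i\<in>{..<p}. lborel)"
  unfolding score_def[abs_def] by (rule measurable_affine)

lemma measurable_gauss: "gauss \<in> borel_measurable (\<Pi>\<^sub>M i\<in>{..<p}. lborel)"
  unfolding gauss_def[abs_def] mvn_density_vec[OF mu S] divide_inverse minus_mult_left[symmetric]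
  by (intro borel_measurable_times borel_measurable_uminus borel_measurable_const borel_measurable_sum
      borel_measurable_diff measurable_coord measurable_affine borel_measurable_exp[THEN measurable_compose_rev]) auto

lemma continuous_std_normal_cdf: "continuous_on A std_normal_cdf"
  using std_normal_cdf_has_derivative by (meson DERIV_isCont continuous_at_imp_continuous_on)

lemma measurable_cdf_skew: "(\<lambda>x. std_normal_cdf (skew x)) \<in> borel_measurable (\<Pi>\<^sub>M i\<in>{..<p}. lborel)"
  by (rule measurable_compose[OF measurable_skew borel_measurable_continuous_onI[OF continuous_std_normal_cdf]])

lemma measurable_density_skew: 
  "(\<lambda>x. std_normal_density (skew x)) \<in> borel_measurable (\<Pi>\<^sub>M i\<in>{..<p}. lborel)"
  by (rule measurable_compose[OF measurable_skew]) auto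

lemma poly_growth_affine: "poly_growth p (\<lambda>x. \<Sum>k<p. c k * (x k - \<mu> $ k))"
  by (intro poly_growth_intros) auto

lemma poly_growth_monom: "poly_growth p (monomial \<kappa>)"
  unfolding monomial_def[abs_def] by (intro poly_growth_intros) auto

lemma poly_growth_score: "poly_growth p (score j)"
  unfolding score_def[abs_def] by (rule poly_growth_affine)

lemma poly_growth_cdf_skew: "poly_growth p (\<lambda>x. std_normal_cdf (skew x))"
  using std_normal_cdf_pos std_normal_cdf_le_1 by (intro poly_growth_bounded[of _ 1]) (simp add: abs_of_pos)

lemma poly_growth_density_skew: "poly_growth p (\<lambda>x. std_normal_density (skew x))"
  using std_normal_density_le_1 by (intro poly_growth_bounded[of _ 1]) simp

lemma measurable_box: 
  "(\<lambda>x. indicator (truncation_box p a b) x :: real) \<in> borel_measurable (\<Pi>\<^sub>M i\<in>{..<p}. lborel)"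
  using measurable_truncation_indicator[of p "{}" "{..<p}" a b] by (simp add: truncation_box_def Ball_def)

lemma integrable_growth_gauss:
  assumes q: "poly_growth p q" and m: "q \<in> borel_measurable (\<Pi>\<^sub>M i\<in>{..<p}. lborel)"
  shows "integrable (\<Pi>\<^sub>M i\<in>{..<p}. lborel) (\<lambda>x. indicator (truncation_box p a b) x * (q x * gauss x))"
proof -
  obtain C where C: "\<And>x. \<bar>q x * gauss x\<bar> \<le> C * (\<Prod>i<p. exp (- \<bar>x i\<bar>))"
    using poly_growth_mvn_bound[OF mu S q] by (auto simp: gauss_def)
  show ?thesis
  proof (rule integrable_PiM_exp_bound)
    show "\<bar>indicator (truncation_box p a b) x * (q x * gauss x)\<bar> \<le> C * (\<Prod>i<p. exp (- \<bar>x i\<bar>))" for x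
      using C[of x] order_trans[OF abs_ge_zero C[of x]] by (auto simp: indicator_def)
  qed (use m measurable_box measurable_gauss in auto)
qed

lemma esn_moment_eq:
  assumes "\<kappa> \<in> carrier_vec p"
  shows "esn_moment \<kappa> a b \<mu> S l \<tau> = 
    (LINT x|(\<Pi>\<^sub>M i\<in>{..<p}. lborel). indicator (truncation_box p a b) x * (monomial \<kappa> x * dens x))"
  using assms by (simp add: esn_moment_def box_moment_def set_lebesgue_integral_def truncation_box_def monomial_def dens_def)

text \<open>
  On the face \<open>x\<^sub>j = t\<close> both the monomial and the density factor into a function of \<open>t\<close> and a function of
  the other coordinates.
\<close>

lemma boundary_term_eq:
  assumes j: "j < p" and k: "\<kappa> \<in> carrier_vec p"
  shows "(LINT x|(\<Pi>\<^sub>M i\<in>{..<p - 1}. lborel). indicator (truncation_box (p - 1) (vec_delete j a) (vec_delete j b)) x *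
      (monomial \<kappa> (insert_coord j t x) * dens (insert_coord j t x))) = boundary_term \<kappa> a b \<mu> S l \<tau> j t"
proof -
  define e where "e = esn1_density (\<mu> $ j) (S $$ (j, j)) (esn_c S l j * sqrt (S $$ (j, j)) * cond_phi S l j) (esn_c S l j * \<tau>) t"
  define f where "f = esn_density (cond_mean \<mu> S j t) (cond_cov S j)
       (sqrt_mat (cond_cov S j) *\<^sub>v vec_delete j (esn_phi S l)) (cond_tau \<mu> S l \<tau> j t)"
  have "monomial \<kappa> (insert_coord j t x) * dens (insert_coord j t x) = 
     t ^ (\<kappa> $ j) * e * ((\<Prod>i<p - 1. x i ^ (vec_delete j \<kappa> $ i)) * f (vec (p - 1) x))" for x
  proof -
    have bij: "bij_betw (insert_index j) {..<p - 1} ({..<p} - {j})"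
      by (rule bij_betw_byWitness[where f' = "delete_index j"])
         (use j in \<open>auto simp: insert_index_def delete_index_def\<close>)
    have dl: "insert_coord j t x (insert_index j i) = x i" for i
      by (auto simp: insert_coord_def insert_index_def delete_index_def)
    have tj: "insert_coord j t x j = t" by (simp add: insert_coord_def)
    have "monomial \<kappa> (insert_coord j t x) = t ^ (\<kappa> $ j) * (\<Prod>i\<in>{..<p} - {j}. insert_coord j t x i ^ (\<kappa> $ i))"
      unfolding monomial_def using j by (subst prod.remove[of _ j]) (auto simp: tj)
    also have "(\<Prod>i\<in>{..<p} - {j}. insert_coord j t x i ^ (\<kappa> $ i)) = 
        (\<Prod>i<p - 1. insert_coord j t x (insert_index j i) ^ (\<kappa> $ insert_index j i))"
      by (rule prod.reindex_bij_betw[OF bij, symmetric])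
    also have "\<dots> = (\<Prod>i<p - 1. x i ^ (vec_delete j \<kappa> $ i))"
      using k by (intro prod.cong) (auto simp: dl vec_delete_index)
    finally have 1: "monomial \<kappa> (insert_coord j t x) = t ^ (\<kappa> $ j) * (\<Prod>i<p - 1. x i ^ (vec_delete j \<kappa> $ i))" .
    have "vec_delete j (vec p (insert_coord j t x)) = vec (p - 1) x"
      using j insert_index_less[OF j] by (intro eq_vecI) (auto simp: vec_delete_index dl)
    moreover have "vec p (insert_coord j t x) $ j = t" using j by (simp add: tj)
    ultimately have 2: "dens (insert_coord j t x) = e * f (vec (p - 1) x)"
      using esn_density_condition[OF S mu l j, of "vec p (insert_coord j t x)" \<tau>]
      by (simp add: dens_def e_def f_def)
    show ?thesis unfolding 1 2 by simp
  qed
  then have eq: "indicator (truncation_box (p - 1) (vec_delete j a) (vec_delete j b)) x *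
      (monomial \<kappa> (insert_coord j t x) * dens (insert_coord j t x)) =
      t ^ (\<kappa> $ j) * e * (indicator (truncation_box (p - 1) (vec_delete j a) (vec_delete j b)) x *
       ((\<Prod>i<p - 1. x i ^ (vec_delete j \<kappa> $ i)) * f (vec (p - 1) x)))" for x
    by simp
  show ?thesis unfolding eq using k
    by (simp add: boundary_term_def esn_moment_def box_moment_def set_lebesgue_integral_def 
        truncation_box_def Let_def flip: e_def f_def)
qed

text \<open>
  Integration by parts applied to \<open>x\<^sup>\<kappa> g\<close>: the part of its derivative that falls on the monomial is
  the first term of \<open>esn_d\<close>, the faces are the other two.
\<close>

lemma integral_monom_partial_derivative:
  assumes j: "j < p" and k: "\<kappa> \<in> carrier_vec p" and ac: "a \<in> carrier_vec p" and bc: "b \<in> carrier_vec p"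
    and ab: "a $ j \<noteq> \<infinity>" "b $ j \<noteq> -\<infinity>" "a $ j \<le> b $ j"
  shows "(LINT x|(\<Pi>\<^sub>M i\<in>{..<p}. lborel). indicator (truncation_box p a b) x * 
      (monomial \<kappa> x * (h $ j * skew_part x - score j x * dens x))) = - esn_d \<kappa> a b \<mu> S l \<tau> $ j"
    (is "?J = _")
proof -
  let ?M = "\<Pi>\<^sub>M i\<in>{..<p}. lborel :: real measure"
  let ?I = "\<lambda>x. indicator (truncation_box p a b) x :: real"
  let ?x = "inverse (esn_xi l \<tau>)"
  define H where "H x = monomial \<kappa> x * dens x" for x
  define D1 where "D1 x = real (\<kappa> $ j) * (monomial (\<kappa> - unit_vec p j) x * dens x)" for x
  define D2 where "D2 x = monomial \<kappa> x * (h $ j * skew_part x - score j x * dens x)" for x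
  define q where "q x = monomial \<kappa> x * (?x * std_normal_cdf (skew x))" for x
  define q1 where "q1 x = real (\<kappa> $ j) * (monomial (\<kappa> - unit_vec p j) x * (?x * std_normal_cdf (skew x)))" for x
  define q2 where "q2 x = monomial \<kappa> x * (h $ j * (?x * std_normal_density (skew x)) - score j x * (?x * std_normal_cdf (skew x)))" for x
  note growth = poly_growth_intros poly_growth_monom poly_growth_score poly_growth_cdf_skew poly_growth_density_skew
  note meas = borel_measurable_times borel_measurable_add borel_measurable_diff borel_measurable_const
    measurable_monom measurable_score measurable_cdf_skew measurable_density_skew measurable_gauss
  have e: "H x = q x * gauss x" "D1 x = q1 x * gauss x" "D2 x = q2 x * gauss x" for x
    by (simp_all add: H_def D1_def D2_def q_def q1_def q2_def dens_eq skew_part_def algebra_simps)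
  have pg: "poly_growth p q" "poly_growth p q1" "poly_growth p q2"
    unfolding q_def[abs_def] q1_def[abs_def] q2_def[abs_def] by (intro growth)+
  have m: "q \<in> borel_measurable ?M" "q1 \<in> borel_measurable ?M" "q2 \<in> borel_measurable ?M"
    unfolding q_def[abs_def] q1_def[abs_def] q2_def[abs_def] by (intro meas)+
  have pg12: "poly_growth p (\<lambda>x. q1 x + q2 x)" using pg by (intro poly_growth_add)
  obtain C1 where C1: "\<And>x. \<bar>q x * gauss x\<bar> \<le> C1 * (\<Prod>i<p. exp (- \<bar>x i\<bar>))"
    using poly_growth_mvn_bound[OF mu S pg(1)] by (auto simp: gauss_def)
  obtain C2 where C2: "\<And>x. \<bar>(q1 x + q2 x) * gauss x\<bar> \<le> C2 * (\<Prod>i<p. exp (- \<bar>x i\<bar>))"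
    using poly_growth_mvn_bound[OF mu S pg12] by (auto simp: gauss_def)
  define C where "C = max C1 C2"
  have P: "(\<Prod>i<p. exp (- \<bar>x i\<bar>)) \<ge> 0" for x :: "nat \<Rightarrow> real" by (intro prod_nonneg) auto
  have "(LINT x|?M. ?I x * (D1 x + D2 x)) =
    (if b $ j = \<infinity> then 0 else boundary_term \<kappa> a b \<mu> S l \<tau> j (real_of_ereal (b $ j))) - 
    (if a $ j = -\<infinity> then 0 else boundary_term \<kappa> a b \<mu> S l \<tau> j (real_of_ereal (a $ j)))"
    unfolding boundary_term_eq[OF j k, symmetric] H_def[symmetric]
  proof (rule integral_box_partial_derivative[OF j ab])
    show "((\<lambda>y. H (x(j := y))) has_real_derivative D1 (x(j := y)) + D2 (x(j := y))) (at y)" for x y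
      unfolding H_def D1_def D2_def
      by (rule DERIV_cong[OF DERIV_mult[OF monom_coord_derivative[OF k j] dens_coord_derivative[OF j]]])
         (simp add: algebra_simps)
    show "continuous_on UNIV (\<lambda>y. D1 (x(j := y)) + D2 (x(j := y)))" for x
      unfolding e q1_def q2_def monomial_def skew_def score_def gauss_def mvn_density_vec[OF mu S] std_normal_density_def
      by (intro continuous_intros continuous_on_compose2[OF continuous_std_normal_cdf[of UNIV]]) 
         (use pos_def_det[OF S] in auto)
    show "\<bar>H x\<bar> \<le> C * (\<Prod>i<p. exp (- \<bar>x i\<bar>))" for x
      using C1[of x] mult_right_mono[OF _ P[of x], of C1 C] by (auto simp: e C_def)
    show "\<bar>D1 x + D2 x\<bar> \<le> C * (\<Prod>i<p. exp (- \<bar>x i\<bar>))" for x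
      using C2[of x] mult_right_mono[OF _ P[of x], of C2 C] by (auto simp: e C_def distrib_right)
    show "H \<in> borel_measurable ?M" unfolding e by (intro meas m)
    show "(\<lambda>x. D1 x + D2 x) \<in> borel_measurable ?M" unfolding e by (intro meas m)
    show "H x = H y" if "\<And>i. i < p \<Longrightarrow> x i = y i" for x y
    proof -
      have "vec p x = vec p y" using that by (intro eq_vecI) auto
      moreover have "monomial \<kappa> x = monomial \<kappa> y" unfolding monomial_def using that by (intro prod.cong) auto
      ultimately show ?thesis by (simp add: H_def dens_def)
    qed
  qed (use ac bc in auto)
  moreover have "(LINT x|?M. ?I x * (D1 x + D2 x)) = (LINT x|?M. ?I x * D1 x) + ?J"
    using integrable_growth_gauss[OF pg(2) m(2)] integrable_growth_gauss[OF pg(3) m(3)]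
    unfolding distrib_left e(2,3)[symmetric] D2_def by (rule Bochner_Integration.integral_add)
  moreover have "(LINT x|?M. ?I x * D1 x) = real (\<kappa> $ j) * esn_moment (\<kappa> - unit_vec p j) a b \<mu> S l \<tau>"
  proof -
    have eq: "?I x * D1 x = real (\<kappa> $ j) * (?I x * (monomial (\<kappa> - unit_vec p j) x * dens x))" for x
      by (simp add: D1_def)
    have "\<kappa> - unit_vec p j \<in> carrier_vec p" using k by simp
    then show ?thesis unfolding eq using esn_moment_eq[of "\<kappa> - unit_vec p j"] by simp
  qed
  ultimately show ?thesis using j k by (simp add: esn_d_def)
qed

lemma skew_part_eq:
  "skew_part x = esn_eta l \<tau> * mvn_density (\<mu> - esn_mu_b S l \<tau>) (esn_Gamma S l) (vec p x)"
  using mvn_density_mult_normal[OF S mu l, of "vec p x" \<tau>]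
  by (simp add: skew_part_def gauss_def skew_eq esn_eta_def h_def divide_inverse mult_ac)

lemma mvn_moment_skew_part:
  assumes "\<kappa> \<in> carrier_vec p"
  shows "(LINT x|(\<Pi>\<^sub>M i\<in>{..<p}. lborel). indicator (truncation_box p a b) x * (monomial \<kappa> x * skew_part x)) =
    esn_eta l \<tau> * mvn_moment \<kappa> a b (\<mu> - esn_mu_b S l \<tau>) (esn_Gamma S l)"
proof -
  have eq: "indicator (truncation_box p a b) x * (monomial \<kappa> x * skew_part x) = esn_eta l \<tau> *
    (indicator (truncation_box p a b) x * (monomial \<kappa> x * mvn_density (\<mu> - esn_mu_b S l \<tau>) (esn_Gamma S l) (vec p x)))" for x
    by (simp add: skew_part_eq)
  show ?thesis unfolding eq using assms
    by (simp add: mvn_moment_def box_moment_def set_lebesgue_integral_def truncation_box_def monomial_def)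
qed

lemma weighted_score:
  assumes i: "i < p"
  shows "(\<Sum>j<p. S $$ (i,j) * score j x) = x i - \<mu> $ i"
proof -
  note Sc = pos_def_carrier[OF S]
  note I = inv_mat_inverse[OF Sc pos_def_det[OF S]]
  define z where "z = vec p x - \<mu>"
  have z: "z \<in> carrier_vec p" using mu by (simp add: z_def)
  have s: "(inv_mat S *\<^sub>v z) $ j = score j x" if "j < p" for j
    using that I z mu by (simp add: score_def scalar_prod_def lessThan_atLeast0 z_def)
  have "(S *\<^sub>v (inv_mat S *\<^sub>v z)) $ i = (\<Sum>j<p. S $$ (i,j) * score j x)"
  proof -
    have "inv_mat S *\<^sub>v z \<in> carrier_vec p" using I z by simp
    moreover have "(S *\<^sub>v w) $ i = (\<Sum>j<p. S $$ (i,j) * w $ j)" if "w \<in> carrier_vec p" for w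
      using i Sc that by (simp add: scalar_prod_sum[of _ p])
    ultimately show ?thesis using s by simp
  qed
  then show ?thesis using inv_mat_mult_vec(2)[OF Sc pos_def_det[OF S] z] i mu by (simp add: z_def)
qed

text \<open>
  Contracting the gradient with row \<open>i\<close> of \<open>S\<close> undoes the inverse in the score, which is how
  \<open>x\<^sub>i\<close> enters.
\<close>

lemma weighted_gradient:
  assumes i: "i < p"
  shows "(\<Sum>j<p. S $$ (i,j) * (h $ j * skew_part x - score j x * dens x)) = 
    (S *\<^sub>v h) $ i * skew_part x - (x i - \<mu> $ i) * dens x"
proof -
  have "(S *\<^sub>v h) $ i = (\<Sum>j<p. S $$ (i,j) * h $ j)"
    using i h pos_def_carrier[OF S] by (simp add: scalar_prod_sum[of _ p])
  moreover have "(\<Sum>j<p. S $$ (i,j) * (h $ j * skew_part x - score j x * dens x)) =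
      (\<Sum>j<p. S $$ (i,j) * h $ j) * skew_part x - (\<Sum>j<p. S $$ (i,j) * score j x) * dens x"
    unfolding sum_distrib_right sum_subtractf[symmetric] by (intro sum.cong) (simp_all add: algebra_simps)
  ultimately show ?thesis by (simp add: weighted_score[OF i])
qed

lemma esn_moment_recurrence:
  assumes i: "i < p" and k: "\<kappa> \<in> carrier_vec p" and ac: "a \<in> carrier_vec p" and bc: "b \<in> carrier_vec p"
    and ab: "\<And>j. j < p \<Longrightarrow> a $ j \<noteq> \<infinity> \<and> b $ j \<noteq> -\<infinity> \<and> a $ j \<le> b $ j"
  shows "esn_moment (\<kappa> + unit_vec p i) a b \<mu> S l \<tau> =
    \<mu> $ i * esn_moment \<kappa> a b \<mu> S l \<tau>
    + esn_delta S l \<tau> $ i * mvn_moment \<kappa> a b (\<mu> - esn_mu_b S l \<tau>) (esn_Gamma S l)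
    + unit_vec p i \<bullet> (S *\<^sub>v esn_d \<kappa> a b \<mu> S l \<tau>)"
proof -
  let ?M = "\<Pi>\<^sub>M i\<in>{..<p}. lborel :: real measure"
  let ?I = "\<lambda>x. indicator (truncation_box p a b) x :: real"
  let ?x = "inverse (esn_xi l \<tau>)"
  let ?d = "esn_d \<kappa> a b \<mu> S l \<tau>"
  have d: "?d \<in> carrier_vec p" using k by (simp add: esn_d_def)
  note Sc = pos_def_carrier[OF S]
  note growth = poly_growth_intros poly_growth_monom poly_growth_score poly_growth_cdf_skew poly_growth_density_skew
  note meas = borel_measurable_times borel_measurable_add borel_measurable_diff borel_measurable_const
    measurable_monom measurable_score measurable_cdf_skew measurable_density_skew measurable_gauss
  have int_dens: "integrable ?M (\<lambda>x. ?I x * (monomial \<kappa>' x * dens x))" for \<kappa>'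
    using integrable_growth_gauss[of "\<lambda>x. monomial \<kappa>' x * (?x * std_normal_cdf (skew x))"]
    by (simp add: dens_eq mult.assoc growth meas)
  have int_skew: "integrable ?M (\<lambda>x. ?I x * (monomial \<kappa> x * skew_part x))"
    using integrable_growth_gauss[of "\<lambda>x. monomial \<kappa> x * (?x * std_normal_density (skew x))"]
    by (simp add: skew_part_def mult.assoc growth meas)
  have int_grad: "integrable ?M (\<lambda>x. ?I x * (monomial \<kappa> x * (h $ j * skew_part x - score j x * dens x)))" for j
  proof -
    have eq: "monomial \<kappa> x * (h $ j * skew_part x - score j x * dens x) =
        monomial \<kappa> x * (h $ j * (?x * std_normal_density (skew x)) - score j x * (?x * std_normal_cdf (skew x))) * gauss x" for x
      by (simp add: skew_part_def dens_eq algebra_simps)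
    show ?thesis unfolding eq by (intro integrable_growth_gauss growth meas)
  qed
  have mon: "monomial (\<kappa> + unit_vec p i) x = x i * monomial \<kappa> x" for x
    unfolding monomial_def using k i
    by (subst (1 2) prod.remove[of _ i]) (auto simp: power_add intro!: prod.cong)
  have pt: "?I x * (monomial (\<kappa> + unit_vec p i) x * dens x) = 
     \<mu> $ i * (?I x * (monomial \<kappa> x * dens x)) + (S *\<^sub>v h) $ i * (?I x * (monomial \<kappa> x * skew_part x))
     - (\<Sum>j<p. S $$ (i,j) * (?I x * (monomial \<kappa> x * (h $ j * skew_part x - score j x * dens x))))" for x
  proof -
    have "(\<Sum>j<p. S $$ (i,j) * (?I x * (monomial \<kappa> x * (h $ j * skew_part x - score j x * dens x)))) = 
        ?I x * monomial \<kappa> x * (\<Sum>j<p. S $$ (i,j) * (h $ j * skew_part x - score j x * dens x))"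
      by (simp add: sum_distrib_left mult_ac)
    then show ?thesis unfolding weighted_gradient[OF i] mon by (simp add: algebra_simps)
  qed
  have "esn_moment (\<kappa> + unit_vec p i) a b \<mu> S l \<tau> = 
      (LINT x|?M. ?I x * (monomial (\<kappa> + unit_vec p i) x * dens x))"
    using k by (intro esn_moment_eq) simp
  also have "\<dots> = \<mu> $ i * (LINT x|?M. ?I x * (monomial \<kappa> x * dens x)) 
      + (S *\<^sub>v h) $ i * (LINT x|?M. ?I x * (monomial \<kappa> x * skew_part x))
      - (\<Sum>j<p. S $$ (i,j) * (LINT x|?M. ?I x * (monomial \<kappa> x * (h $ j * skew_part x - score j x * dens x))))"
    unfolding pt using int_dens int_skew int_grad
    by (subst Bochner_Integration.integral_diff Bochner_Integration.integral_add Bochner_Integration.integral_sum;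
        auto)+
  also have "(\<Sum>j<p. S $$ (i,j) * (LINT x|?M. ?I x * (monomial \<kappa> x * (h $ j * skew_part x - score j x * dens x)))) = 
      (\<Sum>j<p. S $$ (i,j) * (- ?d $ j))"
    using ab by (intro sum.cong refl) (simp add: integral_monom_partial_derivative[OF _ k ac bc])
  also have "\<dots> = - (unit_vec p i \<bullet> (S *\<^sub>v ?d))"
    using i Sc d scalar_prod_left_unit[OF mult_mat_vec_carrier[OF Sc d] i]
    by (simp add: sum_negf) (simp add: scalar_prod_sum[of _ p])
  also have "(S *\<^sub>v h) $ i * (LINT x|?M. ?I x * (monomial \<kappa> x * skew_part x)) = 
      esn_delta S l \<tau> $ i * mvn_moment \<kappa> a b (\<mu> - esn_mu_b S l \<tau>) (esn_Gamma S l)"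
    unfolding mvn_moment_skew_part[OF k] using i Sc by (simp add: esn_delta_def h)
  finally show ?thesis by (simp add: esn_moment_eq[OF k])
qed

end

theorem theorem1:
  fixes p i :: nat and \<mu> l :: "real vec" and \<Sigma> :: "real mat" and \<tau> :: real
    and a b :: "ereal vec" and \<kappa> :: "nat vec"
  assumes "p \<ge> 1"
    and "\<mu> \<in> carrier_vec p" and "pos_def_mat p \<Sigma>" and "l \<in> carrier_vec p"
    and "a \<in> carrier_vec p" and "b \<in> carrier_vec p" and "\<kappa> \<in> carrier_vec p"
    and "\<And>j. j < p \<Longrightarrow> a $ j \<noteq> \<infinity> \<and> b $ j \<noteq> -\<infinity> \<and> a $ j \<le> b $ j"
    and "i < p"
  shows "esn_moment (\<kappa> + unit_vec p i) a b \<mu> \<Sigma> l \<tau> =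
    \<mu> $ i * esn_moment \<kappa> a b \<mu> \<Sigma> l \<tau>
    + esn_delta \<Sigma> l \<tau> $ i * mvn_moment \<kappa> a b (\<mu> - esn_mu_b \<Sigma> l \<tau>) (esn_Gamma \<Sigma> l)
    + unit_vec p i \<bullet> (\<Sigma> *\<^sub>v esn_d \<kappa> a b \<mu> \<Sigma> l \<tau>)"
proof -
  interpret esn_parameters p \<mu> l \<Sigma> \<tau> by unfold_locales (fact assms)+
  show ?thesis by (rule esn_moment_recurrence) (fact assms)+
qed

end
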